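(* Let $A$ be a Noetherian henselian local commutative ring with maximal ideal $\mathfrak m_A$ and residue field $\mathbf F$, let $R$ be an $A$-algebra, let $\rho:R\to M_n(A)$ be a morphism of $A$-algebras and put $T=\mathrm{tr}\,\rho:R\to A$. Assume that $n!$ is invertible in $A$ and that $$\rho \bmod \mathfrak m_A=\begin{pmatrix}\tau_1 & *\\ 0&\tau_2\end{pmatrix}$$ is a non-semisimple extension of $\tau_2$ by $\tau_1$, where $\tau_1,\tau_2$ are non-isomorphic absolutely irreducible representations of $R$ over $\mathbf F$ of dimensions $n_1,n_2$ with $n_1+n_2=n$. Suppose there exists an anti-automorphism $\tau:R\to R$ of $A$-algebras (i.e. $A$-linear with $\tau(xy)=\tau(y)\tau(x)$) with $\tau^2=\mathrm{id}$ such that $$T\circ\tau=T\quad\text{and}\quad \mathrm{tr}\,\tau_i\circ\tau=\mathrm{tr}\,\tau_i\quad (i=1,2).$$ Then $\mathcal A_{1,2}^T\cong\mathcal A_{2,1}^T$ as $A$-modules, and the ideal of reducibility $I_T$ of $T$ is a principal ideal of $A$.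
   Context: A pseudocharacter of dimension $d$ on an $A$-algebra $R$ is an $A$-linear map $R\to A$, central ($T(xy)=T(yx)$), with $T(1)=d$ and satisfying the $d$-dimensional pseudocharacter (Frobenius) identity, as traces of $d$-dimensional representations do. The ideal of reducibility $I_T$ of $T$ is the smallest ideal $I$ of $A$ such that $T$ mod $I$ is a sum $T_1+T_2$ of two pseudocharacters with $T_i\equiv \mathrm{tr}\,\tau_i$ mod $\mathfrak m_A$. The kernel of $T$ is the two-sided ideal $\ker T=\{x\in R:\ T(xy)=0\ \text{for all } y\in R\}$, and $R^T:=R/\ker T$; $T$ induces a map on $R^T$ still denoted $T$. Definition of $\mathcal A_{i,j}^T$: by Bellaïche–Chenevier there are orthogonal idempotents $e_1,e_2\in R^T$ with $e_1+e_2=1$ and $A$-algebra isomorphisms $\psi_i:e_iR^Te_i\to M_{n_i}(A)$ such that $T(e_i)=n_i$, $T(e_ixe_i)\equiv \mathrm{tr}\,\tau_i(x)$ mod $\mathfrak m_A$, $T(e_ixe_jye_i)\in\mathfrak m_A$ for $i\ne j$, $\psi_i$ lifts $\tau_i|_{e_iR^Te_i}$ and $T(x)=\mathrm{tr}\,\psi_i(x)$ for $x\in e_iR^Te_i$; when $\tau$ as in the claim exists, the $e_i$ can be and are chosen with $\tau(e_i)=e_i$. Let $E_i\in e_iR^Te_i$ be the element such that $\psi_i(E_i)$ is the elementary matrix with $1$ in position $(1,1)$ and $0$ elsewhere. Then $\mathcal A_{i,j}^T:=E_iR^TE_j\subset R^T$, an $A$-submodule. *)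

theory Defs
  imports
    "Jordan_Normal_Form.Matrix"
    "HOL-Computational_Algebra.Polynomial"
    "HOL-Algebra.Algebraic_Closure_Type"
    "HOL-Combinatorics.Combinatorics"
begin

section \<open>Noetherian and henselian local rings\<close>

text \<open>Ideals of a commutative ring are the submodules of the regular module.\<close>

abbreviation ring_ideal :: "'a::comm_ring_1 set \<Rightarrow> bool" where
  "ring_ideal \<equiv> Modules.module.subspace (*)"

abbreviation ideal_span :: "'a::comm_ring_1 set \<Rightarrow> 'a set" where
  "ideal_span \<equiv> Modules.module.span (*)"

definition principal_ideal :: "'a::comm_ring_1 set \<Rightarrow> bool" where
  "principal_ideal I \<longleftrightarrow> (\<exists>c. I = ideal_span {c})"

definition noetherian :: "'a::comm_ring_1 itself \<Rightarrow> bool" where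
  "noetherian _ \<longleftrightarrow>
     (\<forall>I :: 'a set. ring_ideal I \<longrightarrow> (\<exists>S. finite S \<and> I = ideal_span S))"

definition maximal_ideal :: "'a::comm_ring_1 set \<Rightarrow> bool" where
  "maximal_ideal M \<longleftrightarrow> ring_ideal M \<and> M \<noteq> UNIV \<and>
     (\<forall>J. ring_ideal J \<and> M \<subseteq> J \<longrightarrow> J = M \<or> J = UNIV)"

definition local_ring :: "'a::comm_ring_1 set \<Rightarrow> bool" where
  "local_ring \<mm> \<longleftrightarrow> maximal_ideal \<mm> \<and> (\<forall>M. maximal_ideal M \<longrightarrow> M = \<mm>)"

text \<open>The residue field is a field type together with a surjective ring homomorphism
  whose kernel is the maximal ideal.\<close>

definition residue_map :: "'a::comm_ring_1 set \<Rightarrow> ('a \<Rightarrow> 'f::field) \<Rightarrow> bool" where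
  "residue_map \<mm> \<pi> \<longleftrightarrow> comm_ring_hom \<pi> \<and> surj \<pi> \<and> (\<forall>a. \<pi> a = 0 \<longleftrightarrow> a \<in> \<mm>)"

text \<open>Hensel's lemma: coprime monic factorisations of the reduction of a monic polynomial
  lift. Here \<open>\<pi>\<close> is the residue map of a local ring.\<close>

definition henselian :: "('a::comm_ring_1 \<Rightarrow> 'f::field) \<Rightarrow> bool" where
  "henselian \<pi> \<longleftrightarrow>
     (\<forall>(f :: 'a poly) g0 h0.
        lead_coeff f = 1 \<and> lead_coeff g0 = 1 \<and> lead_coeff h0 = 1 \<and>
        map_poly \<pi> f = g0 * h0 \<and> coprime g0 h0 \<longrightarrow>
        (\<exists>g h. lead_coeff g = 1 \<and> lead_coeff h = 1 \<and> f = g * h \<and>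
               map_poly \<pi> g = g0 \<and> map_poly \<pi> h = h0))"


section \<open>Algebras and matrix representations\<close>

text \<open>An \<open>A\<close>-algebra is given by its structure map, a ring homomorphism from \<open>A\<close> into the
  centre; \<open>a\<close> acts on \<open>x\<close> as \<open>\<eta> a * x\<close>.\<close>

definition algebra_map :: "('a::comm_ring_1 \<Rightarrow> 'r::ring_1) \<Rightarrow> bool" where
  "algebra_map \<eta> \<longleftrightarrow> Ring_Hom.ring_hom \<eta> \<and> (\<forall>a x. \<eta> a * x = x * \<eta> a)"

definition mat_trace :: "'k::comm_monoid_add mat \<Rightarrow> 'k" where
  "mat_trace M = (\<Sum>i<dim_row M. M $$ (i, i))"

text \<open>Homomorphisms of \<open>A\<close>-algebras into the \<open>d \<times> d\<close> matrices over \<open>K\<close>, where \<open>K\<close> is an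
  \<open>A\<close>-algebra through \<open>c\<close>.\<close>

definition matrix_rep ::
  "('a::comm_ring_1 \<Rightarrow> 'r::ring_1) \<Rightarrow> ('a \<Rightarrow> 'k::comm_ring_1) \<Rightarrow> nat \<Rightarrow> ('r \<Rightarrow> 'k mat) \<Rightarrow> bool"
where
  "matrix_rep \<eta> c d \<rho> \<longleftrightarrow>
     (\<forall>x. \<rho> x \<in> carrier_mat d d) \<and>
     (\<forall>x y. \<rho> (x + y) = \<rho> x + \<rho> y) \<and>
     (\<forall>x y. \<rho> (x * y) = \<rho> x * \<rho> y) \<and>
     \<rho> 1 = 1\<^sub>m d \<and>
     (\<forall>a x. \<rho> (\<eta> a * x) = c a \<cdot>\<^sub>m \<rho> x)"

definition subrep :: "nat \<Rightarrow> ('r \<Rightarrow> 'k::field mat) \<Rightarrow> 'k vec set \<Rightarrow> bool" where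
  "subrep d \<sigma> W \<longleftrightarrow>
     W \<subseteq> carrier_vec d \<and> 0\<^sub>v d \<in> W \<and>
     (\<forall>v\<in>W. \<forall>w\<in>W. v + w \<in> W) \<and>
     (\<forall>c. \<forall>v\<in>W. c \<cdot>\<^sub>v v \<in> W) \<and>
     (\<forall>x. \<forall>v\<in>W. \<sigma> x *\<^sub>v v \<in> W)"

definition irreducible_rep :: "nat \<Rightarrow> ('r \<Rightarrow> 'k::field mat) \<Rightarrow> bool" where
  "irreducible_rep d \<sigma> \<longleftrightarrow>
     d > 0 \<and> (\<forall>W. subrep d \<sigma> W \<longrightarrow> W = {0\<^sub>v d} \<or> W = carrier_vec d)"

text \<open>Irreducible over every extension field, equivalently over an algebraic closure;
  \<open>to_ac\<close> embeds a field into its algebraic closure.\<close>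

definition abs_irreducible_rep :: "nat \<Rightarrow> ('r \<Rightarrow> 'k::field mat) \<Rightarrow> bool" where
  "abs_irreducible_rep d \<sigma> \<longleftrightarrow> irreducible_rep d (\<lambda>x. map_mat to_ac (\<sigma> x))"

definition semisimple_rep :: "nat \<Rightarrow> ('r \<Rightarrow> 'k::field mat) \<Rightarrow> bool" where
  "semisimple_rep d \<sigma> \<longleftrightarrow>
     (\<forall>W. subrep d \<sigma> W \<longrightarrow>
        (\<exists>W'. subrep d \<sigma> W' \<and> W \<inter> W' = {0\<^sub>v d} \<and>
              (\<forall>v\<in>carrier_vec d. \<exists>w\<in>W. \<exists>w'\<in>W'. v = w + w')))"

definition isomorphic_reps ::
  "nat \<Rightarrow> ('r \<Rightarrow> 'k::field mat) \<Rightarrow> nat \<Rightarrow> ('r \<Rightarrow> 'k mat) \<Rightarrow> bool" where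
  "isomorphic_reps d1 \<sigma>1 d2 \<sigma>2 \<longleftrightarrow>
     d1 = d2 \<and> (\<exists>P\<in>carrier_mat d1 d1. invertible_mat P \<and> (\<forall>x. P * \<sigma>1 x = \<sigma>2 x * P))"


section \<open>Pseudocharacters and the ideal of reducibility\<close>

text \<open>The term of the Frobenius identity at the permutation \<open>\<sigma>\<close>: the product over the cycles
  \<open>(j\<^sub>1 \<dots> j\<^sub>m)\<close> of \<open>\<sigma>\<close>, fixed points included, of \<open>T (x\<^bsub>j\<^sub>1\<^esub> * \<dots> * x\<^bsub>j\<^sub>m\<^esub>)\<close>. Each cycle is written
  starting at its least element, which is immaterial for central \<open>T\<close>.\<close>

definition cycle_product ::
  "('r::ring_1 \<Rightarrow> 'a::comm_ring_1) \<Rightarrow> nat \<Rightarrow> (nat \<Rightarrow> 'r) \<Rightarrow> (nat \<Rightarrow> nat) \<Rightarrow> 'a" where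
  "cycle_product T d x \<sigma> =
     (\<Prod>C \<in> orbit \<sigma> ` {..d}. T (prod_list (map x (Cycles.support \<sigma> (Min C)))))"

definition frobenius_sum ::
  "('r::ring_1 \<Rightarrow> 'a::comm_ring_1) \<Rightarrow> nat \<Rightarrow> (nat \<Rightarrow> 'r) \<Rightarrow> 'a" where
  "frobenius_sum T d x =
     (\<Sum>\<sigma> | \<sigma> permutes {..d}. of_int (sign \<sigma>) * cycle_product T d x \<sigma>)"

text \<open>A map from \<open>R\<close> to \<open>A / I\<close> is represented by a lift \<open>R \<Rightarrow> A\<close>, and equality in \<open>A / I\<close>
  becomes congruence modulo \<open>I\<close>. So this says that \<open>T\<close> induces a pseudocharacter of dimension
  \<open>d\<close> with values in \<open>A / I\<close>; for \<open>I = {0}\<close> it defines pseudocharacters with values in \<open>A\<close>.\<close>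

definition pseudocharacter_mod ::
  "('a::comm_ring_1 \<Rightarrow> 'r::ring_1) \<Rightarrow> 'a set \<Rightarrow> nat \<Rightarrow> ('r \<Rightarrow> 'a) \<Rightarrow> bool" where
  "pseudocharacter_mod \<eta> I d T \<longleftrightarrow>
     (\<forall>x y. T (x + y) - (T x + T y) \<in> I) \<and>
     (\<forall>a x. T (\<eta> a * x) - a * T x \<in> I) \<and>
     (\<forall>x y. T (x * y) - T (y * x) \<in> I) \<and>
     T 1 - of_nat d \<in> I \<and>
     (\<forall>x. frobenius_sum T d x \<in> I)"

text \<open>The condition \<open>I \<subseteq> \<mm>\<close> is what allows maps into \<open>A / I\<close> to be reduced modulo \<open>\<mm>\<close>.\<close>

definition splits_mod ::
  "('a::comm_ring_1 \<Rightarrow> 'r::ring_1) \<Rightarrow> 'a set \<Rightarrow> ('a \<Rightarrow> 'f::field) \<Rightarrow> ('r \<Rightarrow> 'a) \<Rightarrow>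
   nat \<Rightarrow> ('r \<Rightarrow> 'f mat) \<Rightarrow> nat \<Rightarrow> ('r \<Rightarrow> 'f mat) \<Rightarrow> 'a set \<Rightarrow> bool" where
  "splits_mod \<eta> \<mm> \<pi> T n1 \<tau>1 n2 \<tau>2 I \<longleftrightarrow>
     ring_ideal I \<and> I \<subseteq> \<mm> \<and>
     (\<exists>T1 T2. pseudocharacter_mod \<eta> I n1 T1 \<and> pseudocharacter_mod \<eta> I n2 T2 \<and>
        (\<forall>x. T x - (T1 x + T2 x) \<in> I) \<and>
        (\<forall>x. \<pi> (T1 x) = mat_trace (\<tau>1 x)) \<and>
        (\<forall>x. \<pi> (T2 x) = mat_trace (\<tau>2 x)))"

definition is_reducibility_ideal ::
  "('a::comm_ring_1 \<Rightarrow> 'r::ring_1) \<Rightarrow> 'a set \<Rightarrow> ('a \<Rightarrow> 'f::field) \<Rightarrow> ('r \<Rightarrow> 'a) \<Rightarrow>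
   nat \<Rightarrow> ('r \<Rightarrow> 'f mat) \<Rightarrow> nat \<Rightarrow> ('r \<Rightarrow> 'f mat) \<Rightarrow> 'a set \<Rightarrow> bool" where
  "is_reducibility_ideal \<eta> \<mm> \<pi> T n1 \<tau>1 n2 \<tau>2 I \<longleftrightarrow>
     splits_mod \<eta> \<mm> \<pi> T n1 \<tau>1 n2 \<tau>2 I \<and>
     (\<forall>J. splits_mod \<eta> \<mm> \<pi> T n1 \<tau>1 n2 \<tau>2 J \<longrightarrow> I \<subseteq> J)"


section \<open>The quotient by the kernel and the modules \<open>\<A>\<^sub>i\<^sub>j\<close>\<close>

definition pseudo_kernel :: "('r::ring_1 \<Rightarrow> 'a::zero) \<Rightarrow> 'r set" where
  "pseudo_kernel T = {x. \<forall>y. T (x * y) = 0}"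

text \<open>The quotient \<open>R\<^sup>T\<close> is a ring type together with a surjective ring homomorphism \<open>q\<close>
  whose kernel is \<open>ker T\<close>. Its \<open>A\<close>-algebra structure map is \<open>q \<circ> \<eta>\<close>.\<close>

definition quotient_map :: "('r::ring_1 \<Rightarrow> 'a::zero) \<Rightarrow> ('r \<Rightarrow> 'q::ring_1) \<Rightarrow> bool" where
  "quotient_map T q \<longleftrightarrow> Ring_Hom.ring_hom q \<and> surj q \<and> (\<forall>x. q x = 0 \<longleftrightarrow> x \<in> pseudo_kernel T)"

text \<open>The map induced on the quotient by a map \<open>f\<close> that is constant on the fibres of \<open>q\<close>.\<close>

definition induced :: "('r \<Rightarrow> 'q) \<Rightarrow> ('r \<Rightarrow> 'b) \<Rightarrow> 'q \<Rightarrow> 'b" where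
  "induced q f z = f (inv_into UNIV q z)"

definition corner :: "'q::ring_1 \<Rightarrow> 'q set" where
  "corner e = {e * x * e | x. True}"

definition corner_iso ::
  "('a::comm_ring_1 \<Rightarrow> 'q::ring_1) \<Rightarrow> 'q \<Rightarrow> nat \<Rightarrow> ('q \<Rightarrow> 'a mat) \<Rightarrow> bool" where
  "corner_iso \<eta> e d \<psi> \<longleftrightarrow>
     bij_betw \<psi> (corner e) (carrier_mat d d) \<and>
     (\<forall>x\<in>corner e. \<forall>y\<in>corner e. \<psi> (x + y) = \<psi> x + \<psi> y) \<and>
     (\<forall>x\<in>corner e. \<forall>y\<in>corner e. \<psi> (x * y) = \<psi> x * \<psi> y) \<and>
     \<psi> e = 1\<^sub>m d \<and>
     (\<forall>a. \<forall>x\<in>corner e. \<psi> (\<eta> a * x) = a \<cdot>\<^sub>m \<psi> x)"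

text \<open>The conditions on a single pair \<open>(e\<^sub>i, \<psi>\<^sub>i)\<close>, where \<open>d = n\<^sub>i\<close> and \<open>\<sigma> = \<tau>\<^sub>i\<close>. The
  representation \<open>\<tau>\<^sub>i\<close> vanishes on \<open>ker T\<close>, so it is defined on the quotient.\<close>

definition adapted_corner ::
  "('a::comm_ring_1 \<Rightarrow> 'r::ring_1) \<Rightarrow> ('a \<Rightarrow> 'f::field) \<Rightarrow> ('r \<Rightarrow> 'a) \<Rightarrow> ('r \<Rightarrow> 'q::ring_1) \<Rightarrow>
   nat \<Rightarrow> ('r \<Rightarrow> 'f mat) \<Rightarrow> 'q \<Rightarrow> ('q \<Rightarrow> 'a mat) \<Rightarrow> bool" where
  "adapted_corner \<eta> \<pi> T q d \<sigma> e \<psi> \<longleftrightarrow>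
     e * e = e \<and>
     corner_iso (q \<circ> \<eta>) e d \<psi> \<and>
     induced q T e = of_nat d \<and>
     (\<forall>x. \<pi> (induced q T (e * x * e)) = mat_trace (induced q \<sigma> x)) \<and>
     (\<forall>z\<in>corner e. map_mat \<pi> (\<psi> z) = induced q \<sigma> z) \<and>
     (\<forall>z\<in>corner e. induced q T z = mat_trace (\<psi> z))"

text \<open>The data of Bellaiche and Chenevier, adapted to the involution \<open>\<tau>\<close>.\<close>

definition adapted_data ::
  "('a::comm_ring_1 \<Rightarrow> 'r::ring_1) \<Rightarrow> 'a set \<Rightarrow> ('a \<Rightarrow> 'f::field) \<Rightarrow> ('r \<Rightarrow> 'a) \<Rightarrow> ('r \<Rightarrow> 'q::ring_1) \<Rightarrow>
   ('r \<Rightarrow> 'r) \<Rightarrow> nat \<Rightarrow> ('r \<Rightarrow> 'f mat) \<Rightarrow> nat \<Rightarrow> ('r \<Rightarrow> 'f mat) \<Rightarrow>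
   'q \<Rightarrow> ('q \<Rightarrow> 'a mat) \<Rightarrow> 'q \<Rightarrow> ('q \<Rightarrow> 'a mat) \<Rightarrow> bool" where
  "adapted_data \<eta> \<mm> \<pi> T q \<tau> n1 \<tau>1 n2 \<tau>2 e1 \<psi>1 e2 \<psi>2 \<longleftrightarrow>
     adapted_corner \<eta> \<pi> T q n1 \<tau>1 e1 \<psi>1 \<and>
     adapted_corner \<eta> \<pi> T q n2 \<tau>2 e2 \<psi>2 \<and>
     e1 * e2 = 0 \<and> e2 * e1 = 0 \<and> e1 + e2 = 1 \<and>
     (\<forall>x y. induced q T (e1 * x * e2 * y * e1) \<in> \<mm>) \<and>
     (\<forall>x y. induced q T (e2 * x * e1 * y * e2) \<in> \<mm>) \<and>
     induced q (q \<circ> \<tau>) e1 = e1 \<and> induced q (q \<circ> \<tau>) e2 = e2"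

definition corner_unit :: "nat \<Rightarrow> 'q::ring_1 \<Rightarrow> ('q \<Rightarrow> 'a::comm_ring_1 mat) \<Rightarrow> 'q" where
  "corner_unit d e \<psi> =
     (THE z. z \<in> corner e \<and> \<psi> z = mat d d (\<lambda>(i, j). if i = 0 \<and> j = 0 then 1 else 0))"

definition off_diagonal ::
  "nat \<Rightarrow> 'q::ring_1 \<Rightarrow> ('q \<Rightarrow> 'a::comm_ring_1 mat) \<Rightarrow> nat \<Rightarrow> 'q \<Rightarrow> ('q \<Rightarrow> 'a mat) \<Rightarrow> 'q set" where
  "off_diagonal d e \<psi> d' e' \<psi>' = {corner_unit d e \<psi> * x * corner_unit d' e' \<psi>' | x. True}"

text \<open>Isomorphism of \<open>A\<close>-submodules of an algebra with structure map \<open>\<eta>\<close>.\<close>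

definition isomorphic_submodules ::
  "('a::comm_ring_1 \<Rightarrow> 'q::ring_1) \<Rightarrow> 'q set \<Rightarrow> 'q set \<Rightarrow> bool" where
  "isomorphic_submodules \<eta> M N \<longleftrightarrow>
     (\<exists>\<phi>. bij_betw \<phi> M N \<and>
        (\<forall>x\<in>M. \<forall>y\<in>M. \<phi> (x + y) = \<phi> x + \<phi> y) \<and>
        (\<forall>a. \<forall>x\<in>M. \<phi> (\<eta> a * x) = \<eta> a * \<phi> x))"

definition anti_involution :: "('a::comm_ring_1 \<Rightarrow> 'r::ring_1) \<Rightarrow> ('r \<Rightarrow> 'r) \<Rightarrow> bool" where
  "anti_involution \<eta> \<tau> \<longleftrightarrow>
     bij \<tau> \<and>
     (\<forall>x y. \<tau> (x + y) = \<tau> x + \<tau> y) \<and>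
     (\<forall>a x. \<tau> (\<eta> a * x) = \<eta> a * \<tau> x) \<and>
     (\<forall>x y. \<tau> (x * y) = \<tau> y * \<tau> x) \<and>
     \<tau> 1 = 1 \<and>
     \<tau> \<circ> \<tau> = id"

end

theory Submission
  imports Defs "Jordan_Normal_Form.Char_Poly"
begin

text \<open>
  The argument works with the concrete algebra \<open>\<rho>(R)\<close> and reads everything off two rank one idempotents.
  By Schur's lemma and the density theorem, \<open>(\<tau>\<^sub>1, \<tau>\<^sub>2)\<close> maps \<open>R\<close> onto the full product of the two matrix
  algebras over the residue field (\<open>density\<close>). So some \<open>x\<close> in \<open>R\<close> reduces to a rank one idempotent in
  one block and to \<open>0\<close> in the other. The characteristic polynomial of \<open>\<rho>(x)\<close> then has \<open>1\<close> as a simple root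
  modulo \<open>\<mm>\<close>; Hensel's lemma splits that root off, and by Cayley-Hamilton the cofactor, evaluated at \<open>x\<close>
  and normalised, is an idempotent (\<open>lift_idempotent\<close>). This gives \<open>x\<^sub>1, x\<^sub>2\<close> in \<open>R\<close> with
  \<open>\<rho>(x\<^sub>i) = v\<^sub>i w\<^sub>i\<^sup>T\<close> and \<open>w\<^sub>i\<^sup>T v\<^sub>i = 1\<close> (\<open>exists_rank_one\<close>).

  With these vectors, the off-diagonal parts of \<open>\<rho>(R)\<close> become two ideals of \<open>A\<close>: the values of
  \<open>w\<^sub>1\<^sup>T \<rho>(s) v\<^sub>2\<close> and those of \<open>w\<^sub>2\<^sup>T \<rho>(s) v\<^sub>1\<close>. The residual extension is not semisimple, so the first
  ideal is all of \<open>A\<close> (\<open>exists_linking_element\<close>); it is block triangular, so the second one, \<open>C\<close>, lies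
  in \<open>\<mm>\<close>. If \<open>l\<close> satisfies \<open>w\<^sub>1\<^sup>T \<rho>(l) v\<^sub>2 = 1\<close>, then \<open>w\<^sub>2\<^sup>T \<rho>(s) v\<^sub>1 = T(x\<^sub>1 l x\<^sub>2 s)\<close>.

  The ideal \<open>C\<close> is the ideal of reducibility. On one side, in a basis adapted to \<open>w\<^sub>1\<close> and \<open>w\<^sub>2\<close> the
  representation is block triangular modulo \<open>C\<close>, and the traces of the diagonal blocks are
  pseudocharacters by the Frobenius identity for matrices (\<open>red_ideal_splits\<close>). On the other side let
  \<open>T = T\<^sub>1 + T\<^sub>2\<close> modulo \<open>J\<close>. In the Frobenius identity for \<open>T\<^sub>2\<close> at \<open>(z, x\<^sub>1, \<dots>, x\<^sub>1)\<close>, every permutation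
  which is not one full cycle contributes a term with a factor \<open>T\<^sub>2(x\<^sub>1\<^sup>k)\<close> in \<open>\<mm>\<close>, whereas the full cycles
  all contribute the same value with the same sign. As factorials up to \<open>n\<close> are units, Nakayama's
  lemma shows that \<open>T\<^sub>2\<close> vanishes modulo \<open>J\<close> on \<open>R x\<^sub>1\<close>, and likewise \<open>T\<^sub>1\<close> on \<open>R x\<^sub>2\<close>; so both kill
  \<open>x\<^sub>1 l x\<^sub>2 s\<close>, and \<open>C \<subseteq> J\<close> (\<open>red_ideal_minimal\<close>). The same mechanism shows beforehand that \<open>T\<^sub>1\<close> and
  \<open>T\<^sub>2\<close> vanish modulo \<open>J\<close> on the kernel of \<open>\<rho>\<close>, up to which \<open>x\<^sub>1\<close> and \<open>x\<^sub>2\<close> are idempotent.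

  The involution exchanges the two off-diagonal parts:
  \<open>T(x\<^sub>1 l x\<^sub>2 s) = T(\<tau>(s) \<tau>(x\<^sub>2) \<tau>(l) \<tau>(x\<^sub>1))\<close>. As far as \<open>T\<close> can see, \<open>\<tau>(x\<^sub>i)\<close> is again a rank one
  idempotent, equivalent to \<open>x\<^sub>i\<close> because \<open>\<tau>\<close> preserves the trace of \<open>\<tau>\<^sub>i\<close>. Moving it back to \<open>x\<^sub>i\<close> writes
  every element of \<open>C\<close> as a multiple of one fixed element (\<open>red_ideal_principal\<close>). The isomorphism
  \<open>\<A>\<^sub>1\<^sub>2 \<cong> \<A>\<^sub>2\<^sub>1\<close> has the same source: \<open>E\<^sub>i\<close> and its image under the involution are idempotents of trace
  one in one matrix algebra over a local ring, so \<open>E\<^sub>i = u\<^sub>i v\<^sub>i\<close> and \<open>\<tau>(E\<^sub>i) = v\<^sub>i u\<^sub>i\<close>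
  (\<open>corner_unit_conjugate\<close>), and \<open>z \<mapsto> u\<^sub>2 \<tau>(z) v\<^sub>1\<close> is the isomorphism (\<open>off_diagonal_isomorphic\<close>).
\<close>

section \<open>The Frobenius identity for matrices\<close>

text \<open>Entry \<open>(a, b)\<close> of a product of \<open>m \<times> m\<close> matrices. Entry functions instead of matrices let blocks of a
  larger matrix, and maps that are multiplicative only modulo an ideal, be inserted directly.\<close>

fun path_prod :: "nat \<Rightarrow> (nat \<Rightarrow> nat \<Rightarrow> 'a::comm_ring_1) list \<Rightarrow> nat \<Rightarrow> nat \<Rightarrow> 'a" where
  "path_prod m [] a b = (if a = b then 1 else 0)"
| "path_prod m (M # Ms) a b = (\<Sum>c<m. M a c * path_prod m Ms c b)"

lemma sum_PiE_insert:
  assumes "k \<notin> B"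
  shows "(\<Sum>g\<in>insert k B \<rightarrow>\<^sub>E K. R g) = (\<Sum>c\<in>K. \<Sum>g\<in>B \<rightarrow>\<^sub>E K. R (g(k := c)))"
  unfolding PiE_insert_eq
  by (subst sum.reindex[OF inj_combinator[OF assms]])
     (simp add: sum.cartesian_product case_prod_unfold)

lemma sum_PiE_Un:
  fixes P Q :: "('i \<Rightarrow> 'k) \<Rightarrow> 'a::comm_semiring_0"
  assumes "A \<inter> B = {}"
    and P: "\<And>g h. (\<And>i. i \<in> A \<Longrightarrow> g i = h i) \<Longrightarrow> P g = P h"
    and Q: "\<And>g h. (\<And>i. i \<in> B \<Longrightarrow> g i = h i) \<Longrightarrow> Q g = Q h"
  shows "(\<Sum>g\<in>A \<rightarrow>\<^sub>E K. P g) * (\<Sum>g\<in>B \<rightarrow>\<^sub>E K. Q g) = (\<Sum>g\<in>A \<union> B \<rightarrow>\<^sub>E K. P g * Q g)"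
proof -
  have "(\<Sum>g\<in>A \<rightarrow>\<^sub>E K. P g) * (\<Sum>g\<in>B \<rightarrow>\<^sub>E K. Q g)
      = (\<Sum>(g, h)\<in>(A \<rightarrow>\<^sub>E K) \<times> (B \<rightarrow>\<^sub>E K). P g * Q h)"
    by (simp add: sum_product sum.cartesian_product)
  also have "\<dots> = (\<Sum>g\<in>A \<union> B \<rightarrow>\<^sub>E K. P g * Q g)"
  proof (rule sum.reindex_bij_witness[where
        i = "\<lambda>g. (restrict g A, restrict g B)" and
        j = "\<lambda>(g, h). \<lambda>i. if i \<in> A then g i else h i"], goal_cases)
    case (1 x)
    obtain g h where x: "x = (g, h)" by force
    have "restrict (\<lambda>i. if i \<in> A then g i else h i) A = g"
      using 1 x by (auto simp: fun_eq_iff PiE_def extensional_def)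
    moreover have "restrict (\<lambda>i. if i \<in> A then g i else h i) B = h"
      using 1 x assms(1) by (auto simp: fun_eq_iff PiE_def extensional_def)
    ultimately show ?case by (simp add: x)
  next
    case (2 x)
    then show ?case by (auto simp: PiE_def extensional_def)
  next
    case (3 g)
    then show ?case by (auto simp: fun_eq_iff PiE_def extensional_def)
  next
    case (4 g)
    then show ?case by (auto simp: PiE_def)
  next
    case (5 x)
    obtain g h where x: "x = (g, h)" by force
    have "P (\<lambda>i. if i \<in> A then g i else h i) = P g" by (rule P) auto
    moreover have "Q (\<lambda>i. if i \<in> A then g i else h i) = Q h" using assms(1) by (intro Q) auto
    ultimately show ?case by (simp add: x)
  qed
  finally show ?thesis .
qed

text \<open>Distributivity: a choice of one function on each of several disjoint sets is one function on their
  union, provided that each factor depends only on the values on its own set.\<close>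

lemma prod_sum_PiE_disjoint:
  fixes F :: "'i \<Rightarrow> ('i \<Rightarrow> 'k) \<Rightarrow> 'a::comm_semiring_1"
  assumes "finite \<C>" and "\<And>C. C \<in> \<C> \<Longrightarrow> finite C" and "pairwise disjnt \<C>"
    and "\<And>C i g h. C \<in> \<C> \<Longrightarrow> i \<in> C \<Longrightarrow> (\<And>j. j \<in> C \<Longrightarrow> g j = h j) \<Longrightarrow> F i g = F i h"
  shows "(\<Prod>C\<in>\<C>. \<Sum>g\<in>C \<rightarrow>\<^sub>E K. \<Prod>i\<in>C. F i g) = (\<Sum>g\<in>\<Union>\<C> \<rightarrow>\<^sub>E K. \<Prod>i\<in>\<Union>\<C>. F i g)"
  using assms
proof (induction \<C> rule: finite_induct)
  case empty
  then show ?case by simp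
next
  case (insert C \<C>)
  have dis: "C \<inter> \<Union>\<C> = {}"
    using insert.prems(2) insert.hyps(2) by (auto simp: pairwise_def disjnt_def)
  have fin: "finite (\<Union>\<C>)" "finite C" using insert.hyps insert.prems by auto
  have IH: "(\<Prod>C\<in>\<C>. \<Sum>g\<in>C \<rightarrow>\<^sub>E K. \<Prod>i\<in>C. F i g) = (\<Sum>g\<in>\<Union>\<C> \<rightarrow>\<^sub>E K. \<Prod>i\<in>\<Union>\<C>. F i g)"
  proof (rule insert.IH)
    show "F i g = F i h" if "D \<in> \<C>" "i \<in> D" "\<And>j. j \<in> D \<Longrightarrow> g j = h j" for D i g h
      using insert.prems(3)[of D i g h] that by simp
  qed (use insert.prems(1,2) in \<open>auto simp: pairwise_insert\<close>)
  have "(\<Prod>D\<in>insert C \<C>. \<Sum>g\<in>D \<rightarrow>\<^sub>E K. \<Prod>i\<in>D. F i g)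
     = (\<Sum>g\<in>C \<rightarrow>\<^sub>E K. \<Prod>i\<in>C. F i g) * (\<Sum>g\<in>\<Union>\<C> \<rightarrow>\<^sub>E K. \<Prod>i\<in>\<Union>\<C>. F i g)"
    using insert.hyps IH by simp
  also have "\<dots> = (\<Sum>g\<in>C \<union> \<Union>\<C> \<rightarrow>\<^sub>E K. (\<Prod>i\<in>C. F i g) * (\<Prod>i\<in>\<Union>\<C>. F i g))"
  proof (rule sum_PiE_Un[OF dis], goal_cases)
    case (1 g h)
    then have "F i g = F i h" if "i \<in> C" for i using insert.prems(3)[of C i g h] that by simp
    then show ?case by (rule prod.cong[OF refl])
  next
    case (2 g h)
    then have "F i g = F i h" if "D \<in> \<C>" "i \<in> D" for D i
      using insert.prems(3)[of D i g h] that by blast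
    then show ?case by (intro prod.cong) auto
  qed
  also have "\<dots> = (\<Sum>g\<in>\<Union>(insert C \<C>) \<rightarrow>\<^sub>E K. \<Prod>i\<in>\<Union>(insert C \<C>). F i g)"
    using fin dis by (simp add: prod.union_disjoint)
  finally show ?case .
qed

text \<open>Expanding a product along \<open>j # js\<close> gives a sum over the intermediate vertices of a path. When \<open>\<sigma>\<close> steps
  through the list, the vertex in front of the factor \<open>M i\<close> can be recorded as \<open>g i\<close>, and the one behind it is
  \<open>g (\<sigma> i)\<close>; the two ends \<open>a\<close> and \<open>b\<close> are fixed. For a closed path this turns a trace along a cycle of \<open>\<sigma>\<close> into
  a sum over functions on that cycle.\<close>

lemma path_prod_expand:
  assumes "distinct (j # js)" and "\<And>k. k < length js \<Longrightarrow> \<sigma> ((j # js) ! k) = js ! k" and "b < m"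
  shows "path_prod m (map M (j # js)) a b =
    (\<Sum>g\<in>set js \<rightarrow>\<^sub>E {..<m}. \<Prod>i\<in>set (j # js).
       M i (if i = j then a else g i) (if i = last (j # js) then b else g (\<sigma> i)))"
  using assms
proof (induction js arbitrary: j a)
  case Nil
  have "(\<Sum>c<m. M j a c * (if c = b then 1 else 0)) = (\<Sum>c<m. if c = b then M j a c else 0)"
    by (intro sum.cong) auto
  with Nil show ?case by (simp add: PiE_empty_domain)
next
  case (Cons k ks)
  have \<sigma>j: "\<sigma> j = k" using Cons.prems(2)[of 0] by simp
  have \<sigma>k: "\<sigma> ((k # ks) ! l) = ks ! l" if "l < length ks" for l
    using Cons.prems(2)[of "Suc l"] that by simp
  \<comment> \<open>all indices but the last are sent by \<open>\<sigma>\<close> into \<open>ks\<close>, so updating \<open>g\<close> at \<open>k\<close> does not disturb their factors\<close>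
  have last_nin: "\<sigma> i \<in> set ks" if "i \<in> set (k # ks)" "i \<noteq> last (k # ks)" for i
  proof -
    obtain l where l: "l < length (k # ks)" "i = (k # ks) ! l"
      using \<open>i \<in> set (k # ks)\<close> by (metis in_set_conv_nth)
    have "l \<noteq> length ks" using that(2) l(2) last_conv_nth[of "k # ks"] by auto
    then show ?thesis using l \<sigma>k[of l] by simp
  qed
  have dis: "distinct (k # ks)" "k \<notin> set ks" "j \<noteq> k" "j \<notin> set ks" using Cons.prems by auto
  have "path_prod m (map M (j # k # ks)) a b
      = (\<Sum>c<m. M j a c * (\<Sum>g\<in>set ks \<rightarrow>\<^sub>E {..<m}. \<Prod>i\<in>set (k # ks).
           M i (if i = k then c else g i) (if i = last (k # ks) then b else g (\<sigma> i))))"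
    using Cons.IH[OF dis(1) \<sigma>k \<open>b < m\<close>] by simp
  also have "\<dots> = (\<Sum>c<m. \<Sum>g\<in>set ks \<rightarrow>\<^sub>E {..<m}. \<Prod>i\<in>set (j # k # ks).
       M i (if i = j then a else (g(k := c)) i)
           (if i = last (j # k # ks) then b else (g(k := c)) (\<sigma> i)))"
    unfolding sum_distrib_left
  proof (intro sum.cong refl, goal_cases)
    case (1 c g)
    let ?h = "g(k := c)"
    have "(\<Prod>i\<in>set (j # k # ks). M i (if i = j then a else ?h i)
           (if i = last (j # k # ks) then b else ?h (\<sigma> i)))
      = M j a c * (\<Prod>i\<in>set (k # ks). M i (if i = j then a else ?h i)
           (if i = last (j # k # ks) then b else ?h (\<sigma> i)))"
      using dis \<sigma>j by (subst list.set, subst prod.insert) (auto simp: last_in_set)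
    also have "(\<Prod>i\<in>set (k # ks). M i (if i = j then a else ?h i)
           (if i = last (j # k # ks) then b else ?h (\<sigma> i)))
      = (\<Prod>i\<in>set (k # ks). M i (if i = k then c else g i)
           (if i = last (k # ks) then b else g (\<sigma> i)))"
    proof (rule prod.cong[OF refl])
      fix i assume i: "i \<in> set (k # ks)"
      then have "i \<noteq> j" using dis by auto
      moreover have "\<sigma> i \<noteq> k" if "i \<noteq> last (k # ks)" using last_nin[OF i that] dis(2) by auto
      ultimately show "M i (if i = j then a else ?h i) (if i = last (j # k # ks) then b else ?h (\<sigma> i))
        = M i (if i = k then c else g i) (if i = last (k # ks) then b else g (\<sigma> i))"
        by simp
    qed
    finally show ?case by simp
  qed
  also have "\<dots> = (\<Sum>g\<in>set (k # ks) \<rightarrow>\<^sub>E {..<m}. \<Prod>i\<in>set (j # k # ks).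
       M i (if i = j then a else g i) (if i = last (j # k # ks) then b else g (\<sigma> i)))"
    unfolding list.set(2)[of k ks] sum_PiE_insert[OF dis(2)] by (rule refl)
  finally show ?case .
qed

lemma orbit_partition:
  assumes "\<sigma> permutes {..d::nat}"
  shows "finite (orbit \<sigma> ` {..d})" and "\<And>C. C \<in> orbit \<sigma> ` {..d} \<Longrightarrow> finite C"
    and "pairwise disjnt (orbit \<sigma> ` {..d})" and "\<Union>(orbit \<sigma> ` {..d}) = {..d}"
proof -
  have perm: "permutation \<sigma>" using permutes_imp_permutation[OF finite_atMost assms] .
  have eq: "orbit \<sigma> y = orbit \<sigma> x" if "y \<in> orbit \<sigma> x" for x y
    using that perm by (metis cyclic_on_orbit' orbit_cyclic_eq3)
  have self: "x \<in> orbit \<sigma> x" for x using perm by (rule permutation_self_in_orbit)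
  have sub: "orbit \<sigma> x \<subseteq> {..d}" if "x \<le> d" for x
    using permutes_orbit_subset[OF assms] that by auto
  show "finite (orbit \<sigma> ` {..d})" by simp
  show "finite C" if "C \<in> orbit \<sigma> ` {..d}" for C
    using that sub by (auto intro: finite_subset)
  show "pairwise disjnt (orbit \<sigma> ` {..d})"
    unfolding pairwise_def disjnt_def using eq by blast
  show "\<Union>(orbit \<sigma> ` {..d}) = {..d}" using self sub by blast
qed

lemma support_orbit:
  assumes "permutation \<sigma>"
  shows "set (Cycles.support \<sigma> x) = orbit \<sigma> x"
  unfolding support_set[OF assms] using orbit_altdef_permutation[OF assms] by auto

lemma support_cycle:
  assumes "permutation \<sigma>"
  obtains js where "Cycles.support \<sigma> x = x # js" and "distinct (x # js)"
    and "\<And>k. k < length js \<Longrightarrow> \<sigma> ((x # js) ! k) = js ! k" and "\<sigma> (last (x # js)) = x"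
    and "set (x # js) = orbit \<sigma> x"
proof -
  let ?l = "least_power \<sigma> x"
  have l: "?l > 0" "(\<sigma> ^^ ?l) x = x" using least_power_of_permutation[OF assms] by auto
  define js where "js = map (\<lambda>i. (\<sigma> ^^ i) x) [1..<?l]"
  have s: "Cycles.support \<sigma> x = x # js"
    using l(1) by (simp add: js_def upt_conv_Cons)
  have len: "length js = ?l - 1" by (simp add: js_def)
  have nth: "(x # js) ! k = (\<sigma> ^^ k) x" if "k < ?l" for k
    using that by (simp flip: s)
  show thesis
  proof
    show "Cycles.support \<sigma> x = x # js" by (fact s)
    show "distinct (x # js)" using cycle_of_permutation[OF assms, of x] s by simp
    show "set (x # js) = orbit \<sigma> x" using support_orbit[OF assms, of x] s by simp
    show "\<sigma> ((x # js) ! k) = js ! k" if "k < length js" for k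
      using nth[of k] nth[of "Suc k"] that len by simp
    have "last (x # js) = (\<sigma> ^^ (?l - 1)) x"
      using nth[of "?l - 1"] l(1) len by (subst last_conv_nth) simp_all
    then have "\<sigma> (last (x # js)) = (\<sigma> ^^ Suc (?l - 1)) x" by simp
    then show "\<sigma> (last (x # js)) = x" using l by simp
  qed
qed

lemma path_trace_cycle:
  assumes "permutation \<sigma>"
  shows "(\<Sum>a<m. path_prod m (map M (Cycles.support \<sigma> x)) a a)
    = (\<Sum>g\<in>orbit \<sigma> x \<rightarrow>\<^sub>E {..<m}. \<Prod>i\<in>orbit \<sigma> x. M i (g i) (g (\<sigma> i)))"
proof -
  obtain js where js: "Cycles.support \<sigma> x = x # js" "distinct (x # js)"
    "\<And>k. k < length js \<Longrightarrow> \<sigma> ((x # js) ! k) = js ! k" "\<sigma> (last (x # js)) = x"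
    "set (x # js) = orbit \<sigma> x"
    using support_cycle[OF assms, of x] by metis
  have nx: "x \<notin> set js" using js(2) by simp
  have \<sigma>ne: "\<sigma> i \<noteq> x" if "i \<noteq> last (x # js)" for i
    using that js(4) assms by (metis permutation_bijective bij_def inj_def)
  have "(\<Sum>a<m. path_prod m (map M (Cycles.support \<sigma> x)) a a)
     = (\<Sum>a<m. \<Sum>g\<in>set js \<rightarrow>\<^sub>E {..<m}. \<Prod>i\<in>set (x # js).
       M i (if i = x then a else g i) (if i = last (x # js) then a else g (\<sigma> i)))"
    unfolding js(1) using js(2,3) by (intro sum.cong refl path_prod_expand) auto
  also have "\<dots> = (\<Sum>a<m. \<Sum>g\<in>set js \<rightarrow>\<^sub>E {..<m}. \<Prod>i\<in>set (x # js).
       M i ((g(x := a)) i) ((g(x := a)) (\<sigma> i)))"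
    using js(4) \<sigma>ne by (intro sum.cong prod.cong refl) auto
  also have "\<dots> = (\<Sum>g\<in>orbit \<sigma> x \<rightarrow>\<^sub>E {..<m}. \<Prod>i\<in>orbit \<sigma> x. M i (g i) (g (\<sigma> i)))"
    using sum_PiE_insert[OF nx, where R = "\<lambda>g. \<Prod>i\<in>set (x # js). M i (g i) (g (\<sigma> i))"]
    by (simp add: js(5)[symmetric])
  finally show ?thesis .
qed

text \<open>Multiplying the expansions of the single cycles, whose vertex functions are independent of each other,
  leaves a sum over all functions \<open>f\<close> in which \<open>\<sigma>\<close> occurs only as the column index. So the signed sum over
  \<open>\<sigma>\<close> will be a determinant for each \<open>f\<close>.\<close>

lemma cycle_traces_expand:
  assumes \<sigma>: "\<sigma> permutes {..d::nat}"
  shows "(\<Prod>C\<in>orbit \<sigma> ` {..d}. \<Sum>a<m. path_prod m (map M (Cycles.support \<sigma> (Min C))) a a)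
    = (\<Sum>f\<in>{..d} \<rightarrow>\<^sub>E {..<m}. \<Prod>i\<le>d. M i (f i) (f (\<sigma> i)))"
proof -
  have perm: "permutation \<sigma>" using permutes_imp_permutation[OF finite_atMost assms] .
  have orb: "orbit \<sigma> (Min C) = C" if "C \<in> orbit \<sigma> ` {..d}" for C
  proof -
    obtain x where x: "C = orbit \<sigma> x" "x \<le> d" using \<open>C \<in> _\<close> by auto
    have "Min C \<in> C"
      using orbit_partition(2)[OF \<sigma> that] permutation_self_in_orbit[OF perm, of x] x
      by (intro Min_in) auto
    then show ?thesis using perm x by (metis cyclic_on_orbit' orbit_cyclic_eq3)
  qed
  have "(\<Prod>C\<in>orbit \<sigma> ` {..d}. \<Sum>a<m. path_prod m (map M (Cycles.support \<sigma> (Min C))) a a)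
     = (\<Prod>C\<in>orbit \<sigma> ` {..d}. \<Sum>g\<in>C \<rightarrow>\<^sub>E {..<m}. \<Prod>i\<in>C. M i (g i) (g (\<sigma> i)))"
    using orb by (intro prod.cong refl) (simp only: path_trace_cycle[OF perm])
  also have "\<dots> = (\<Sum>g\<in>\<Union>(orbit \<sigma> ` {..d}) \<rightarrow>\<^sub>E {..<m}. \<Prod>i\<in>\<Union>(orbit \<sigma> ` {..d}). M i (g i) (g (\<sigma> i)))"
  proof (rule prod_sum_PiE_disjoint[OF orbit_partition(1-3)[OF \<sigma>]])
    fix C i and g h :: "nat \<Rightarrow> nat"
    assume C: "C \<in> orbit \<sigma> ` {..d}" "i \<in> C" and eq: "\<And>j. j \<in> C \<Longrightarrow> g j = h j"
    have "\<sigma> i \<in> C" using C by (auto intro: orbit.step)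
    then show "M i (g i) (g (\<sigma> i)) = M i (h i) (h (\<sigma> i))" using eq C(2) by simp
  qed simp
  also have "\<dots> = (\<Sum>f\<in>{..d} \<rightarrow>\<^sub>E {..<m}. \<Prod>i\<le>d. M i (f i) (f (\<sigma> i)))"
    by (simp only: orbit_partition(4)[OF \<sigma>])
  finally show ?thesis .
qed

text \<open>A function from \<open>d + 1\<close> indices to \<open>m \<le> d\<close> vertices takes some value twice, and then the determinant
  of \<open>M k (f k) (f l)\<close> has two equal columns.\<close>

theorem frobenius_identity:
  fixes M :: "nat \<Rightarrow> nat \<Rightarrow> nat \<Rightarrow> 'a::comm_ring_1"
  assumes "m \<le> d"
  shows "(\<Sum>\<sigma> | \<sigma> permutes {..d}. of_int (sign \<sigma>) *
     (\<Prod>C\<in>orbit \<sigma> ` {..d}. \<Sum>a<m. path_prod m (map M (Cycles.support \<sigma> (Min C))) a a)) = 0"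
proof -
  have zero: "(\<Sum>\<sigma> | \<sigma> permutes {..d}. of_int (sign \<sigma>) * (\<Prod>i\<le>d. M i (f i) (f (\<sigma> i)))) = 0"
    if f: "f \<in> {..d} \<rightarrow>\<^sub>E {..<m}" for f
  proof -
    have "\<not> inj_on f {..d}"
    proof
      assume "inj_on f {..d}"
      then have "card {..d} \<le> card {..<m}" using f by (intro card_inj_on_le) auto
      then show False using assms by simp
    qed
    then obtain i j where ij: "i \<le> d" "j \<le> d" "i \<noteq> j" "f i = f j"
      by (auto simp: inj_on_def)
    let ?D = "mat (Suc d) (Suc d) (\<lambda>(k, l). M k (f k) (f l))"
    have "det ?D = 0"
      using ij by (intro det_identical_columns[of _ "Suc d" i j]) (auto simp: col_def)
    moreover have "det ?D = (\<Sum>\<sigma> | \<sigma> permutes {..d}. of_int (sign \<sigma>) * (\<Prod>i\<le>d. M i (f i) (f (\<sigma> i))))"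
    proof -
      have "det ?D = (\<Sum>\<sigma> | \<sigma> permutes {0..<Suc d}.
          signof \<sigma> * (\<Prod>i = 0..<Suc d. ?D $$ (i, \<sigma> i)))"
        by (rule det_def') simp
      also have "{0..<Suc d} = {..d}" by auto
      finally have *: "det ?D = (\<Sum>\<sigma> | \<sigma> permutes {..d}. signof \<sigma> * (\<Prod>i\<le>d. ?D $$ (i, \<sigma> i)))" .
      have entries: "?D $$ (i, \<sigma> i) = M i (f i) (f (\<sigma> i))" if "\<sigma> permutes {..d}" "i \<le> d" for \<sigma> i
        using permutes_in_image[OF that(1), of i] that(2) by simp
      show ?thesis unfolding * by (intro sum.cong refl) (simp add: entries)
    qed
    ultimately show ?thesis by simp
  qed
  have "(\<Sum>\<sigma> | \<sigma> permutes {..d}. of_int (sign \<sigma>) *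
     (\<Prod>C\<in>orbit \<sigma> ` {..d}. \<Sum>a<m. path_prod m (map M (Cycles.support \<sigma> (Min C))) a a))
   = (\<Sum>\<sigma> | \<sigma> permutes {..d}. \<Sum>f\<in>{..d} \<rightarrow>\<^sub>E {..<m}. of_int (sign \<sigma>) * (\<Prod>i\<le>d. M i (f i) (f (\<sigma> i))))"
    by (intro sum.cong refl) (simp only: mem_Collect_eq cycle_traces_expand sum_distrib_left)
  also have "\<dots> = (\<Sum>f\<in>{..d} \<rightarrow>\<^sub>E {..<m}. \<Sum>\<sigma> | \<sigma> permutes {..d}. of_int (sign \<sigma>) * (\<Prod>i\<le>d. M i (f i) (f (\<sigma> i))))"
    by (rule sum.swap)
  also have "\<dots> = 0" using zero by simp
  finally show ?thesis .
qed

section \<open>Full cycles in the Frobenius identity\<close>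

lemma path_prod_identity: 
  "a < m \<Longrightarrow> path_prod m (map (\<lambda>_ a b. if a = b then 1 else 0) js) a b = (if a = b then 1 else 0)"
proof (induction js)
  case (Cons j js)
  have "path_prod m (map (\<lambda>_ a b. if a = b then 1 else 0) (j # js)) a b
    = (\<Sum>c<m. if a = c then path_prod m (map (\<lambda>_ a b. if a = b then 1 else 0) js) c b else 0)"
    unfolding list.map path_prod.simps by (intro sum.cong refl) simp
  also have "\<dots> = path_prod m (map (\<lambda>_ a b. if a = b then 1 else 0) js) a b" using Cons.prems by simp
  finally show ?case using Cons.IH[OF Cons.prems] by (rule trans)
qed simp

text \<open>The Frobenius identity for the identity matrix of size \<open>m\<close>: each cycle contributes its trace \<open>m\<close>.\<close>

lemma sum_sign_power_cycles_zero:
  assumes "m \<le> d"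
  shows "(\<Sum>\<sigma> | \<sigma> permutes {..d}. sign \<sigma> * int m ^ card (orbit \<sigma> ` {..d})) = 0"
proof -
  have "(\<Sum>a<m. path_prod m (map (\<lambda>_ a b. if a = b then 1 else 0) js) a a) = int m" for js :: "nat list"
    by (simp add: path_prod_identity)
  then show ?thesis
    using frobenius_identity[OF assms, of "\<lambda>_ a b. if a = b then 1 else (0::int)"]
    by (simp del: map_map)
qed

lemma card_orbits_le:
  assumes "\<sigma> permutes {..d::nat}"
  shows "card (orbit \<sigma> ` {..d}) \<le> Suc d"
    and "card (orbit \<sigma> ` {..d}) = Suc d \<Longrightarrow> \<sigma> = id"
    and "card (orbit \<sigma> ` {..d}) > 0"
proof -
  show "card (orbit \<sigma> ` {..d}) \<le> Suc d" using card_image_le[of "{..d}" "orbit \<sigma>"] by simp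
  show "card (orbit \<sigma> ` {..d}) > 0" by (simp add: card_gt_0_iff)
  assume "card (orbit \<sigma> ` {..d}) = Suc d"
  then have inj: "inj_on (orbit \<sigma>) {..d}" by (intro eq_card_imp_inj_on) simp_all
  have perm: "permutation \<sigma>" using permutes_imp_permutation[OF finite_atMost assms] .
  have "\<sigma> x = x" if "x \<le> d" for x
  proof -
    have "orbit \<sigma> (\<sigma> x) = orbit \<sigma> x" using perm by (rule permutation_orbit_step)
    moreover have "\<sigma> x \<in> {..d}" using permutes_in_image[OF assms] that by simp
    ultimately show ?thesis using inj that by (auto dest: inj_onD)
  qed
  moreover have "\<sigma> x = x" if "\<not> x \<le> d" for x using permutes_not_in[OF assms] that by simp
  ultimately show "\<sigma> = id" by (auto simp: fun_eq_iff)
qed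

text \<open>The full cycles of \<open>{0..d}\<close> all have sign \<open>(-1)\<^sup>d\<close> and there are \<open>d!\<close> of them. The signed count comes without
  classifying them: the polynomial \<open>\<Sum>\<^sub>\<sigma> sign \<sigma> * t ^ c(\<sigma>)\<close>, with \<open>c(\<sigma>)\<close> the number of cycles, is monic of degree
  \<open>d + 1\<close> and vanishes at \<open>0, \<dots>, d\<close>, so it is \<open>t (t - 1) \<cdots> (t - d)\<close>, and its linear coefficient is wanted.\<close>

lemma sum_sign_full_cycles:
  "(\<Sum>\<sigma> | \<sigma> permutes {..d} \<and> card (orbit \<sigma> ` {..d}) = 1. sign \<sigma>) = (-1) ^ d * fact d"
proof -
  let ?c = "\<lambda>\<sigma>. card (orbit \<sigma> ` {..d})"
  define p :: "int poly" where "p = (\<Sum>\<sigma> | \<sigma> permutes {..d}. monom (sign \<sigma>) (?c \<sigma>))"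
  define r :: "int poly" where "r = (\<Prod>k\<in>{1..d}. [:- int k, 1:])"
  have fin: "finite {\<sigma>. \<sigma> permutes {..d}}" by (rule finite_permutations) simp
  have degr: "degree r = d" "lead_coeff r = 1"
    unfolding r_def by (subst degree_prod_eq_sum_degree) (auto simp: lead_coeff_prod)
  have "coeff p (Suc d) = (\<Sum>\<sigma> | \<sigma> permutes {..d}. if \<sigma> = id then 1 else 0)"
    unfolding p_def coeff_sum
  proof (intro sum.cong refl)
    fix \<sigma> assume \<sigma>: "\<sigma> \<in> {\<sigma>. \<sigma> permutes {..d}}"
    have "?c id = Suc d"
    proof -
      have "orbit id x = {x}" for x :: nat by (simp add: orbit_eq_singleton_iff)
      then have "?c id = card ((\<lambda>x. {x}) ` {..d})" by simp
      also have "\<dots> = Suc d" by (subst card_image) auto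
      finally show ?thesis .
    qed
    then show "coeff (monom (sign \<sigma>) (?c \<sigma>)) (Suc d) = (if \<sigma> = id then 1 else 0)"
      using card_orbits_le(2)[of \<sigma> d] \<sigma> by (auto simp: coeff_monom)
  qed
  also have "\<dots> = 1" using fin by (simp add: permutes_id)
  finally have p1: "coeff p (Suc d) = 1" .
  have degp: "degree p \<le> Suc d" unfolding p_def
    by (intro degree_sum_le fin order.trans[OF degree_monom_le]) (auto intro: card_orbits_le)
  \<comment> \<open>both have degree at most \<open>d + 1\<close>, the same coefficient there, and agree at the \<open>d + 1\<close> points \<open>0, \<dots>, d\<close>\<close>
  have "p = [:0, 1:] * r"
  proof (rule poly_eqI_degree_lead_coeff[where n = "Suc d" and A = "int ` {..d}"])
    show "degree ([:0, 1:] * r) \<le> Suc d" using degr by (simp add: degree_mult_le)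
    show "coeff p (Suc d) = coeff ([:0, 1:] * r) (Suc d)" using p1 degr by simp
    show "Suc d \<le> card (int ` {..d})" by (subst card_image) auto
    fix x assume "x \<in> int ` {..d}"
    then obtain m where m: "x = int m" "m \<le> d" by auto
    have "poly p x = 0" using sum_sign_power_cycles_zero[OF m(2)]
      by (simp add: p_def poly_sum poly_monom m(1))
    moreover have "poly ([:0, 1:] * r) x = 0"
    proof (cases "m = 0")
      case False
      then have "poly r x = 0" using m unfolding r_def poly_prod by (intro prod_zero) auto
      then show ?thesis by simp
    qed (use m in simp)
    ultimately show "poly p x = poly ([:0, 1:] * r) x" by simp
  qed fact
  then have "coeff p 1 = coeff r 0" by simp
  also have "\<dots> = (\<Prod>k\<in>{1..d}. - int k)" by (simp add: r_def poly_0_coeff_0[symmetric] poly_prod)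
  also have "\<dots> = (-1) ^ d * fact d"
    by (simp add: prod_uminus fact_prod)
  finally have "coeff p 1 = (-1) ^ d * fact d" .
  moreover have "coeff p 1 = (\<Sum>\<sigma> | \<sigma> permutes {..d}. if ?c \<sigma> = 1 then sign \<sigma> else 0)"
    by (simp add: p_def coeff_sum coeff_monom)
  moreover have "\<dots> = (\<Sum>\<sigma> | \<sigma> permutes {..d} \<and> ?c \<sigma> = 1. sign \<sigma>)"
    using fin by (simp add: sum.inter_filter[symmetric])
  ultimately show ?thesis by simp
qed

lemma module_times: "Modules.module ((*) :: 'a::comm_ring_1 \<Rightarrow> _)"
  by unfold_locales (simp_all add: algebra_simps)

lemma ring_ideal_iff:
  "ring_ideal I \<longleftrightarrow> 0 \<in> I \<and> (\<forall>x\<in>I. \<forall>y\<in>I. x + y \<in> I) \<and> (\<forall>c. \<forall>x\<in>I. c * x \<in> I)"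
  by (simp add: module.subspace_def[OF module_times])

lemma
  assumes "ring_ideal I"
  shows ideal_zero: "0 \<in> I" and ideal_add: "x \<in> I \<Longrightarrow> y \<in> I \<Longrightarrow> x + y \<in> I"
    and ideal_multl: "x \<in> I \<Longrightarrow> c * x \<in> I" and ideal_multr: "x \<in> I \<Longrightarrow> x * c \<in> I"
    and ideal_uminus: "x \<in> I \<Longrightarrow> - x \<in> I" and ideal_diff: "x \<in> I \<Longrightarrow> y \<in> I \<Longrightarrow> x - y \<in> I"
    and ideal_sum: "(\<And>i. i \<in> A \<Longrightarrow> f i \<in> I) \<Longrightarrow> sum f A \<in> I"
proof -
  note I = assms[unfolded ring_ideal_iff]
  show "0 \<in> I" using I by blast
  show add: "x \<in> I \<Longrightarrow> y \<in> I \<Longrightarrow> x + y \<in> I" for x y using I by blast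
  show mult: "x \<in> I \<Longrightarrow> c * x \<in> I" for c x using I by blast
  show "x \<in> I \<Longrightarrow> x * c \<in> I" using mult[of x c] by (simp only: mult.commute[of x c])
  show um: "x \<in> I \<Longrightarrow> - x \<in> I" for x using mult[of x "-1"] by simp
  show "x \<in> I \<Longrightarrow> y \<in> I \<Longrightarrow> x - y \<in> I" using add[of x "- y"] um[of y] by simp
  show "(\<And>i. i \<in> A \<Longrightarrow> f i \<in> I) \<Longrightarrow> sum f A \<in> I"
    by (rule module.subspace_sum[OF module_times assms])
qed

lemma ideal_congI:
  assumes "ring_ideal I" "x - y \<in> I" shows "x \<in> I \<longleftrightarrow> y \<in> I"
  using ideal_add[OF assms(1), of "x - y" y] ideal_diff[OF assms(1), of x "x - y"] assms(2) by auto

text \<open>In the Frobenius identity with one argument \<open>z\<close> (at the index \<open>0\<close>) and all others equal to \<open>y\<close>, the cycle of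
  \<open>0\<close> contributes some \<open>T (z * y ^ k)\<close> in \<open>L\<close>, and any further cycle some \<open>T (y ^ l)\<close> in \<open>\<mm>\<close>. So modulo \<open>D\<close>
  only the full cycles survive, and each of them contributes \<open>T (z * y ^ d)\<close>.\<close>

lemma frobenius_full_cycle:
  fixes T :: "'r::ring_1 \<Rightarrow> 'a::comm_ring_1"
  assumes D: "ring_ideal D" "frobenius_sum T d (\<lambda>i. if i = 0 then z else y) \<in> D"
    and M: "ring_ideal \<mm>" "\<And>k. k > 0 \<Longrightarrow> T (y ^ k) \<in> \<mm>"
    and L: "\<And>k. T (z * y ^ k) \<in> L" "\<And>c l. c \<in> \<mm> \<Longrightarrow> l \<in> L \<Longrightarrow> c * l \<in> D"
  shows "of_nat (fact d) * T (z * y ^ d) \<in> D"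
proof -
  let ?x = "\<lambda>i::nat. if i = 0 then z else y"
  let ?P = "\<lambda>\<sigma>. cycle_product T d ?x \<sigma>"
  let ?c = "\<lambda>\<sigma>. card (orbit \<sigma> ` {..d})"
  let ?f = "\<lambda>\<sigma> C. T (prod_list (map ?x (Cycles.support \<sigma> (Min C))))"
  have fin: "finite {\<sigma>. \<sigma> permutes {..d}}" by (rule finite_permutations) simp
  have prod_y: "prod_list (map ?x js) = y ^ length js" if "0 \<notin> set js" for js
    using that by (induction js) auto
  have C0: "\<exists>k. ?f \<sigma> (orbit \<sigma> 0) = T (z * y ^ k) \<and> Suc k = card (orbit \<sigma> 0)"
    if \<sigma>: "\<sigma> permutes {..d}" for \<sigma>
  proof -
    have perm: "permutation \<sigma>" using permutes_imp_permutation[OF finite_atMost \<sigma>] .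
    have "finite (orbit \<sigma> 0)" using orbit_partition(2)[OF \<sigma>] by simp
    then have Min: "Min (orbit \<sigma> 0) = 0"
      using permutation_self_in_orbit[OF perm, of 0] by (metis Min_le le_zero_eq)
    obtain js where js: "Cycles.support \<sigma> 0 = 0 # js" "distinct (0 # js)" "set (0 # js) = orbit \<sigma> 0"
      using support_cycle[OF perm, of 0] by metis
    have "?f \<sigma> (orbit \<sigma> 0) = T (z * y ^ length js)"
      unfolding Min js(1) using js(2) prod_y[of js] by simp
    moreover have "Suc (length js) = card (orbit \<sigma> 0)"
      using distinct_card[OF js(2)] js(3) by simp
    ultimately show ?thesis by blast
  qed
  have C_in: "?f \<sigma> C \<in> \<mm>" if \<sigma>: "\<sigma> permutes {..d}" and C: "C \<in> orbit \<sigma> ` {..d}" "C \<noteq> orbit \<sigma> 0" for \<sigma> C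
  proof -
    have perm: "permutation \<sigma>" using permutes_imp_permutation[OF finite_atMost \<sigma>] .
    obtain x where x: "C = orbit \<sigma> x" using C(1) by auto
    have ne: "C \<noteq> {}" using permutation_self_in_orbit[OF perm, of x] x by auto
    have "Min C \<in> C" using orbit_partition(2)[OF \<sigma> C(1)] ne by (rule Min_in)
    then have orb: "orbit \<sigma> (Min C) = C" using perm x by (metis cyclic_on_orbit' orbit_cyclic_eq3)
    obtain js where js: "Cycles.support \<sigma> (Min C) = Min C # js" "set (Min C # js) = C"
      using support_cycle[OF perm, of "Min C"] orb by metis
    have "0 \<notin> C" using C(2) x perm by (metis cyclic_on_orbit' orbit_cyclic_eq3)
    then have "?f \<sigma> C = T (y ^ length (Min C # js))"
      unfolding js(1) using prod_y[of "Min C # js"] js(2) by metis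
    then show ?thesis using M(2)[of "length (Min C # js)"] by simp
  qed
  have split: "?P \<sigma> = ?f \<sigma> (orbit \<sigma> 0) * (\<Prod>C\<in>orbit \<sigma> ` {..d} - {orbit \<sigma> 0}. ?f \<sigma> C)"
    if "\<sigma> permutes {..d}" for \<sigma>
    unfolding cycle_product_def by (rule prod.remove) auto
  have full: "?P \<sigma> = T (z * y ^ d)" if \<sigma>: "\<sigma> permutes {..d}" and "?c \<sigma> = 1" for \<sigma>
  proof -
    obtain C where C: "orbit \<sigma> ` {..d} = {C}" using \<open>?c \<sigma> = 1\<close> by (rule card_1_singletonE)
    then have "orbit \<sigma> 0 = C" by auto
    moreover have "C = {..d}" using orbit_partition(4)[OF \<sigma>] C by simp
    ultimately show ?thesis using split[OF \<sigma>] C C0[OF \<sigma>] by auto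
  qed
  have not_full: "?P \<sigma> \<in> D" if \<sigma>: "\<sigma> permutes {..d}" and "?c \<sigma> \<noteq> 1" for \<sigma>
  proof -
    have "orbit \<sigma> ` {..d} \<noteq> {orbit \<sigma> 0}" using \<open>?c \<sigma> \<noteq> 1\<close> by auto
    then obtain C where C: "C \<in> orbit \<sigma> ` {..d} - {orbit \<sigma> 0}" by auto
    have "(\<Prod>C\<in>orbit \<sigma> ` {..d} - {orbit \<sigma> 0}. ?f \<sigma> C) \<in> \<mm>"
      using C C_in[OF \<sigma>] by (subst prod.remove[OF _ C]) (auto intro!: ideal_multr[OF M(1)])
    moreover have "?f \<sigma> (orbit \<sigma> 0) \<in> L" using C0[OF \<sigma>] L(1) by metis
    ultimately show ?thesis unfolding split[OF \<sigma>] by (subst mult.commute) (rule L(2))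
  qed
  have "frobenius_sum T d ?x = (\<Sum>\<sigma> | \<sigma> permutes {..d}. of_int (sign \<sigma>) * ?P \<sigma>)"
    by (simp add: frobenius_sum_def)
  also have "\<dots> = (\<Sum>\<sigma> | \<sigma> permutes {..d} \<and> ?c \<sigma> = 1. of_int (sign \<sigma>) * ?P \<sigma>)
       + (\<Sum>\<sigma> | \<sigma> permutes {..d} \<and> ?c \<sigma> \<noteq> 1. of_int (sign \<sigma>) * ?P \<sigma>)"
    using fin by (subst sum.union_disjoint[symmetric]) (auto intro!: sum.cong)
  also have "(\<Sum>\<sigma> | \<sigma> permutes {..d} \<and> ?c \<sigma> = 1. of_int (sign \<sigma>) * ?P \<sigma>)
      = of_int (\<Sum>\<sigma> | \<sigma> permutes {..d} \<and> ?c \<sigma> = 1. sign \<sigma>) * T (z * y ^ d)"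
    using full by (auto simp: of_int_sum sum_distrib_right intro!: sum.cong)
  also have "\<dots> = (-1) ^ d * (of_nat (fact d) * T (z * y ^ d))"
  proof -
    have "(-1) ^ d * fact d = int (fact d) * (-1) ^ d" by simp
    then show ?thesis
      by (simp only: sum_sign_full_cycles of_int_mult of_int_of_nat_eq) (simp add: algebra_simps)
  qed
  finally have eq: "frobenius_sum T d ?x = (-1) ^ d * (of_nat (fact d) * T (z * y ^ d))
      + (\<Sum>\<sigma> | \<sigma> permutes {..d} \<and> ?c \<sigma> \<noteq> 1. of_int (sign \<sigma>) * ?P \<sigma>)" .
  have rest: "(\<Sum>\<sigma> | \<sigma> permutes {..d} \<and> ?c \<sigma> \<noteq> 1. of_int (sign \<sigma>) * ?P \<sigma>) \<in> D"
    using not_full by (intro ideal_sum[OF D(1)] ideal_multl[OF D(1)]) auto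
  have "(-1) ^ d * (of_nat (fact d) * T (z * y ^ d)) \<in> D"
    using ideal_diff[OF D(1) D(2) rest] unfolding eq add_diff_cancel_right' .
  from ideal_multl[OF D(1) this, of "(-1) ^ d"] show ?thesis
    by (simp flip: mult.assoc power_mult_distrib)
qed

section \<open>Local rings, Nakayama's lemma and vanishing of pseudocharacters\<close>

text \<open>A non-unit lies in a maximal ideal by Zorn's lemma, and \<open>\<mm>\<close> is the only one.\<close>

lemma local_ring_unit:
  assumes "local_ring \<mm>" and "a \<notin> \<mm>"
  shows "a dvd 1"
proof (rule ccontr)
  assume na: "\<not> a dvd 1"
  define \<S> where "\<S> = {I. ring_ideal I \<and> a \<in> I \<and> 1 \<notin> I}"
  have "\<S> \<noteq> {}" using na by (auto simp: \<S>_def ring_ideal_iff intro!: exI[of _ "{x. a dvd x}"])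
  moreover have "\<Union>\<C> \<in> \<S>" if "\<C> \<noteq> {}" "subset.chain \<S> \<C>" for \<C>
  proof -
    have mem: "I \<in> \<S>" if "I \<in> \<C>" for I using \<open>subset.chain \<S> \<C>\<close> that by (auto simp: subset.chain_def)
    have add: "x + y \<in> \<Union>\<C>" if xy: "x \<in> \<Union>\<C>" "y \<in> \<Union>\<C>" for x y
    proof -
      obtain I where I: "I \<in> \<C>" "x \<in> I" using xy(1) by blast
      obtain J where J: "J \<in> \<C>" "y \<in> J" using xy(2) by blast
      have "I \<subseteq> J \<or> J \<subseteq> I" using \<open>subset.chain \<S> \<C>\<close> I J unfolding subset_chain_def by blast
      then obtain H where "H \<in> \<C>" "x \<in> H" "y \<in> H" using I J by blast
      then have "x + y \<in> H" using mem[of H] by (simp add: \<S>_def ideal_add)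
      then show ?thesis using \<open>H \<in> \<C>\<close> by blast
    qed
    have mult: "c * x \<in> \<Union>\<C>" if "x \<in> \<Union>\<C>" for c x
    proof -
      obtain H where "H \<in> \<C>" "x \<in> H" using \<open>x \<in> \<Union>\<C>\<close> by blast
      then have "c * x \<in> H" using mem[of H] by (simp add: \<S>_def ideal_multl)
      then show ?thesis using \<open>H \<in> \<C>\<close> by blast
    qed
    obtain H where H: "H \<in> \<C>" using \<open>\<C> \<noteq> {}\<close> by blast
    then have "0 \<in> H" "a \<in> H" using mem[of H] by (simp_all add: \<S>_def ideal_zero)
    then have "0 \<in> \<Union>\<C>" "a \<in> \<Union>\<C>" "1 \<notin> (\<Union>\<C>)"
      using mem H by (blast, blast, auto simp: \<S>_def)
    then show ?thesis unfolding \<S>_def ring_ideal_iff mem_Collect_eq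
      using add mult by (intro conjI ballI allI)
  qed
  ultimately have "\<exists>M\<in>\<S>. \<forall>J\<in>\<S>. M \<subseteq> J \<longrightarrow> J = M"
    by (rule subset_Zorn_nonempty)
  then obtain M where M: "M \<in> \<S>" "\<And>J. J \<in> \<S> \<Longrightarrow> M \<subseteq> J \<Longrightarrow> J = M"
    by blast
  have "maximal_ideal M"
    unfolding maximal_ideal_def
  proof (intro conjI allI impI)
    show "ring_ideal M" "M \<noteq> UNIV" using M(1) by (auto simp: \<S>_def)
    fix J assume J: "ring_ideal J \<and> M \<subseteq> J"
    show "J = M \<or> J = UNIV"
    proof (cases "1 \<in> J")
      case True
      then have "x \<in> J" for x using ideal_multl[of J 1 x] J by simp
      then show ?thesis by blast
    next
      case False
      then have "J \<in> \<S>" using J M(1) by (auto simp: \<S>_def)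
      then show ?thesis using M(2) J by blast
    qed
  qed
  then have "M = \<mm>" using assms(1) by (simp add: local_ring_def)
  then show False using M(1) assms(2) by (simp add: \<S>_def)
qed

lemma local_ringD:
  assumes "local_ring \<mm>"
  shows "ring_ideal \<mm>" and "1 \<notin> \<mm>"
proof -
  show I: "ring_ideal \<mm>" using assms by (simp add: local_ring_def maximal_ideal_def)
  show "1 \<notin> \<mm>"
  proof
    assume "1 \<in> \<mm>"
    then have "x \<in> \<mm>" for x using ideal_multl[OF I, of 1 x] by simp
    then show False using assms by (auto simp: local_ring_def maximal_ideal_def)
  qed
qed

lemma unit_one_minus:
  assumes "local_ring \<mm>" and "c \<in> \<mm>"
  obtains u where "u * (1 - c) = 1"
proof -
  have "1 - c \<notin> \<mm>" using ideal_add[OF local_ringD(1)[OF assms(1)], of "1 - c" c] assms local_ringD(2) by auto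
  then have "1 - c dvd 1" using local_ring_unit assms(1) by blast
  then show thesis using that by (metis dvdE mult.commute)
qed

text \<open>Generators are eliminated one at a time: \<open>1 - c s\<close> is a unit, so the relation for \<open>s\<close> expresses \<open>s\<close> modulo \<open>J\<close>
  through the remaining generators, again with coefficients in \<open>\<mm>\<close>.\<close>

lemma nakayama_finite:
  assumes m: "local_ring \<mm>" and J: "ring_ideal J" and "finite S"
    and "\<And>s. s \<in> S \<Longrightarrow> \<exists>c. (\<forall>t\<in>S. c t \<in> \<mm>) \<and> s - (\<Sum>t\<in>S. c t * t) \<in> J"
  shows "S \<subseteq> J"
  using assms(3,4)
proof (induction S rule: finite_induct)
  case (insert s S)
  note mi = local_ringD(1)[OF m]
  obtain c where c: "\<And>t. t \<in> insert s S \<Longrightarrow> c t \<in> \<mm>" "s - (\<Sum>t\<in>insert s S. c t * t) \<in> J"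
    using insert.prems[of s] by blast
  obtain u where u: "u * (1 - c s) = 1" using unit_one_minus[OF m c(1)[of s]] by auto
  have "u * (s - (\<Sum>t\<in>insert s S. c t * t)) = (u * (1 - c s)) * s - (\<Sum>t\<in>S. u * c t * t)"
    using insert.hyps by (simp add: algebra_simps sum_distrib_left)
  then have s: "s - (\<Sum>t\<in>S. u * c t * t) \<in> J"
    using ideal_multl[OF J c(2), of u] u by simp
  have "S \<subseteq> J"
  proof (rule insert.IH)
    fix r assume r: "r \<in> S"
    obtain c' where c': "\<And>t. t \<in> insert s S \<Longrightarrow> c' t \<in> \<mm>" "r - (\<Sum>t\<in>insert s S. c' t * t) \<in> J"
      using insert.prems[of r] r by blast
    have "(r - (\<Sum>t\<in>insert s S. c' t * t)) + c' s * (s - (\<Sum>t\<in>S. u * c t * t)) \<in> J"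
      using ideal_add[OF J c'(2) ideal_multl[OF J s]] .
    also have "(r - (\<Sum>t\<in>insert s S. c' t * t)) + c' s * (s - (\<Sum>t\<in>S. u * c t * t))
        = r - (\<Sum>t\<in>S. (c' t + c' s * u * c t) * t)"
      using insert.hyps by (simp add: algebra_simps sum_distrib_left sum.distrib)
    finally have "r - (\<Sum>t\<in>S. (c' t + c' s * u * c t) * t) \<in> J" .
    moreover have "c' t + c' s * u * c t \<in> \<mm>" if "t \<in> S" for t
      using that c(1) c'(1) by (intro ideal_add[OF mi] ideal_multl[OF mi]) auto
    ultimately show "\<exists>c. (\<forall>t\<in>S. c t \<in> \<mm>) \<and> r - (\<Sum>t\<in>S. c t * t) \<in> J"
      by (intro exI[of _ "\<lambda>t. c' t + c' s * u * c t"] conjI ballI)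
  qed
  moreover have "(\<Sum>t\<in>S. u * c t * t) \<in> J"
    using \<open>S \<subseteq> J\<close> by (intro ideal_sum[OF J] ideal_multl[OF J]) auto
  from ideal_add[OF J s this] have "s \<in> J" by simp
  ultimately show ?case by simp
qed simp

text \<open>Nakayama's lemma, in the form \<open>L \<subseteq> J + \<mm> L\<close> implies \<open>L \<subseteq> J\<close>. The hypothesis speaks of an arbitrary ideal \<open>D\<close>
  above \<open>J\<close> and \<open>\<mm> L\<close>, so that an application can compute modulo \<open>D\<close> without handling the ideal \<open>J + \<mm> L\<close>.\<close>

lemma nakayama:
  fixes \<mm> J L :: "'a::comm_ring_1 set"
  assumes N: "noetherian TYPE('a)" and m: "local_ring \<mm>" and J: "ring_ideal J" and L: "ring_ideal L"
    and step: "\<And>D. ring_ideal D \<Longrightarrow> J \<subseteq> D \<Longrightarrow> (\<And>c l. c \<in> \<mm> \<Longrightarrow> l \<in> L \<Longrightarrow> c * l \<in> D) \<Longrightarrow> L \<subseteq> D"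
  shows "L \<subseteq> J"
proof -
  note mi = local_ringD(1)[OF m]
  obtain S where S: "finite S" "L = ideal_span S" using N L unfolding noetherian_def by blast
  \<comment> \<open>this is \<open>J + \<mm> L\<close>, written through the generators of \<open>L\<close>\<close>
  define D where "D = {x. \<exists>c. (\<forall>t\<in>S. c t \<in> \<mm>) \<and> x - (\<Sum>t\<in>S. c t * t) \<in> J}"
  have DI: "x \<in> D" if "\<forall>t\<in>S. c t \<in> \<mm>" "x - (\<Sum>t\<in>S. c t * t) \<in> J" for c x
    using that unfolding D_def mem_Collect_eq by (intro exI[of _ c] conjI)
  have "L \<subseteq> D"
  proof (rule step)
    show "ring_ideal D"
      unfolding ring_ideal_iff
    proof (intro conjI ballI allI)
      show "0 \<in> D" unfolding D_def using ideal_zero[OF mi] ideal_zero[OF J]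
        by (auto intro!: exI[of _ "\<lambda>_. 0"])
      fix x assume "x \<in> D"
      then obtain c where c: "\<forall>t\<in>S. c t \<in> \<mm>" "x - (\<Sum>t\<in>S. c t * t) \<in> J" unfolding D_def by blast
      show "x + y \<in> D" if y: "y \<in> D" for y
      proof -
        obtain c' where c': "\<forall>t\<in>S. c' t \<in> \<mm>" "y - (\<Sum>t\<in>S. c' t * t) \<in> J"
          using y unfolding D_def by blast
        have "x + y - (\<Sum>t\<in>S. (c t + c' t) * t) \<in> J"
          using ideal_add[OF J c(2) c'(2)] by (simp add: algebra_simps sum.distrib)
        moreover have "\<forall>t\<in>S. c t + c' t \<in> \<mm>" using c(1) c'(1) ideal_add[OF mi] by blast
        ultimately show ?thesis by (intro DI)
      qed
      show "a * x \<in> D" for a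
      proof -
        have "a * x - (\<Sum>t\<in>S. (a * c t) * t) \<in> J"
          using ideal_multl[OF J c(2), of a] by (simp add: algebra_simps sum_distrib_left)
        moreover have "\<forall>t\<in>S. a * c t \<in> \<mm>" using c(1) ideal_multl[OF mi] by blast
        ultimately show ?thesis by (intro DI)
      qed
    qed
    show "J \<subseteq> D" unfolding D_def using ideal_zero[OF mi] by (auto intro!: exI[of _ "\<lambda>_. 0"])
    fix c l assume c: "c \<in> \<mm>" and l: "l \<in> L"
    obtain f where f: "l = (\<Sum>t\<in>S. f t * t)"
      using l S module.span_finite[OF module_times S(1)] by auto
    have "c * l - (\<Sum>t\<in>S. (c * f t) * t) \<in> J"
      using ideal_zero[OF J] by (simp add: f sum_distrib_left mult.assoc)
    moreover have "\<forall>t\<in>S. c * f t \<in> \<mm>" using c ideal_multr[OF mi] by blast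
    ultimately show "c * l \<in> D" by (intro DI)
  qed
  moreover have "S \<subseteq> L" using S(2) module.span_superset[OF module_times] by blast
  ultimately have "S \<subseteq> D" by blast
  then have "S \<subseteq> J" unfolding D_def by (intro nakayama_finite[OF m J S(1)]) blast
  then show ?thesis using S(2) J by (simp add: module.span_minimal[OF module_times])
qed

lemma pseudocharacter_modD:
  assumes "pseudocharacter_mod \<eta> J d T"
  shows "T (x + y) - (T x + T y) \<in> J" "T (\<eta> a * x) - a * T x \<in> J" "T (x * y) - T (y * x) \<in> J"
    "frobenius_sum T d f \<in> J"
  using assms by (simp_all add: pseudocharacter_mod_def)

lemma pseudocharacter_power:
  fixes T :: "'r::ring_1 \<Rightarrow> 'a::comm_ring_1"
  assumes T: "pseudocharacter_mod \<eta> J d T" and D: "ring_ideal D" "J \<subseteq> D"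
    and d: "(of_nat (fact d) :: 'a) dvd 1"
    and M: "ring_ideal \<mm>" "\<And>k. k > 0 \<Longrightarrow> T (y ^ k) \<in> \<mm>"
    and L: "\<And>k. T (z * y ^ k) \<in> L" "\<And>c l. c \<in> \<mm> \<Longrightarrow> l \<in> L \<Longrightarrow> c * l \<in> D"
  shows "T (z * y ^ d) \<in> D"
proof -
  have "of_nat (fact d) * T (z * y ^ d) \<in> D"
    using pseudocharacter_modD(4)[OF T] D(2) by (intro frobenius_full_cycle[OF D(1) _ M L]) auto
  then have mem: "u * (of_nat (fact d) * T (z * y ^ d)) \<in> D" for u by (rule ideal_multl[OF D(1)])
  obtain u :: 'a where "1 = of_nat (fact d) * u" using d by (rule dvdE)
  then have "u * (of_nat (fact d) * T (z * y ^ d)) = T (z * y ^ d)"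
    by (metis mult.assoc mult.commute mult_1)
  with mem[of u] show ?thesis by simp
qed

text \<open>The values of \<open>T\<close> on a submodule \<open>Z\<close> of \<open>R\<close>, together with \<open>J\<close>, form the ideal to which Nakayama's lemma
  is applied below.\<close>

lemma trace_ideal:
  assumes T: "pseudocharacter_mod \<eta> J d T" and J: "ring_ideal J"
    and Z: "0 \<in> Z" "\<And>z z'. z \<in> Z \<Longrightarrow> z' \<in> Z \<Longrightarrow> z + z' \<in> Z" "\<And>a z. z \<in> Z \<Longrightarrow> \<eta> a * z \<in> Z"
  shows "ring_ideal {a. \<exists>z\<in>Z. a - T z \<in> J}"
  unfolding ring_ideal_iff
proof (intro conjI ballI allI)
  have "T (0 + 0) - (T 0 + T 0) \<in> J" using pseudocharacter_modD(1)[OF T] .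
  then show "0 \<in> {a. \<exists>z\<in>Z. a - T z \<in> J}" using Z(1) by auto
  fix a assume "a \<in> {a. \<exists>z\<in>Z. a - T z \<in> J}"
  then obtain z where z: "z \<in> Z" "a - T z \<in> J" by auto
  show "a + b \<in> {a. \<exists>z\<in>Z. a - T z \<in> J}" if "b \<in> {a. \<exists>z\<in>Z. a - T z \<in> J}" for b
  proof -
    obtain z' where z': "z' \<in> Z" "b - T z' \<in> J" using \<open>b \<in> _\<close> by auto
    have "(a - T z) + (b - T z') - (T (z + z') - (T z + T z')) \<in> J"
      by (intro ideal_diff[OF J] ideal_add[OF J] z z' pseudocharacter_modD(1)[OF T])
    then have "(a + b) - T (z + z') \<in> J" by (simp add: algebra_simps)
    then show ?thesis using Z(2) z z' by auto
  qed
  show "c * a \<in> {a. \<exists>z\<in>Z. a - T z \<in> J}" for c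
  proof -
    have "c * (a - T z) - (T (\<eta> c * z) - c * T z) \<in> J"
      by (intro ideal_diff[OF J] ideal_multl[OF J] z pseudocharacter_modD(2)[OF T])
    then have "c * a - T (\<eta> c * z) \<in> J" by (simp add: algebra_simps)
    then show ?thesis using Z(3) z by auto
  qed
qed

text \<open>Here \<open>T1\<close> and \<open>T2\<close> cancel on the right ideal \<open>K\<close>, and \<open>y\<close> separates them residually: it acts like \<open>0\<close> for
  \<open>T2\<close>, and like \<open>1\<close> for \<open>T1\<close>. The full cycle argument makes \<open>T2 (z * y ^ n2)\<close> and
  \<open>T1 (z * (1 - y) ^ n1)\<close> vanish modulo \<open>\<mm>\<close> times the values on \<open>K\<close>, and in the second case \<open>T2\<close> agrees with
  \<open>T1\<close> up to sign. Since \<open>1 = (y + (1 - y)) ^ (n1 + n2)\<close>, every \<open>z\<close> is a sum of terms of these two kinds.\<close>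

lemma pseudocharacter_vanishes_on_kernel:
  fixes T1 T2 :: "'r::ring_1 \<Rightarrow> 'a::comm_ring_1"
  assumes N: "noetherian TYPE('a)" and m: "local_ring \<mm>" and J: "ring_ideal J"
    and T1: "pseudocharacter_mod \<eta> J n1 T1" and T2: "pseudocharacter_mod \<eta> J n2 T2"
    and fact: "(of_nat (fact n1) :: 'a) dvd 1" "(of_nat (fact n2) :: 'a) dvd 1"
    and K: "0 \<in> K" "\<And>z z'. z \<in> K \<Longrightarrow> z' \<in> K \<Longrightarrow> z + z' \<in> K" "\<And>a z. z \<in> K \<Longrightarrow> \<eta> a * z \<in> K"
      "\<And>z x. z \<in> K \<Longrightarrow> z * x \<in> K"
    and sum: "\<And>z. z \<in> K \<Longrightarrow> T1 z + T2 z \<in> J"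
    and y: "\<And>k. k > 0 \<Longrightarrow> T2 (y ^ k) \<in> \<mm>" "\<And>k. k > 0 \<Longrightarrow> T1 ((1 - y) ^ k) \<in> \<mm>"
    and "z \<in> K"
  shows "T2 z \<in> J"
proof -
  define L where "L = {a. \<exists>z\<in>K. a - T2 z \<in> J}"
  have L: "ring_ideal L" unfolding L_def by (rule trace_ideal[OF T2 J K(1-3)])
  have T2L: "T2 z \<in> L" if "z \<in> K" for z
    using that ideal_zero[OF J] by (auto simp: L_def intro!: bexI[of _ z])
  have JL: "J \<subseteq> L"
  proof
    fix j assume "j \<in> J"
    then have "j + (T2 (0 + 0) - (T2 0 + T2 0)) \<in> J"
      by (intro ideal_add[OF J] pseudocharacter_modD(1)[OF T2])
    then show "j \<in> L" using K(1) by (auto simp: L_def)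
  qed
  have T1L: "T1 z \<in> L" if "z \<in> K" for z
  proof -
    have "T1 z + T2 z - T2 z \<in> L" using sum[OF that] JL by (intro ideal_diff[OF L _ T2L[OF that]]) blast
    then show ?thesis by simp
  qed
  have "L \<subseteq> J"
  proof (rule nakayama[OF N m J L])
    fix D assume D: "ring_ideal D" "J \<subseteq> D" and mL: "\<And>c l. c \<in> \<mm> \<Longrightarrow> l \<in> L \<Longrightarrow> c * l \<in> D"
    note mi = local_ringD(1)[OF m]
    have a: "T2 (z * y ^ n2) \<in> D" if "z \<in> K" for z
      by (rule pseudocharacter_power[OF T2 D fact(2) mi y(1) _ mL]) (auto intro: T2L K(4) that)
    have b: "T2 (z * (1 - y) ^ n1) \<in> D" if "z \<in> K" for z
    proof -
      have "T1 (z * (1 - y) ^ n1) \<in> D"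
        by (rule pseudocharacter_power[OF T1 D fact(1) mi y(2) _ mL]) (auto intro: T1L K(4) that)
      moreover have "T1 (z * (1 - y) ^ n1) + T2 (z * (1 - y) ^ n1) \<in> D"
        using sum[OF K(4)[OF that]] D(2) by blast
      ultimately have "T1 (z * (1 - y) ^ n1) + T2 (z * (1 - y) ^ n1) - T1 (z * (1 - y) ^ n1) \<in> D"
        by (intro ideal_diff[OF D(1)])
      then show ?thesis by simp
    qed
    have comm: "y * (1 - y) = (1 - y) * y" by (simp add: algebra_simps)
    have commk: "y ^ k * (1 - y) ^ l = (1 - y) ^ l * y ^ k" for k l
      using power_commuting_commutes[OF power_commuting_commutes[OF comm, symmetric], symmetric] .
    \<comment> \<open>splitting \<open>1 = y + (1 - y)\<close> raises one of the exponents until one of them reaches its bound\<close>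
    have "T2 (z * (y ^ k * (1 - y) ^ l)) \<in> D" if "z \<in> K" for z k l
    proof (induction "(n2 - k) + (n1 - l)" arbitrary: k l rule: less_induct)
      case less
      show ?case
      proof (cases "n2 \<le> k \<or> n1 \<le> l")
        case True
        then show ?thesis
        proof
          assume "n2 \<le> k"
          then have "z * (y ^ k * (1 - y) ^ l) = (z * (1 - y) ^ l * y ^ (k - n2)) * y ^ n2"
            by (simp add: commk mult.assoc flip: power_add)
          then show ?thesis using a[OF K(4)[OF K(4)[OF \<open>z \<in> K\<close>]]] by simp
        next
          assume "n1 \<le> l"
          then have "z * (y ^ k * (1 - y) ^ l) = (z * y ^ k * (1 - y) ^ (l - n1)) * (1 - y) ^ n1"
            by (simp add: mult.assoc flip: power_add)
          then show ?thesis using b[OF K(4)[OF K(4)[OF \<open>z \<in> K\<close>]]] by simp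
        qed
      next
        case False
        have "z * (y ^ k * (1 - y) ^ l) = z * (y ^ Suc k * (1 - y) ^ l) + z * (y ^ k * (1 - y) ^ Suc l)"
        proof -
          have "y ^ Suc k * (1 - y) ^ l + y ^ k * (1 - y) ^ Suc l = y ^ k * (y + (1 - y)) * (1 - y) ^ l"
            by (simp only: power_Suc2[of y] power_Suc[of "1 - y"] distrib_left distrib_right mult.assoc)
          also have "\<dots> = y ^ k * (1 - y) ^ l" by simp
          finally show ?thesis by (simp only: distrib_left[symmetric])
        qed
        moreover have "T2 (z * (y ^ Suc k * (1 - y) ^ l)) + T2 (z * (y ^ k * (1 - y) ^ Suc l)) \<in> D"
          using False by (intro ideal_add[OF D(1)] less) auto
        ultimately show ?thesis
          using ideal_congI[OF D(1) subsetD[OF D(2) pseudocharacter_modD(1)[OF T2]]] by simp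
      qed
    qed
    from this[of _ 0 0] have T2D: "T2 z \<in> D" if "z \<in> K" for z using that by simp
    show "L \<subseteq> D"
    proof
      fix a assume "a \<in> L"
      then obtain z where "z \<in> K" "a - T2 z \<in> J" by (auto simp: L_def)
      then show "a \<in> D" using T2D ideal_congI[OF D(1), of a "T2 z"] D(2) by blast
    qed
  qed
  then show ?thesis using T2L[OF \<open>z \<in> K\<close>] by blast
qed

text \<open>The condition \<open>T (z * x ^ Suc d) \<equiv> T (z * x)\<close> says that \<open>x\<close> is idempotent for \<open>T\<close>; as its powers have trace in
  \<open>\<mm>\<close>, it behaves like one of rank zero. The full cycle argument at \<open>(z * x, x, \<dots>, x)\<close> returns \<open>T (z * x)\<close> itself,
  which makes the ideal of these values equal to \<open>\<mm>\<close> times itself modulo \<open>J\<close>.\<close>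

lemma pseudocharacter_vanishes_on_left_ideal:
  fixes T :: "'r::ring_1 \<Rightarrow> 'a::comm_ring_1"
  assumes N: "noetherian TYPE('a)" and m: "local_ring \<mm>" and J: "ring_ideal J"
    and T: "pseudocharacter_mod \<eta> J d T" and fact: "(of_nat (fact d) :: 'a) dvd 1"
    and x: "\<And>k. k > 0 \<Longrightarrow> T (x ^ k) \<in> \<mm>" "\<And>z. T (z * x ^ Suc d) - T (z * x) \<in> J"
  shows "T (z * x) \<in> J"
proof -
  define L where "L = {a. \<exists>z\<in>range (\<lambda>z. z * x). a - T z \<in> J}"
  have L: "ring_ideal L" unfolding L_def
  proof (rule trace_ideal[OF T J])
    show "0 \<in> range (\<lambda>z. z * x)" by (rule range_eqI[of _ _ 0]) simp
    show "z + z' \<in> range (\<lambda>z. z * x)" if "z \<in> range (\<lambda>z. z * x)" "z' \<in> range (\<lambda>z. z * x)" for z z'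
      using that by (auto simp flip: distrib_right)
    show "\<eta> a * z \<in> range (\<lambda>z. z * x)" if "z \<in> range (\<lambda>z. z * x)" for a z
      using that by (auto simp flip: mult.assoc)
  qed
  have TL: "T (z * x) \<in> L" for z
    using ideal_zero[OF J] by (auto simp: L_def intro!: exI[of _ z])
  have "L \<subseteq> J"
  proof (rule nakayama[OF N m J L])
    fix D assume D: "ring_ideal D" "J \<subseteq> D" and mL: "\<And>c l. c \<in> \<mm> \<Longrightarrow> l \<in> L \<Longrightarrow> c * l \<in> D"
    have TD: "T (z * x) \<in> D" for z
    proof -
      have "T (z * x * x ^ k) \<in> L" for k using TL[of "z * x ^ k"] by (simp add: mult.assoc power_commutes)
      then have "T (z * x * x ^ d) \<in> D"
        by (intro pseudocharacter_power[OF T D fact local_ringD(1)[OF m] x(1) _ mL])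
      then show ?thesis
        using ideal_congI[OF D(1), of "T (z * x ^ Suc d)" "T (z * x)"] x(2)[of z] D(2)
        by (auto simp: mult.assoc)
    qed
    show "L \<subseteq> D"
    proof
      fix a assume "a \<in> L"
      then obtain z where "a - T (z * x) \<in> J" by (auto simp: L_def)
      then show "a \<in> D" using TD ideal_congI[OF D(1), of a "T (z * x)"] D(2) by blast
    qed
  qed
  then show ?thesis using TL by blast
qed

section \<open>Cayley-Hamilton and lifting of idempotents\<close>

lemma matrix_repD:
  assumes \<rho>: "matrix_rep \<eta> c d \<rho>" and "i < d" "j < d"
  shows "\<rho> (x + y) $$ (i, j) = \<rho> x $$ (i, j) + \<rho> y $$ (i, j)"
    and "\<rho> (x * y) $$ (i, j) = (\<Sum>k<d. \<rho> x $$ (i, k) * \<rho> y $$ (k, j))"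
    and "\<rho> 1 $$ (i, j) = (if i = j then 1 else 0)"
    and "\<rho> (\<eta> a * x) $$ (i, j) = c a * \<rho> x $$ (i, j)"
proof -
  have [simp]: "\<rho> x \<in> carrier_mat d d" for x using \<rho> by (simp add: matrix_rep_def)
  then have [simp]: "dim_row (\<rho> x) = d" "dim_col (\<rho> x) = d" for x by (metis carrier_matD)+
  show "\<rho> (x + y) $$ (i, j) = \<rho> x $$ (i, j) + \<rho> y $$ (i, j)"
    using \<rho> assms(2,3) by (simp add: matrix_rep_def)
  show "\<rho> (x * y) $$ (i, j) = (\<Sum>k<d. \<rho> x $$ (i, k) * \<rho> y $$ (k, j))"
    using \<rho> assms(2,3) by (simp add: matrix_rep_def scalar_prod_def atLeast0LessThan)
  show "\<rho> 1 $$ (i, j) = (if i = j then 1 else 0)"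
    using \<rho> assms(2,3) by (simp add: matrix_rep_def)
  have "\<rho> (\<eta> a * x) = c a \<cdot>\<^sub>m \<rho> x" using \<rho> unfolding matrix_rep_def by blast
  then show "\<rho> (\<eta> a * x) $$ (i, j) = c a * \<rho> x $$ (i, j)" using assms(2,3) by simp
qed

lemma matrix_rep_dim [simp]:
  assumes "matrix_rep \<eta> c d \<rho>"
  shows "\<rho> x \<in> carrier_mat d d" "dim_row (\<rho> x) = d" "dim_col (\<rho> x) = d"
  using assms carrier_matD[of "\<rho> x" d d] by (simp_all add: matrix_rep_def)

lemma matrix_rep_0:
  assumes "matrix_rep \<eta> c d \<rho>" and "i < d" "j < d"
  shows "\<rho> 0 $$ (i, j) = 0"
  using matrix_repD(1)[OF assms, of 0 0] by simp

lemma matrix_rep_sum: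
  assumes "matrix_rep \<eta> c d \<rho>" and "i < d" "j < d"
  shows "\<rho> (\<Sum>k\<in>A. f k) $$ (i, j) = (\<Sum>k\<in>A. \<rho> (f k) $$ (i, j))"
  by (induction A rule: infinite_finite_induct)
     (simp_all add: matrix_rep_0[OF assms] matrix_repD[OF assms])

lemma matrix_rep_uminus:
  assumes "matrix_rep \<eta> c d \<rho>" and "i < d" "j < d"
  shows "\<rho> (- x) $$ (i, j) = - \<rho> x $$ (i, j)"
  using matrix_repD(1)[OF assms, of x "- x"] matrix_rep_0[OF assms]
  by (simp add: eq_neg_iff_add_eq_0 add.commute)

lemma matrix_rep_diff:
  assumes "matrix_rep \<eta> c d \<rho>" and "i < d" "j < d"
  shows "\<rho> (x - y) $$ (i, j) = \<rho> x $$ (i, j) - \<rho> y $$ (i, j)"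
  using matrix_repD(1)[OF assms, of x "- y"] matrix_rep_uminus[OF assms, of y] by simp

text \<open>Horner evaluation of a polynomial over the base ring at an element of a non-commutative algebra.\<close>

definition alg_eval :: "('a::comm_ring_1 \<Rightarrow> 'r::ring_1) \<Rightarrow> 'r \<Rightarrow> 'a poly \<Rightarrow> 'r" where
  "alg_eval \<eta> x p = fold_coeffs (\<lambda>c r. \<eta> c + x * r) p 0"

lemma algebra_mapD:
  assumes "algebra_map \<eta>"
  shows "\<eta> 0 = 0" "\<eta> 1 = 1" "\<eta> (a + b) = \<eta> a + \<eta> b" "\<eta> (a * b) = \<eta> a * \<eta> b" "\<eta> (- a) = - \<eta> a"
    "\<eta> a * x = x * \<eta> a"
proof -
  interpret Ring_Hom.ring_hom \<eta> using assms by (simp add: algebra_map_def)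
  show "\<eta> 0 = 0" "\<eta> 1 = 1" "\<eta> (a + b) = \<eta> a + \<eta> b" "\<eta> (a * b) = \<eta> a * \<eta> b" "\<eta> (- a) = - \<eta> a"
    by (simp_all add: hom_distribs)
  show "\<eta> a * x = x * \<eta> a" using assms by (simp add: algebra_map_def)
qed

lemma alg_eval_simps:
  assumes "algebra_map \<eta>"
  shows "alg_eval \<eta> x 0 = 0"
    and "alg_eval \<eta> x (pCons a p) = \<eta> a + x * alg_eval \<eta> x p"
    and "alg_eval \<eta> x (p + q) = alg_eval \<eta> x p + alg_eval \<eta> x q"
    and "alg_eval \<eta> x (smult a p) = \<eta> a * alg_eval \<eta> x p"
    and "alg_eval \<eta> x (p * q) = alg_eval \<eta> x p * alg_eval \<eta> x q"
    and "alg_eval \<eta> x (- p) = - alg_eval \<eta> x p"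
    and "alg_eval \<eta> x (p - q) = alg_eval \<eta> x p - alg_eval \<eta> x q"
    and "alg_eval \<eta> x (monom 1 k) = x ^ k"
    and "alg_eval \<eta> x (\<Sum>i\<in>A. f i) = (\<Sum>i\<in>A. alg_eval \<eta> x (f i))"
proof -
  note \<eta> = algebra_mapD[OF assms]
  show zero: "alg_eval \<eta> x 0 = 0" by (simp add: alg_eval_def)
  show pc: "alg_eval \<eta> x (pCons a p) = \<eta> a + x * alg_eval \<eta> x p" for a p
    by (cases "a = 0 \<and> p = 0") (auto simp: alg_eval_def \<eta>)
  show add: "alg_eval \<eta> x (p + q) = alg_eval \<eta> x p + alg_eval \<eta> x q" for p q
    by (induction p q rule: poly_induct2) (simp_all add: zero pc \<eta> algebra_simps)
  show sm: "alg_eval \<eta> x (smult a p) = \<eta> a * alg_eval \<eta> x p" for a p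
    by (induction p) (simp_all add: zero pc \<eta>(4) distrib_left, metis \<eta>(6) mult.assoc)
  show "alg_eval \<eta> x (p * q) = alg_eval \<eta> x p * alg_eval \<eta> x q" for p q
    by (induction p) (simp_all add: zero pc add sm \<eta>(1) distrib_right mult.assoc)
  show um: "alg_eval \<eta> x (- p) = - alg_eval \<eta> x p" for p
    using add[of p "- p"] zero by (simp add: eq_neg_iff_add_eq_0 add.commute)
  show "alg_eval \<eta> x (p - q) = alg_eval \<eta> x p - alg_eval \<eta> x q" for p q
    using add[of p "- q"] um by simp
  show "alg_eval \<eta> x (monom 1 k) = x ^ k"
    by (induction k) (simp_all add: zero pc \<eta> monom_0 monom_Suc)
  show "alg_eval \<eta> x (\<Sum>i\<in>A. f i) = (\<Sum>i\<in>A. alg_eval \<eta> x (f i))"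
    by (induction A rule: infinite_finite_induct) (simp_all add: zero add)
qed

text \<open>Let polynomials \<open>g l\<close> be evaluated at \<open>x\<close>. The matrix \<open>X - \<rho>(x)\<close>, applied to the vector \<open>(g l)\<close>, is killed by
  this evaluation followed by the pairing \<open>\<Sum>\<^sub>k \<rho>(\<cdot>)\<^sub>i\<^sub>k\<close>, because multiplication by \<open>X\<close> turns into multiplication by
  \<open>\<rho>(x)\<close>. Taking for \<open>g\<close> a column of the adjugate of \<open>X - \<rho>(x)\<close> leaves the characteristic polynomial. The theorem is
  stated for an algebra over a commutative ring, not only for matrices, since the idempotents have to lie in
  \<open>\<rho>(R)\<close>.\<close>

theorem cayley_hamilton:
  assumes \<eta>: "algebra_map \<eta>" and \<rho>: "matrix_rep \<eta> (\<lambda>a. a) n \<rho>" and "i < n" "j < n"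
  shows "\<rho> (alg_eval \<eta> x (char_poly (\<rho> x))) $$ (i, j) = 0"
proof -
  let ?ev = "alg_eval \<eta> x" and ?N = "char_poly_matrix (\<rho> x)"
  note ev = alg_eval_simps[OF \<eta>]
  have N: "?N \<in> carrier_mat n n" using matrix_rep_dim[OF \<rho>] by simp
  have entry: "?N $$ (k, l) = (if k = l then [:0, 1:] else 0) - [:\<rho> x $$ (k, l):]"
    if "k < n" "l < n" for k l
    using that matrix_rep_dim[OF \<rho>, of x] by (simp add: char_poly_matrix_def)
  \<comment> \<open>the vector \<open>(X - \<rho>(x)) g\<close> is killed, for every vector \<open>g\<close> of polynomials\<close>
  have kill: "(\<Sum>k<n. \<rho> (?ev (\<Sum>l<n. ?N $$ (k, l) * g l)) $$ (i, k)) = 0" for g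
  proof -
    have step: "?ev (\<Sum>l<n. ?N $$ (k, l) * g l) = ?ev (g k) * x - (\<Sum>l<n. \<eta> (\<rho> x $$ (k, l)) * ?ev (g l))"
      if k: "k < n" for k
    proof -
      have "(\<Sum>l<n. ?N $$ (k, l) * g l)
          = (\<Sum>l<n. (if k = l then g l * [:0, 1:] else 0) - smult (\<rho> x $$ (k, l)) (g l))"
        using k by (intro sum.cong refl) (auto simp: entry left_diff_distrib mult.commute)
      also have "\<dots> = g k * [:0, 1:] - (\<Sum>l<n. smult (\<rho> x $$ (k, l)) (g l))"
        using k by (simp add: sum_subtractf)
      also have "?ev \<dots> = ?ev (g k) * ?ev [:0, 1:] - (\<Sum>l<n. \<eta> (\<rho> x $$ (k, l)) * ?ev (g l))"
        by (simp only: ev)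
      also have "?ev [:0, 1:] = x" by (simp add: ev algebra_mapD[OF \<eta>])
      finally show ?thesis .
    qed
    have "(\<Sum>k<n. \<rho> (?ev (\<Sum>l<n. ?N $$ (k, l) * g l)) $$ (i, k))
       = (\<Sum>k<n. (\<Sum>l<n. \<rho> (?ev (g k)) $$ (i, l) * \<rho> x $$ (l, k))
            - (\<Sum>l<n. \<rho> x $$ (k, l) * \<rho> (?ev (g l)) $$ (i, k)))"
    proof (intro sum.cong refl)
      fix k assume "k \<in> {..<n}"
      then have k: "k < n" by simp
      note r = matrix_rep_diff[OF \<rho> \<open>i < n\<close> k] matrix_rep_sum[OF \<rho> \<open>i < n\<close> k] matrix_repD(4)[OF \<rho> \<open>i < n\<close> k]
      show "\<rho> (?ev (\<Sum>l<n. ?N $$ (k, l) * g l)) $$ (i, k)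
        = (\<Sum>l<n. \<rho> (?ev (g k)) $$ (i, l) * \<rho> x $$ (l, k))
            - (\<Sum>l<n. \<rho> x $$ (k, l) * \<rho> (?ev (g l)) $$ (i, k))"
        unfolding step[OF k] r matrix_repD(2)[OF \<rho> \<open>i < n\<close> k, of "?ev (g k)" x] ..
    qed
    also have "\<dots> = 0"
      by (simp add: sum_subtractf) (subst sum.swap, simp add: mult.commute)
    finally show ?thesis .
  qed
  have "(\<Sum>l<n. ?N $$ (k, l) * adj_mat ?N $$ (l, j)) = (if k = j then char_poly (\<rho> x) else 0)"
    if "k < n" for k
  proof -
    have "(\<Sum>l<n. ?N $$ (k, l) * adj_mat ?N $$ (l, j)) = (?N * adj_mat ?N) $$ (k, j)"
      using that \<open>j < n\<close> N adj_mat(1)[OF N] by (simp add: scalar_prod_def atLeast0LessThan)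
    also have "\<dots> = (if k = j then char_poly (\<rho> x) else 0)"
      unfolding adj_mat(2)[OF N] using that \<open>j < n\<close> by (simp add: char_poly_def)
    finally show ?thesis .
  qed
  then have "0 = (\<Sum>k<n. \<rho> (?ev (if k = j then char_poly (\<rho> x) else 0)) $$ (i, k))"
    using kill[of "\<lambda>l. adj_mat ?N $$ (l, j)"] by simp
  also have "\<dots> = (\<Sum>k<n. if k = j then \<rho> (?ev (char_poly (\<rho> x))) $$ (i, k) else 0)"
    using \<open>i < n\<close> by (intro sum.cong refl) (simp add: ev matrix_rep_0[OF \<rho>])
  finally show ?thesis using \<open>j < n\<close> by simp
qed

lemma residue_mapD:
  assumes "residue_map \<mm> \<pi>"
  shows "\<pi> 0 = 0" "\<pi> 1 = 1" "\<pi> (a + b) = \<pi> a + \<pi> b" "\<pi> (a * b) = \<pi> a * \<pi> b" "\<pi> (- a) = - \<pi> a"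
    "\<pi> (a - b) = \<pi> a - \<pi> b" "\<pi> (sum f A) = (\<Sum>i\<in>A. \<pi> (f i))" "\<pi> (a ^ k) = \<pi> a ^ k"
    "\<pi> a = 0 \<longleftrightarrow> a \<in> \<mm>" "surj \<pi>" "comm_ring_hom \<pi>"
proof -
  show "comm_ring_hom \<pi>" using assms by (simp add: residue_map_def)
  then interpret comm_ring_hom \<pi> .
  show "\<pi> 0 = 0" "\<pi> 1 = 1" "\<pi> (a + b) = \<pi> a + \<pi> b" "\<pi> (a * b) = \<pi> a * \<pi> b" "\<pi> (- a) = - \<pi> a"
    "\<pi> (a - b) = \<pi> a - \<pi> b" "\<pi> (sum f A) = (\<Sum>i\<in>A. \<pi> (f i))" "\<pi> (a ^ k) = \<pi> a ^ k"
    by (simp_all add: hom_distribs)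
  show "\<pi> a = 0 \<longleftrightarrow> a \<in> \<mm>" "surj \<pi>" using assms by (simp_all add: residue_map_def)
qed

lemma matrix_rep_residue:
  assumes \<rho>: "matrix_rep \<eta> (\<lambda>a. a) n \<rho>" and \<pi>: "residue_map \<mm> \<pi>"
  shows "matrix_rep \<eta> \<pi> n (\<lambda>x. map_mat \<pi> (\<rho> x))"
proof -
  interpret comm_ring_hom \<pi> by (rule residue_mapD[OF \<pi>])
  note c = matrix_rep_dim[OF \<rho>]
  have "map_mat \<pi> (\<rho> (x + y)) = map_mat \<pi> (\<rho> x) + map_mat \<pi> (\<rho> y)" for x y
    using \<rho> c by (intro eq_matI) (auto simp: matrix_rep_def hom_distribs)
  moreover have "map_mat \<pi> (\<rho> (x * y)) = map_mat \<pi> (\<rho> x) * map_mat \<pi> (\<rho> y)" for x y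
    using \<rho> c mat_hom_mult[of "\<rho> x" n n "\<rho> y" n] by (simp add: matrix_rep_def)
  moreover have "map_mat \<pi> (\<rho> 1) = 1\<^sub>m n" using \<rho> by (simp add: matrix_rep_def mat_hom_one)
  moreover have "map_mat \<pi> (\<rho> (\<eta> a * x)) = \<pi> a \<cdot>\<^sub>m map_mat \<pi> (\<rho> x)" for a x
    using matrix_repD(4)[OF \<rho>] c by (intro eq_matI) (simp_all add: hom_distribs)
  ultimately show ?thesis using c by (simp add: matrix_rep_def)
qed

lemma alg_eval_residue:
  assumes \<eta>: "algebra_map \<eta>" and \<pi>: "residue_map \<mm> \<pi>" and \<sigma>: "matrix_rep \<eta> \<pi> d \<sigma>"
    and "map_poly \<pi> p = map_poly \<pi> q"
  shows "\<sigma> (alg_eval \<eta> x p) = \<sigma> (alg_eval \<eta> x q)"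
proof -
  have zero: "\<sigma> (alg_eval \<eta> x r) $$ (i, j) = 0" if "\<And>k. \<pi> (coeff r k) = 0" "i < d" "j < d" for r i j
    using that
  proof (induction r arbitrary: i j)
    case 0
    then show ?case by (simp add: alg_eval_simps[OF \<eta>] matrix_rep_0[OF \<sigma>])
  next
    case (pCons a r)
    have "\<pi> a = 0" "\<pi> (coeff r k) = 0" for k
      using pCons.prems(1)[of 0] pCons.prems(1)[of "Suc k"] by simp_all
    moreover have "\<sigma> (\<eta> a) $$ (i, j) = \<pi> a * \<sigma> 1 $$ (i, j)"
      using matrix_repD(4)[OF \<sigma> pCons.prems(2,3), of a 1] by simp
    ultimately show ?case
      using pCons by (simp add: alg_eval_simps[OF \<eta>] matrix_repD[OF \<sigma>])
  qed
  have "\<pi> (coeff (p - q) k) = 0" for k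
    using arg_cong[OF assms(4), of "\<lambda>r. coeff r k"] residue_mapD[OF \<pi>] by (simp add: coeff_map_poly)
  then have "\<sigma> (alg_eval \<eta> x p) $$ (i, j) = \<sigma> (alg_eval \<eta> x q) $$ (i, j)" if "i < d" "j < d" for i j
    using zero[of "p - q" i j] that by (simp add: alg_eval_simps[OF \<eta>] matrix_rep_diff[OF \<sigma>])
  then show ?thesis using matrix_rep_dim[OF \<sigma>] by (intro eq_matI) simp_all
qed

lemma hensel_simple_root:
  fixes \<pi> :: "'a::comm_ring_1 \<Rightarrow> 'f::field"
  assumes \<pi>: "residue_map \<mm> \<pi>" and H: "henselian \<pi>"
    and f: "lead_coeff f = 1" "map_poly \<pi> f = [:-1, 1:] * monom 1 k"
  obtains a h where "f = [:- a, 1:] * h" and "\<pi> a = 1" and "map_poly \<pi> h = monom 1 k"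
proof -
  \<comment> \<open>modulo \<open>X - 1\<close> the second factor is \<open>1\<close>\<close>
  have cop: "coprime [:-1, 1:: 'f:] (monom 1 k)"
  proof (rule coprimeI)
    fix r :: "'f poly" assume r: "r dvd [:-1, 1:]" "r dvd monom 1 k"
    have "poly (monom 1 k - 1) (1::'f) = 0" by (simp add: poly_monom)
    then have "[:-1, 1:] dvd monom 1 k - (1 :: 'f poly)" by (simp only: poly_eq_0_iff_dvd)
    then have "r dvd monom 1 k - (monom 1 k - 1)" by (rule dvd_diff[OF r(2) dvd_trans[OF r(1)]])
    moreover have "monom 1 k - (monom 1 k - 1) = (1 :: 'f poly)" by simp
    ultimately show "is_unit r" by (simp only:)
  qed
  have "\<exists>g h. lead_coeff g = 1 \<and> lead_coeff h = 1 \<and> f = g * h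
      \<and> map_poly \<pi> g = [:-1, 1:] \<and> map_poly \<pi> h = monom 1 k"
    using H[unfolded henselian_def, rule_format, of f "[:-1, 1:]" "monom 1 k"] f cop
    by (simp add: degree_monom_eq)
  then obtain g h where gh: "lead_coeff g = 1" "f = g * h" "map_poly \<pi> g = [:-1, 1:]"
      "map_poly \<pi> h = monom 1 k" by blast
  note p = residue_mapD[OF \<pi>]
  have cg: "\<pi> (coeff g i) = coeff [:-1, 1:] i" for i
    using arg_cong[OF gh(3), of "\<lambda>r. coeff r i"] p by (simp add: coeff_map_poly)
  have deg: "degree g = 1"
  proof -
    have "degree g \<ge> 1" using cg[of 1] p(1) by (intro le_degree) auto
    moreover have "degree g \<le> 1"
    proof (rule ccontr)
      assume "\<not> degree g \<le> 1"
      then have "coeff [:-1, 1 :: 'f:] (degree g) = 0" by (intro coeff_eq_0) simp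
      then show False using cg[of "degree g"] gh(1) p by simp
    qed
    ultimately show ?thesis by simp
  qed
  define a where "a = - coeff g 0"
  have "g = [:- a, 1:]"
  proof (rule poly_eqI)
    fix i show "coeff g i = coeff [:- a, 1:] i"
    proof (cases "i \<le> 1")
      case True
      then show ?thesis using gh(1) deg by (cases i) (auto simp: a_def)
    next
      case False
      then show ?thesis using deg by (simp add: coeff_eq_0)
    qed
  qed
  moreover have "\<pi> a = 1" using cg[of 0] p by (simp add: a_def)
  ultimately show thesis using that gh by blast
qed

text \<open>Let \<open>f = (X - a) h\<close> be the characteristic polynomial, with \<open>a\<close> the lift of the simple root \<open>1\<close>. Modulo \<open>f\<close>
  multiplication by \<open>h\<close> sees only the value at \<open>a\<close>, that is \<open>h\<^sup>2 \<equiv> h(a) h\<close>, since \<open>h - h(a)\<close> is divisible by \<open>X - a\<close>.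
  Hence \<open>h(x) / h(a)\<close> is idempotent under \<open>\<rho>\<close>. Residually \<open>h\<close> is \<open>X\<^sup>n\<^sup>-\<^sup>1\<close>, which identifies the image of the
  idempotent in every residual representation.\<close>

lemma lift_idempotent:
  fixes \<pi> :: "'a::comm_ring_1 \<Rightarrow> 'f::field" and \<rho> :: "'r::ring_1 \<Rightarrow> 'a mat"
  assumes m: "local_ring \<mm>" and \<pi>: "residue_map \<mm> \<pi>" and H: "henselian \<pi>"
    and \<eta>: "algebra_map \<eta>" and \<rho>: "matrix_rep \<eta> (\<lambda>a. a) n \<rho>"
    and "p < n" and ut: "upper_triangular (map_mat \<pi> (\<rho> x))"
    and diag: "\<And>i. i < n \<Longrightarrow> \<pi> (\<rho> x $$ (i, i)) = (if i = p then 1 else 0)"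
  obtains e where "\<rho> (e * e) = \<rho> e"
    and "\<And>d (\<sigma> :: 'r \<Rightarrow> 'f mat). matrix_rep \<eta> \<pi> d \<sigma> \<Longrightarrow> \<sigma> e = \<sigma> (x ^ (n - 1))"
proof -
  interpret comm_ring_hom \<pi> by (rule residue_mapD[OF \<pi>])
  note p = residue_mapD[OF \<pi>] and ev = alg_eval_simps[OF \<eta>] and e = algebra_mapD[OF \<eta>]
  let ?f = "char_poly (\<rho> x)" and ?ev = "alg_eval \<eta> x"
  have M: "\<rho> x \<in> carrier_mat n n" using matrix_rep_dim[OF \<rho>] by simp
  have "map_poly \<pi> ?f = char_poly (map_mat \<pi> (\<rho> x))" by (rule char_poly_hom[OF M, symmetric])
  also have "\<dots> = (\<Prod>a\<leftarrow>diag_mat (map_mat \<pi> (\<rho> x)). [:- a, 1:])"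
    by (rule char_poly_upper_triangular[OF _ ut]) (use M in simp)
  also have "\<dots> = (\<Prod>i\<in>{0..<n}. [:- (if i = p then 1 else 0), 1:])"
  proof -
    have "map (\<lambda>i. map_mat \<pi> (\<rho> x) $$ (i, i)) [0..<n] = map (\<lambda>i. if i = p then 1 else 0) [0..<n]"
      using M diag by (intro map_cong) auto
    then have "diag_mat (map_mat \<pi> (\<rho> x)) = map (\<lambda>i. if i = p then 1 else 0) [0..<n]"
      using M by (simp add: diag_mat_def)
    then show ?thesis by (simp add: o_def prod.distinct_set_conv_list[symmetric])
  qed
  also have "\<dots> = [:-1, 1:] * (\<Prod>i\<in>{0..<n} - {p}. [:- (if i = p then 1 else 0), 1:])"
    using \<open>p < n\<close> by (subst prod.remove[of _ p]) auto
  also have "(\<Prod>i\<in>{0..<n} - {p}. [:- (if i = p then 1 else 0), 1:]) = (\<Prod>i\<in>{0..<n} - {p}. [:0, 1 :: 'f:])"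
    by (intro prod.cong) auto
  also have "\<dots> = monom 1 (n - 1)" using \<open>p < n\<close> by (simp add: monom_altdef)
  finally have res: "map_poly \<pi> ?f = [:-1, 1:] * monom 1 (n - 1)" .
  have "lead_coeff ?f = 1" using degree_monic_char_poly[OF M] by simp
  from hensel_simple_root[OF \<pi> H this res] obtain a h where
    ah: "?f = [:- a, 1:] * h" "\<pi> a = 1" "map_poly \<pi> h = monom 1 (n - 1)" .
  have "\<pi> (poly h a) = poly (map_poly \<pi> h) (\<pi> a)" by (simp add: poly_map_poly)
  then have ha: "\<pi> (poly h a) = 1" using ah by (simp add: poly_monom)
  then have "poly h a dvd 1" using local_ring_unit[OF m] p(9) by force
  then obtain u where u: "poly h a * u = 1" by (metis dvdE)
  then have \<pi>u: "\<pi> u = 1" using ha p(4)[of "poly h a" u] p(2) by simp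
  define e where "e = \<eta> u * ?ev h"
  show thesis
  proof
    have "[:- a, 1:] dvd h - [:poly h a:]" by (simp flip: poly_eq_0_iff_dvd)
    then obtain g where g: "h - [:poly h a:] = [:- a, 1:] * g" by (elim dvdE)
    have "h * h - smult (poly h a) h = (h - [:poly h a:]) * h" by (simp add: algebra_simps)
    also have "\<dots> = g * ?f" by (simp add: g ah(1) algebra_simps)
    finally have "?ev (h * h - smult (poly h a) h) = ?ev (g * ?f)" by simp
    then have hh: "?ev h * ?ev h = \<eta> (poly h a) * ?ev h + ?ev g * ?ev ?f" by (simp add: ev algebra_simps)
    have "e * e = \<eta> u * (\<eta> u * (?ev h * ?ev h))"
      unfolding e_def by (metis e(6) mult.assoc)
    also have "\<dots> = \<eta> u * ((\<eta> u * \<eta> (poly h a)) * ?ev h + \<eta> u * (?ev g * ?ev ?f))"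
      by (simp add: hh distrib_left mult.assoc)
    also have "\<eta> u * \<eta> (poly h a) = 1" using u e(2,4) by (metis mult.commute)
    finally have ee: "e * e = e + \<eta> u * (\<eta> u * (?ev g * ?ev ?f))" by (simp add: e_def distrib_left)
    have "\<rho> (e * e) $$ (i, j) = \<rho> e $$ (i, j)" if "i < n" "j < n" for i j
      unfolding ee using that
      by (simp add: matrix_repD[OF \<rho>] cayley_hamilton[OF \<eta> \<rho>])
    then show "\<rho> (e * e) = \<rho> e" using matrix_rep_dim[OF \<rho>] by (intro eq_matI) simp_all
    fix d and \<sigma> :: "'r \<Rightarrow> 'f mat" assume \<sigma>: "matrix_rep \<eta> \<pi> d \<sigma>"
    have "\<sigma> e = \<pi> u \<cdot>\<^sub>m \<sigma> (?ev h)" using \<sigma> unfolding e_def matrix_rep_def by blast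
    also have "\<sigma> (?ev h) = \<sigma> (?ev (monom 1 (n - 1)))"
      using ah(3) p by (intro alg_eval_residue[OF \<eta> \<pi> \<sigma>]) (simp add: map_poly_monom)
    also have "?ev (monom 1 (n - 1)) = x ^ (n - 1)" by (rule ev)
    finally show "\<sigma> e = \<sigma> (x ^ (n - 1))" using \<pi>u by (intro eq_matI) simp_all
  qed
qed

text \<open>The column \<open>v\<close> and the normalised row \<open>w\<close> through the pivot \<open>(p, p)\<close> satisfy \<open>w\<^sup>T v = 1\<close>, \<open>M v = v\<close> and
  \<open>w\<^sup>T M = w\<^sup>T\<close>, so \<open>F = M - v w\<^sup>T\<close> is again idempotent. Residually \<open>F\<close> is strictly upper triangular, so
  \<open>1 - F\<close> is invertible, and \<open>F (1 - F) = 0\<close> gives \<open>F = 0\<close>.\<close>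

lemma idempotent_rank_one:
  fixes \<pi> :: "'a::comm_ring_1 \<Rightarrow> 'f::field"
  assumes m: "local_ring \<mm>" and \<pi>: "residue_map \<mm> \<pi>"
    and M: "M \<in> carrier_mat n n" "M * M = M" and "p < n"
    and ut: "\<And>i j. j < i \<Longrightarrow> i < n \<Longrightarrow> \<pi> (M $$ (i, j)) = 0"
    and diag: "\<And>i. i < n \<Longrightarrow> \<pi> (M $$ (i, i)) = (if i = p then 1 else 0)"
  obtains v w where "\<And>i j. i < n \<Longrightarrow> j < n \<Longrightarrow> M $$ (i, j) = v i * w j"
    and "(\<Sum>i<n. w i * v i) = 1"
    and "\<And>i. \<pi> (v i) = \<pi> (M $$ (i, p))" and "\<And>j. \<pi> (w j) = \<pi> (M $$ (p, j))"
proof -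
  interpret comm_ring_hom \<pi> by (rule residue_mapD[OF \<pi>])
  note p = residue_mapD[OF \<pi>]
  have MM: "(\<Sum>k<n. M $$ (i, k) * M $$ (k, j)) = M $$ (i, j)" if "i < n" "j < n" for i j
  proof -
    have "(M * M) $$ (i, j) = (\<Sum>k<n. M $$ (i, k) * M $$ (k, j))"
      using that M(1) by (simp add: scalar_prod_def atLeast0LessThan)
    then show ?thesis by (simp add: M(2))
  qed
  have "M $$ (p, p) dvd 1" using local_ring_unit[OF m] p(9) diag[OF \<open>p < n\<close>] by force
  then obtain u where u: "M $$ (p, p) * u = 1" by (metis dvdE)
  then have \<pi>u: "\<pi> u = 1" using diag[OF \<open>p < n\<close>] p(4)[of "M $$ (p, p)" u] p(2) by simp
  define v where "v i = M $$ (i, p)" for i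
  define w where "w j = u * M $$ (p, j)" for j
  have wv: "(\<Sum>i<n. w i * v i) = 1"
  proof -
    have "(\<Sum>i<n. w i * v i) = u * (\<Sum>i<n. M $$ (p, i) * M $$ (i, p))"
      by (simp add: v_def w_def mult.assoc sum_distrib_left)
    then show ?thesis using MM[OF \<open>p < n\<close> \<open>p < n\<close>] u by (simp add: mult.commute)
  qed
  have wM: "(\<Sum>k<n. w k * M $$ (k, j)) = w j" if "j < n" for j
    using MM[OF \<open>p < n\<close> that] by (simp add: w_def mult.assoc flip: sum_distrib_left)
  have Mv: "(\<Sum>k<n. M $$ (i, k) * v k) = v i" if "i < n" for i
    using MM[OF that \<open>p < n\<close>] by (simp add: v_def)
  define F where "F = mat n n (\<lambda>(i, j). M $$ (i, j) - v i * w j)"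
  have F: "F \<in> carrier_mat n n" by (simp add: F_def)
  have FF: "F * F = F"
  proof (rule eq_matI)
    fix i j assume "i < dim_row F" "j < dim_col F"
    then have ij: "i < n" "j < n" by (simp_all add: F_def)
    have "(F * F) $$ (i, j) = (\<Sum>k<n. (M $$ (i, k) - v i * w k) * (M $$ (k, j) - v k * w j))"
      using ij by (simp add: F_def scalar_prod_def atLeast0LessThan)
    also have "\<dots> = (\<Sum>k<n. M $$ (i, k) * M $$ (k, j)) - v i * (\<Sum>k<n. w k * M $$ (k, j))
        - (\<Sum>k<n. M $$ (i, k) * v k) * w j + v i * (\<Sum>k<n. w k * v k) * w j"
      by (simp add: sum_distrib_left sum_distrib_right sum_subtractf sum.distrib algebra_simps)
    also have "\<dots> = M $$ (i, j) - v i * w j" using ij by (simp add: MM wM Mv wv)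
    finally show "(F * F) $$ (i, j) = F $$ (i, j)" using ij by (simp add: F_def)
  qed (simp_all add: F_def)
  let ?G = "1\<^sub>m n - F"
  have G: "?G \<in> carrier_mat n n" using F by (rule minus_carrier_mat)
  have FG: "F * ?G = 0\<^sub>m n n" using F FF by (simp add: mult_minus_distrib_mat[of _ n n _ n])
  have "\<pi> (det ?G) = det (map_mat \<pi> ?G)" by simp
  also have "\<dots> = prod_list (diag_mat (map_mat \<pi> ?G))"
  proof (rule det_upper_triangular[of _ n])
    show "upper_triangular (map_mat \<pi> ?G)"
    proof (rule upper_triangularI)
      fix i j assume ij: "j < i" "i < dim_row (map_mat \<pi> ?G)"
      then have ij: "j < i" "i < n" using F by auto
      have "\<pi> (M $$ (i, p)) * \<pi> (M $$ (p, j)) = 0"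
        using ut[of p i] ut[of j p] ij \<open>p < n\<close> by (cases "p < i") auto
      then show "map_mat \<pi> ?G $$ (i, j) = 0"
        using ij ut[OF ij] by (simp add: F_def v_def w_def p(1-8) \<pi>u)
    qed
  qed (use G in simp)
  also have "diag_mat (map_mat \<pi> ?G) = map (\<lambda>i. 1) [0..<n]"
    unfolding diag_mat_def
  proof (rule map_cong)
    fix i assume "i \<in> set [0..<n]"
    then have i: "i < n" by simp
    have "\<pi> (M $$ (i, p)) * \<pi> (M $$ (p, i)) = (if i = p then 1 else 0)"
      using ut[of p i] ut[of i p] i \<open>p < n\<close> diag[of p] by (cases i p rule: linorder_cases) auto
    then show "map_mat \<pi> ?G $$ (i, i) = 1" using i diag[OF i] by (simp add: F_def v_def w_def p(1-8) \<pi>u)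
  qed (use F in simp)
  also have "prod_list \<dots> = (1 :: 'f)" by (induction n) simp_all
  finally have "det ?G dvd 1" using local_ring_unit[OF m] p(9)[of "det ?G"] by force
  then obtain t where t: "det ?G * t = 1" by (metis dvdE)
  have "0\<^sub>m n n = (F * ?G) * adj_mat ?G" using FG adj_mat(1)[OF G] by simp
  also have "\<dots> = F * (?G * adj_mat ?G)" using F G adj_mat(1)[OF G] by (rule assoc_mult_mat)
  also have "\<dots> = det ?G \<cdot>\<^sub>m F" using F by (simp add: adj_mat(2)[OF G] mult_smult_distrib[of _ n n _ n])
  finally have dF: "det ?G \<cdot>\<^sub>m F = 0\<^sub>m n n" by simp
  have "M $$ (i, j) = v i * w j" if "i < n" "j < n" for i j
  proof -
    have "det ?G * F $$ (i, j) = 0" using arg_cong[OF dF, of "\<lambda>A. A $$ (i, j)"] that F by simp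
    then have "(det ?G * t) * F $$ (i, j) = 0" by (metis mult.assoc mult.commute mult_zero_left)
    then have "F $$ (i, j) = 0" by (simp add: t)
    then show ?thesis using that by (simp add: F_def)
  qed
  then show thesis
    using wv that[of v w] by (simp add: v_def w_def p(1-8) \<pi>u)
qed

section \<open>Schur's lemma and density\<close>

text \<open>Vectors are functions on the natural numbers of which only an initial segment of coordinates matters. This
  avoids carrying dimensions through sums and scalar multiples.\<close>

definition fun_subspace :: "(nat \<Rightarrow> 'k::field) set \<Rightarrow> bool" where
  "fun_subspace W \<longleftrightarrow> (\<lambda>_. 0) \<in> W \<and> (\<forall>v\<in>W. \<forall>w\<in>W. (\<lambda>i. v i + w i) \<in> W) \<and> (\<forall>c. \<forall>v\<in>W. (\<lambda>i. c * v i) \<in> W)"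

lemma
  assumes "fun_subspace W"
  shows fun_subspace_add: "v \<in> W \<Longrightarrow> w \<in> W \<Longrightarrow> (\<lambda>i. v i + w i) \<in> W"
    and fun_subspace_scale: "v \<in> W \<Longrightarrow> (\<lambda>i. c * v i) \<in> W"
  using assms by (simp_all add: fun_subspace_def)

text \<open>A subspace with zero annihilator is everything, by induction on the number of coordinates: a vector with last
  coordinate \<open>1\<close> reduces the problem to the subspace of vectors with last coordinate \<open>0\<close>.\<close>

lemma fun_subspace_annihilator:
  assumes "fun_subspace W"
    and "\<And>c i. (\<And>w. w \<in> W \<Longrightarrow> (\<Sum>i<n. c i * w i) = 0) \<Longrightarrow> i < n \<Longrightarrow> c i = 0"
  shows "\<exists>w\<in>W. \<forall>i<n. w i = v i"
  using assms
proof (induction n arbitrary: W v)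
  case 0
  then show ?case by (auto simp: fun_subspace_def)
next
  case (Suc n)
  note W = Suc.prems(1)[unfolded fun_subspace_def]
  have "\<exists>u\<in>W. u n \<noteq> 0"
  proof (rule ccontr)
    assume *: "\<not> ?thesis"
    have "(\<Sum>i<Suc n. (if i = n then 1 else 0) * w i) = 0" if "w \<in> W" for w
      using * that by simp
    from Suc.prems(2)[OF this, of n] show False by simp
  qed
  then obtain u0 where u0: "u0 \<in> W" "u0 n \<noteq> 0" by blast
  define u where "u = (\<lambda>i. inverse (u0 n) * u0 i)"
  have u: "u \<in> W" "u n = 1" using W u0 by (auto simp: u_def)
  define W0 where "W0 = {w\<in>W. w n = 0}"
  have W0: "fun_subspace W0" using W by (auto simp: fun_subspace_def W0_def)
  have "\<exists>w\<in>W0. \<forall>i<n. w i = v i - v n * u i"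
  proof (rule Suc.IH[OF W0])
    fix c i assume c: "\<And>w. w \<in> W0 \<Longrightarrow> (\<Sum>i<n. c i * w i) = 0" and i: "i < n"
    define c' where "c' = c(n := - (\<Sum>i<n. c i * u i))"
    have "(\<Sum>i<Suc n. c' i * w i) = 0" if w: "w \<in> W" for w
    proof -
      have "(\<lambda>i. w i + (- w n) * u i) \<in> W"
        by (rule fun_subspace_add[OF Suc.prems(1) w fun_subspace_scale[OF Suc.prems(1) u(1)]])
      then have "(\<lambda>i. w i + (- w n) * u i) \<in> W0" using u by (simp add: W0_def)
      from c[OF this] have "(\<Sum>i<n. c i * w i) = w n * (\<Sum>i<n. c i * u i)"
        by (simp add: algebra_simps sum.distrib sum_subtractf sum_distrib_left)
      moreover have "(\<Sum>i<n. c' i * w i) = (\<Sum>i<n. c i * w i)" by (simp add: c'_def)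
      ultimately show ?thesis by (simp add: c'_def)
    qed
    from Suc.prems(2)[OF this, of i] show "c i = 0" using i by (simp add: c'_def)
  qed
  then obtain w where w: "w \<in> W0" "\<forall>i<n. w i = v i - v n * u i" by blast
  have "w \<in> W" using w(1) by (simp add: W0_def)
  then have "(\<lambda>i. w i + v n * u i) \<in> W"
    by (rule fun_subspace_add[OF Suc.prems(1) _ fun_subspace_scale[OF Suc.prems(1) u(1)]])
  moreover have "\<forall>i<Suc n. w i + v n * u i = v i"
    using w u by (auto simp: W0_def less_Suc_eq)
  ultimately show ?case by (intro bexI[of _ "\<lambda>i. w i + v n * u i"])
qed

abbreviation act :: "nat \<Rightarrow> ('r \<Rightarrow> 'k::field mat) \<Rightarrow> 'r \<Rightarrow> (nat \<Rightarrow> 'k) \<Rightarrow> nat \<Rightarrow> 'k" where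
  "act d \<sigma> x v \<equiv> \<lambda>i. \<Sum>j<d. \<sigma> x $$ (i, j) * v j"

lemma irreducible_rep_full:
  assumes irr: "irreducible_rep d \<sigma>" and dim: "\<And>x. \<sigma> x \<in> carrier_mat d d"
    and W: "fun_subspace W" "\<And>x w. w \<in> W \<Longrightarrow> act d \<sigma> x w \<in> W"
    and w0: "w0 \<in> W" "i0 < d" "w0 i0 \<noteq> 0"
  shows "\<exists>w\<in>W. \<forall>i<d. w i = v i"
proof -
  note W' = W(1)[unfolded fun_subspace_def]
  have dims: "dim_row (\<sigma> x) = d" "dim_col (\<sigma> x) = d" for x using dim[of x] by auto
  have "subrep d \<sigma> (vec d ` W)"
    unfolding subrep_def
  proof (intro conjI ballI allI)
    show "0\<^sub>v d \<in> vec d ` W" by (rule image_eqI[of _ _ "\<lambda>_. 0"]) (use W' in auto)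
    fix a assume "a \<in> vec d ` W"
    then obtain v where v: "v \<in> W" "a = vec d v" by blast
    show "a + b \<in> vec d ` W" if b: "b \<in> vec d ` W" for b
    proof -
      obtain w where w: "w \<in> W" "b = vec d w" using b by blast
      have "a + b = vec d (\<lambda>i. v i + w i)" using v w by auto
      then show ?thesis using fun_subspace_add[OF W(1) v(1) w(1)] by blast
    qed
    show "c \<cdot>\<^sub>v a \<in> vec d ` W" for c
    proof -
      have "c \<cdot>\<^sub>v a = vec d (\<lambda>i. c * v i)" using v by auto
      then show ?thesis using fun_subspace_scale[OF W(1) v(1)] by blast
    qed
    show "\<sigma> x *\<^sub>v a \<in> vec d ` W" for x
    proof -
      have "\<sigma> x *\<^sub>v a = vec d (act d \<sigma> x v)"
        using v dims by (intro eq_vecI) (auto simp: scalar_prod_def atLeast0LessThan)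
      then show ?thesis using W(2) v by blast
    qed
  qed auto
  then have "vec d ` W = {0\<^sub>v d} \<or> vec d ` W = carrier_vec d"
    using irr by (simp add: irreducible_rep_def)
  moreover have "vec d ` W \<noteq> {0\<^sub>v d}"
  proof
    assume "vec d ` W = {0\<^sub>v d}"
    then have "vec d w0 = 0\<^sub>v d" using w0 by blast
    then have "vec d w0 $ i0 = 0\<^sub>v d $ i0" by simp
    then show False using w0 by simp
  qed
  ultimately have "vec d v \<in> vec d ` W" by simp
  then obtain w where w: "w \<in> W" "vec d v = vec d w" by blast
  have "w i = v i" if "i < d" for i using arg_cong[OF w(2), of "\<lambda>a. vec_index a i"] that by simp
  then show ?thesis using w by blast
qed

text \<open>Absolute irreducibility is a statement over the algebraic closure, but the subspace \<open>W\<close> lives over the ground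
  field. Its annihilator is stable on the other side, and the zero space \<open>V\<close> of the annihilator over the closure is a
  non-zero subrepresentation, hence everything. So the annihilator is zero, over the closure and over the field.\<close>

lemma abs_irreducible_rep_full:
  assumes irr: "abs_irreducible_rep d \<sigma>" and dim: "\<And>x. \<sigma> x \<in> carrier_mat d d"
    and W: "fun_subspace W" "\<And>x w. w \<in> W \<Longrightarrow> act d \<sigma> x w \<in> W"
    and w0: "w0 \<in> W" "i0 < d" "w0 i0 \<noteq> 0"
  shows "\<exists>w\<in>W. \<forall>i<d. w i = v i"
proof (rule fun_subspace_annihilator[OF W(1)])
  fix c i assume c: "\<And>w. w \<in> W \<Longrightarrow> (\<Sum>i<d. c i * w i) = 0" and i: "i < d"
  have dims: "dim_row (\<sigma> x) = d" "dim_col (\<sigma> x) = d" for x using dim[of x] by auto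
  define Ann where "Ann = {c. \<forall>w\<in>W. (\<Sum>i<d. c i * w i) = 0}"
  define V where "V = {v. \<forall>c\<in>Ann. (\<Sum>i<d. to_ac (c i) * v i) = 0}"
  have swap: "(\<Sum>j<d. (\<Sum>i<d. c i * m i j) * v j) = (\<Sum>i<d. c i * (\<Sum>j<d. m i j * v j))"
    for c v :: "nat \<Rightarrow> 'c::field" and m
    by (simp add: sum_distrib_left sum_distrib_right mult.assoc) (rule sum.swap)
  have Ann: "(\<lambda>j. \<Sum>i<d. c i * \<sigma> x $$ (i, j)) \<in> Ann" if "c \<in> Ann" for c x
    using that W(2) by (auto simp: Ann_def swap)
  have "\<exists>w\<in>V. \<forall>j<d. w j = (if j = i then 1 else 0)"
  proof (rule irreducible_rep_full)
    show "irreducible_rep d (\<lambda>x. map_mat to_ac (\<sigma> x))" using irr by (simp add: abs_irreducible_rep_def)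
    show "map_mat to_ac (\<sigma> x) \<in> carrier_mat d d" for x using dim by simp
    show "fun_subspace V"
      by (auto simp: fun_subspace_def V_def algebra_simps sum.distrib simp flip: sum_distrib_left)
    show "act d (\<lambda>x. map_mat to_ac (\<sigma> x)) x w \<in> V" if "w \<in> V" for x w
      unfolding V_def
    proof (intro CollectI ballI)
      fix c assume "c \<in> Ann"
      have "(\<Sum>i<d. to_ac (c i) * act d (\<lambda>x. map_mat to_ac (\<sigma> x)) x w i)
         = (\<Sum>i<d. to_ac (c i) * (\<Sum>j<d. to_ac (\<sigma> x $$ (i, j)) * w j))"
        using dims by (intro sum.cong refl arg_cong2[of _ _ _ _ "(*)"]) auto
      also have "\<dots> = (\<Sum>j<d. to_ac (\<Sum>i<d. c i * \<sigma> x $$ (i, j)) * w j)"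
        by (simp add: swap[symmetric] to_ac_sum)
      also have "\<dots> = 0" using that bspec[OF _ Ann[OF \<open>c \<in> Ann\<close>, of x]] by (simp add: V_def)
      finally show "(\<Sum>i<d. to_ac (c i) * act d (\<lambda>x. map_mat to_ac (\<sigma> x)) x w i) = 0" .
    qed
    show "(\<lambda>i. to_ac (w0 i)) \<in> V"
      using w0(1) by (simp add: V_def Ann_def flip: to_ac_mult to_ac_sum)
    show "i0 < d" "to_ac (w0 i0) \<noteq> 0" using w0 by auto
  qed
  then obtain w where w: "w \<in> V" "\<forall>j<d. w j = (if j = i then 1 else 0)" by blast
  have "c \<in> Ann" using c by (simp add: Ann_def)
  then have "0 = (\<Sum>j<d. to_ac (c j) * w j)" using w(1) by (simp add: V_def)
  also have "\<dots> = (\<Sum>j<d. if j = i then to_ac (c j) else 0)" using w(2) by (intro sum.cong) auto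
  also have "\<dots> = to_ac (c i)" using i by simp
  finally show "c i = 0" by simp
qed

text \<open>Schur's lemma for endomorphisms: over the algebraic closure an eigenspace is a subrepresentation.\<close>

lemma schur_scalar:
  assumes irr: "abs_irreducible_rep d \<sigma>" and dim: "\<And>x. \<sigma> x \<in> carrier_mat d d"
    and P: "\<And>x i k. i < d \<Longrightarrow> k < d \<Longrightarrow> (\<Sum>j<d. P i j * \<sigma> x $$ (j, k)) = (\<Sum>j<d. \<sigma> x $$ (i, j) * P j k)"
  shows "\<exists>c. \<forall>i<d. \<forall>j<d. P i j = (if i = j then c else 0)"
proof -
  have dims: "dim_row (\<sigma> x) = d" "dim_col (\<sigma> x) = d" for x using dim[of x] by auto
  have "d > 0" using irr by (simp add: abs_irreducible_rep_def irreducible_rep_def)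
  define M where "M = mat d d (\<lambda>(i, j). to_ac (P i j))"
  have M: "M \<in> carrier_mat d d" by (simp add: M_def)
  obtain l where "poly (char_poly M) l = 0"
    using alg_closed_imp_poly_has_root[of "char_poly M"] degree_monic_char_poly[OF M] \<open>d > 0\<close> by auto
  then have "eigenvalue M l" using eigenvalue_root_char_poly[OF M] by simp
  then obtain v where v: "v \<in> carrier_vec d" "v \<noteq> 0\<^sub>v d" "M *\<^sub>v v = l \<cdot>\<^sub>v v"
    using M by (auto simp: eigenvalue_def eigenvector_def)
  define V where "V = {w. \<forall>i<d. (\<Sum>j<d. to_ac (P i j) * w j) = l * w i}"
  obtain i0 where i0: "i0 < d" "v $ i0 \<noteq> 0"
    using v(1,2) by (metis carrier_vecD eq_vecI index_zero_vec)
  have full: "\<exists>w\<in>V. \<forall>j<d. w j = (if j = k then 1 else 0)" for k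
  proof (rule irreducible_rep_full)
    show "irreducible_rep d (\<lambda>x. map_mat to_ac (\<sigma> x))" using irr by (simp add: abs_irreducible_rep_def)
    show "map_mat to_ac (\<sigma> x) \<in> carrier_mat d d" for x using dim by simp
    show "fun_subspace V"
      by (auto simp: fun_subspace_def V_def algebra_simps sum.distrib simp flip: sum_distrib_left)
    show "act d (\<lambda>x. map_mat to_ac (\<sigma> x)) x w \<in> V" if "w \<in> V" for x w
      unfolding V_def
    proof (intro CollectI allI impI)
      fix i assume i: "i < d"
      have e: "act d (\<lambda>x. map_mat to_ac (\<sigma> x)) x w j = (\<Sum>k<d. to_ac (\<sigma> x $$ (j, k)) * w k)" if "j < d" for j
        using dims that by simp
      have "(\<Sum>j<d. to_ac (P i j) * act d (\<lambda>x. map_mat to_ac (\<sigma> x)) x w j)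
         = (\<Sum>j<d. \<Sum>k<d. to_ac (P i j * \<sigma> x $$ (j, k)) * w k)"
        using e by (simp add: sum_distrib_left mult.assoc)
      also have "\<dots> = (\<Sum>k<d. to_ac (\<Sum>j<d. P i j * \<sigma> x $$ (j, k)) * w k)"
        by (subst sum.swap) (simp add: to_ac_sum sum_distrib_right)
      also have "\<dots> = (\<Sum>k<d. to_ac (\<Sum>j<d. \<sigma> x $$ (i, j) * P j k) * w k)"
        using P[OF i] by simp
      also have "\<dots> = (\<Sum>j<d. to_ac (\<sigma> x $$ (i, j)) * (\<Sum>k<d. to_ac (P j k) * w k))"
        by (simp add: to_ac_sum sum_distrib_right sum_distrib_left mult.assoc) (rule sum.swap)
      also have "\<dots> = (\<Sum>j<d. to_ac (\<sigma> x $$ (i, j)) * (l * w j))"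
        using that by (simp add: V_def)
      also have "\<dots> = l * act d (\<lambda>x. map_mat to_ac (\<sigma> x)) x w i"
        unfolding e[OF i] by (simp add: sum_distrib_left algebra_simps)
      finally show "(\<Sum>j<d. to_ac (P i j) * act d (\<lambda>x. map_mat to_ac (\<sigma> x)) x w j)
        = l * act d (\<lambda>x. map_mat to_ac (\<sigma> x)) x w i" .
    qed
    show "(\<lambda>i. v $ i) \<in> V"
      unfolding V_def
    proof (intro CollectI allI impI)
      fix i assume "i < d"
      then show "(\<Sum>j<d. to_ac (P i j) * v $ j) = l * v $ i"
        using arg_cong[OF v(3), of "\<lambda>a. vec_index a i"] v(1) by (simp add: M_def scalar_prod_def atLeast0LessThan)
    qed
    show "i0 < d" "v $ i0 \<noteq> 0" using i0 by auto
  qed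
  have eq: "to_ac (P i k) = (if i = k then l else 0)" if "i < d" "k < d" for i k
  proof -
    obtain w where w: "w \<in> V" "\<forall>j<d. w j = (if j = k then 1 else 0)" using full by blast
    have "(\<Sum>j<d. to_ac (P i j) * w j) = (\<Sum>j<d. if j = k then to_ac (P i j) else 0)"
      using w(2) by (intro sum.cong) auto
    then have "to_ac (P i k) = (\<Sum>j<d. to_ac (P i j) * w j)" using that by simp
    also have "\<dots> = l * w i" using w(1) that by (simp add: V_def)
    finally show ?thesis using w(2) that by simp
  qed
  have "P i j = (if i = j then P 0 0 else 0)" if "i < d" "j < d" for i j
  proof -
    have "to_ac (P i j) = to_ac (if i = j then P 0 0 else 0)"
      using eq[OF that] eq[of 0 0] \<open>d > 0\<close> by simp
    then show ?thesis by (simp only: to_ac_eq_iff)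
  qed
  then show ?thesis by blast
qed

text \<open>A one-sided inverse through a smaller dimension, padded by zeros to square matrices, would be two-sided.\<close>

lemma right_inverse_dim:
  fixes P Q :: "nat \<Rightarrow> nat \<Rightarrow> 'k::field"
  assumes "\<And>i j. i < m \<Longrightarrow> j < m \<Longrightarrow> (\<Sum>l<k. P i l * Q l j) = (if i = j then 1 else 0)"
  shows "m \<le> k"
proof (rule ccontr)
  assume "\<not> m \<le> k"
  then have km: "k < m" by simp
  let ?P = "mat m m (\<lambda>(i, l). if l < k then P i l else 0)"
  let ?Q = "mat m m (\<lambda>(l, j). if l < k then Q l j else 0)"
  have "?P * ?Q = 1\<^sub>m m"
  proof (rule eq_matI)
    fix i j assume "i < dim_row (1\<^sub>m m :: 'k mat)" "j < dim_col (1\<^sub>m m :: 'k mat)"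
    then have ij: "i < m" "j < m" by simp_all
    have "(?P * ?Q) $$ (i, j) = (\<Sum>l<m. (if l < k then P i l else 0) * (if l < k then Q l j else 0))"
      using ij by (simp add: scalar_prod_def atLeast0LessThan)
    also have "\<dots> = (\<Sum>l<k. P i l * Q l j)"
      using km by (intro sum.mono_neutral_cong_right) auto
    finally show "(?P * ?Q) $$ (i, j) = 1\<^sub>m m $$ (i, j)" using assms ij by simp
  qed simp_all
  then have "?Q * ?P = 1\<^sub>m m" by (rule mat_mult_left_right_inverse[rotated 2]) simp_all
  then have "(?Q * ?P) $$ (k, k) = 1" using km by simp
  moreover have "(?Q * ?P) $$ (k, k) = 0" using km by (simp add: scalar_prod_def)
  ultimately show False by simp
qed

text \<open>Schur's lemma for homomorphisms: kernel and image of a non-zero intertwiner are subrepresentations, so it is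
  bijective. The two dimensions are not assumed to be equal; that they agree comes out of the two-sided inverse.\<close>

lemma schur_hom:
  fixes \<sigma>1 \<sigma>2 :: "'r \<Rightarrow> 'k::field mat"
  assumes irr: "abs_irreducible_rep d1 \<sigma>1" "abs_irreducible_rep d2 \<sigma>2"
    and dim: "\<And>x. \<sigma>1 x \<in> carrier_mat d1 d1" "\<And>x. \<sigma>2 x \<in> carrier_mat d2 d2"
    and P: "\<And>x i k. i < d2 \<Longrightarrow> k < d1 \<Longrightarrow> (\<Sum>j<d1. P i j * \<sigma>1 x $$ (j, k)) = (\<Sum>j<d2. \<sigma>2 x $$ (i, j) * P j k)"
    and P0: "i0 < d2" "k0 < d1" "P i0 k0 \<noteq> 0"
  shows "isomorphic_reps d1 \<sigma>1 d2 \<sigma>2"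
proof -
  have dims: "dim_row (\<sigma>1 x) = d1" "dim_col (\<sigma>1 x) = d1" "dim_row (\<sigma>2 x) = d2" "dim_col (\<sigma>2 x) = d2"
    for x using dim[of x] by auto
  let ?ap = "\<lambda>v i. \<Sum>k<d1. P i k * v k"
  have Pact: "?ap (act d1 \<sigma>1 x v) i = act d2 \<sigma>2 x (?ap v) i" if "i < d2" for x v i
  proof -
    have "?ap (act d1 \<sigma>1 x v) i = (\<Sum>k<d1. (\<Sum>j<d1. P i j * \<sigma>1 x $$ (j, k)) * v k)"
      by (simp add: sum_distrib_left sum_distrib_right mult.assoc) (rule sum.swap)
    also have "\<dots> = (\<Sum>k<d1. (\<Sum>j<d2. \<sigma>2 x $$ (i, j) * P j k) * v k)" using P[OF that] by simp
    also have "\<dots> = act d2 \<sigma>2 x (?ap v) i"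
      by (simp add: sum_distrib_left sum_distrib_right mult.assoc) (rule sum.swap)
    finally show ?thesis .
  qed
  have inj: "v i = 0" if v: "\<And>i. i < d2 \<Longrightarrow> ?ap v i = 0" and i: "i < d1" for v i
  proof (rule ccontr)
    assume vi: "v i \<noteq> 0"
    define V where "V = {v. \<forall>i<d2. ?ap v i = 0}"
    have "\<exists>w\<in>V. \<forall>i<d1. w i = (if i = k0 then 1 else 0)"
    proof (rule abs_irreducible_rep_full[where ?w0.0 = v and ?i0.0 = i, OF irr(1) dim(1)])
      show "fun_subspace V"
        by (auto simp: fun_subspace_def V_def algebra_simps sum.distrib simp flip: sum_distrib_left)
      show "act d1 \<sigma>1 x w \<in> V" if "w \<in> V" for x w
      proof -
        have "?ap (act d1 \<sigma>1 x w) i = 0" if "i < d2" for i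
          unfolding Pact[OF that] using \<open>w \<in> V\<close> by (simp add: V_def)
        then show ?thesis by (simp add: V_def)
      qed
      show "v \<in> V" using v by (simp add: V_def)
      show "i < d1" "v i \<noteq> 0" by fact+
    qed
    then obtain w where w: "w \<in> V" "\<forall>i<d1. w i = (if i = k0 then 1 else 0)" by blast
    have "0 = ?ap w i0" using w(1) P0 by (simp add: V_def)
    also have "\<dots> = (\<Sum>k<d1. if k = k0 then P i0 k else 0)" using w(2) by (intro sum.cong) auto
    also have "\<dots> = P i0 k0" using P0 by simp
    finally show False using P0 by simp
  qed
  define V where "V = {v. \<exists>w. \<forall>i<d2. v i = ?ap w i}"
  have surj: "\<exists>w\<in>V. \<forall>i<d2. w i = v i" for v
  proof (rule abs_irreducible_rep_full[OF irr(2) dim(2)])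
    show "fun_subspace V"
      unfolding fun_subspace_def
    proof (intro conjI ballI allI)
      show "(\<lambda>_. 0) \<in> V" unfolding V_def by (auto intro!: exI[of _ "\<lambda>_. 0"])
      fix v assume "v \<in> V"
      then obtain a where a: "\<forall>i<d2. v i = ?ap a i" by (auto simp: V_def)
      show "(\<lambda>i. v i + w i) \<in> V" if w: "w \<in> V" for w
      proof -
        obtain b where "\<forall>i<d2. w i = ?ap b i" using w by (auto simp: V_def)
        then show ?thesis using a unfolding V_def
          by (auto intro!: exI[of _ "\<lambda>k. a k + b k"] simp: algebra_simps sum.distrib)
      qed
      show "(\<lambda>i. c * v i) \<in> V" for c
        using a unfolding V_def
        by (auto intro!: exI[of _ "\<lambda>k. c * a k"] simp: algebra_simps sum_distrib_left)
    qed
    show "act d2 \<sigma>2 x w \<in> V" if w: "w \<in> V" for x w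
    proof -
      obtain a where a: "\<forall>i<d2. w i = ?ap a i" using w by (auto simp: V_def)
      have "act d2 \<sigma>2 x w i = ?ap (act d1 \<sigma>1 x a) i" if "i < d2" for i
        unfolding Pact[OF that] using a by simp
      then show ?thesis unfolding V_def mem_Collect_eq by (intro exI[of _ "act d1 \<sigma>1 x a"] allI impI)
    qed
    show "(\<lambda>i. P i k0) \<in> V"
    proof -
      have "P i k0 = (\<Sum>k<d1. P i k * (if k = k0 then 1 else 0))" for i
      proof -
        have "(\<Sum>k<d1. P i k * (if k = k0 then 1 else 0)) = (\<Sum>k<d1. if k = k0 then P i k else 0)"
          by (intro sum.cong) auto
        then show ?thesis using P0(2) by simp
      qed
      then show ?thesis unfolding V_def mem_Collect_eq
        by (intro exI[of _ "\<lambda>k. if k = k0 then 1 else 0"] allI impI)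
    qed
    show "i0 < d2" "P i0 k0 \<noteq> 0" using P0 by auto
  qed
  have "\<exists>q. \<forall>i<d2. ?ap q i = (if i = k then 1 else 0)" for k
  proof -
    obtain w where w: "w \<in> V" "\<forall>i<d2. w i = (if i = k then 1 else 0)"
      using surj[of "\<lambda>i. if i = k then 1 else 0"] by blast
    obtain q where "\<forall>i<d2. w i = ?ap q i" using w(1) unfolding V_def mem_Collect_eq by (rule exE)
    then show ?thesis using w(2) by (intro exI[of _ q]) simp
  qed
  then have "\<exists>q. \<forall>k. \<forall>i<d2. ?ap (q k) i = (if i = k then 1 else 0)" by (rule choice[OF allI])
  then obtain q where q': "\<forall>k. \<forall>i<d2. ?ap (q k) i = (if i = k then 1 else 0)" by (rule exE)
  then have q: "?ap (q k) i = (if i = k then 1 else 0)" if "i < d2" for k i using that by simp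
  define Q where "Q l k = q k l" for l k
  have PQ: "(\<Sum>l<d1. P i l * Q l k) = (if i = k then 1 else 0)" if "i < d2" for i k
    using q[OF that] by (simp add: Q_def)
  have QP: "(\<Sum>i<d2. Q l i * P i k) = (if l = k then 1 else 0)" if "l < d1" "k < d1" for l k
  proof -
    let ?v = "\<lambda>l. (\<Sum>i<d2. Q l i * P i k) - (if l = k then 1 else 0)"
    have "?ap ?v i = 0" if i: "i < d2" for i
    proof -
      have "P i l * (if l = k then 1 else 0) = (if l = k then P i l else 0)" for l by simp
      then have "?ap ?v i = (\<Sum>l<d1. \<Sum>j<d2. P i l * Q l j * P j k) - (\<Sum>l<d1. if l = k then P i l else 0)"
        by (simp only: right_diff_distrib sum_subtractf sum_distrib_left mult.assoc)
      also have "(\<Sum>l<d1. \<Sum>j<d2. P i l * Q l j * P j k) = (\<Sum>j<d2. (\<Sum>l<d1. P i l * Q l j) * P j k)"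
        by (subst sum.swap) (simp add: sum_distrib_right)
      also have "\<dots> = (\<Sum>j<d2. if i = j then P j k else 0)" using PQ[OF i] by (intro sum.cong) auto
      finally show ?thesis using i \<open>k < d1\<close> by simp
    qed
    from inj[of ?v, OF this \<open>l < d1\<close>] show ?thesis by simp
  qed
  have d: "d1 = d2"
    using right_inverse_dim[where m = d2 and k = d1 and P = P and Q = Q]
      right_inverse_dim[where m = d1 and k = d2 and P = Q and Q = P] PQ QP by auto
  let ?P = "mat d1 d1 (\<lambda>(i, j). P i j)" and ?Q = "mat d1 d1 (\<lambda>(i, j). Q i j)"
  have "?P * ?Q = 1\<^sub>m d1" "?Q * ?P = 1\<^sub>m d1"
    using PQ QP d by (auto intro!: eq_matI simp: scalar_prod_def atLeast0LessThan)
  then have "invertible_mat ?P" unfolding invertible_mat_def inverts_mat_def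
    by (auto intro!: exI[of _ ?Q])
  moreover have "?P * \<sigma>1 x = \<sigma>2 x * ?P" for x
  proof (rule eq_matI)
    fix i j assume "i < dim_row (\<sigma>2 x * ?P)" "j < dim_col (\<sigma>2 x * ?P)"
    then have ij: "i < d2" "j < d1" using dims by auto
    then show "(?P * \<sigma>1 x) $$ (i, j) = (\<sigma>2 x * ?P) $$ (i, j)"
      using P[OF ij, of x] dims d by (simp add: scalar_prod_def atLeast0LessThan)
  qed (use dims d in auto)
  ultimately show ?thesis unfolding isomorphic_reps_def using d by (auto intro!: bexI[of _ ?P])
qed

text \<open>Any columns, in any of finitely many pairwise non-isomorphic representations, can be prescribed at once. The
  induction adds one column. If some element killing the columns of \<open>S\<close> does not kill the new one, then the
  new columns of such elements form a non-zero subrepresentation, so they take every value. Otherwise the new column is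
  a function of the columns in \<open>S\<close>, necessarily a sum of intertwiners \<open>P b k\<close>. By Schur's lemma these are
  zero, or scalar if \<open>b\<close> is the new representation; in neither case can they send the columns of the identity to
  the new column of the identity, as that would be another unit vector.\<close>

theorem density:
  fixes \<sigma> :: "'b \<Rightarrow> 'r::ring_1 \<Rightarrow> 'f::field mat" and \<pi> :: "'a::comm_ring_1 \<Rightarrow> 'f"
  assumes rep: "\<And>b. matrix_rep \<eta> \<pi> (d b) (\<sigma> b)" and surj: "surj \<pi>"
    and irr: "\<And>b. abs_irreducible_rep (d b) (\<sigma> b)"
    and niso: "\<And>b b'. b \<noteq> b' \<Longrightarrow> \<not> isomorphic_reps (d b) (\<sigma> b) (d b') (\<sigma> b')"
    and "finite S" and "\<And>b k. (b, k) \<in> S \<Longrightarrow> k < d b"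
  shows "\<exists>x. \<forall>(b, k)\<in>S. \<forall>i<d b. \<sigma> b x $$ (i, k) = t b k i"
  using assms(5,6)
proof (induction S arbitrary: t rule: finite_induct)
  case (insert bk0 S)
  obtain b0 k0 where bk0: "bk0 = (b0, k0)" by force
  have k0: "k0 < d b0" using insert.prems bk0 by auto
  have S: "k < d b" if "(b, k) \<in> S" for b k using insert.prems that by auto
  note IH = insert.IH[OF S]
  note rm = matrix_repD(2)[OF rep]
  define Ann where "Ann = {x. \<forall>(b, k)\<in>S. \<forall>i<d b. \<sigma> b x $$ (i, k) = 0}"
  have AnnD: "\<sigma> b x $$ (i, k) = 0" if "x \<in> Ann" "(b, k) \<in> S" "i < d b" for b k x i
    using that by (auto simp: Ann_def)
  have AnnI: "x \<in> Ann" if "\<And>b k i. (b, k) \<in> S \<Longrightarrow> i < d b \<Longrightarrow> \<sigma> b x $$ (i, k) = 0" for x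
    using that by (auto simp: Ann_def)
  define W where "W = {v. \<exists>x\<in>Ann. \<forall>i<d b0. v i = \<sigma> b0 x $$ (i, k0)}"
  have WI: "v \<in> W" if "x \<in> Ann" "\<And>i. i < d b0 \<Longrightarrow> v i = \<sigma> b0 x $$ (i, k0)" for v x
    using that unfolding W_def by blast
  have WE: "\<exists>x\<in>Ann. \<forall>i<d b0. v i = \<sigma> b0 x $$ (i, k0)" if "v \<in> W" for v
    using that unfolding W_def by blast
  show ?case
  proof (cases "\<exists>w\<in>W. \<exists>i<d b0. w i \<noteq> 0")
    case True
    then obtain w0 i0 where w0: "w0 \<in> W" "i0 < d b0" "w0 i0 \<noteq> 0" by blast
    obtain x where x: "\<forall>(b, k)\<in>S. \<forall>i<d b. \<sigma> b x $$ (i, k) = t b k i" using IH by blast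
    have "\<exists>w\<in>W. \<forall>i<d b0. w i = t b0 k0 i - \<sigma> b0 x $$ (i, k0)"
    proof (rule abs_irreducible_rep_full[where ?w0.0 = w0 and ?i0.0 = i0, OF irr])
      show "\<sigma> b0 x \<in> carrier_mat (d b0) (d b0)" for x by (rule matrix_rep_dim(1)[OF rep])
      show "w0 \<in> W" "i0 < d b0" "w0 i0 \<noteq> 0" by fact+
      show "fun_subspace W"
        unfolding fun_subspace_def
      proof (intro conjI ballI allI)
        show "(\<lambda>_. 0) \<in> W" by (rule WI[of 0]) (use k0 S in \<open>auto intro!: AnnI simp: matrix_rep_0[OF rep]\<close>)
        fix v assume "v \<in> W"
        then obtain y where y: "y \<in> Ann" "\<forall>i<d b0. v i = \<sigma> b0 y $$ (i, k0)" using WE by blast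
        show "(\<lambda>i. v i + w i) \<in> W" if w: "w \<in> W" for w
        proof -
          obtain z where z: "z \<in> Ann" "\<forall>i<d b0. w i = \<sigma> b0 z $$ (i, k0)" using WE[OF w] by blast
          have "y + z \<in> Ann"
            by (rule AnnI) (use AnnD[OF y(1)] AnnD[OF z(1)] in \<open>simp add: matrix_repD(1)[OF rep] S\<close>)
          then show ?thesis by (rule WI) (use y(2) z(2) k0 in \<open>simp add: matrix_repD(1)[OF rep]\<close>)
        qed
        show "(\<lambda>i. c * v i) \<in> W" for c
        proof -
          obtain a where a: "c = \<pi> a" using surj by (metis surjD)
          have "\<eta> a * y \<in> Ann"
            by (rule AnnI) (use AnnD[OF y(1)] in \<open>simp add: matrix_repD(4)[OF rep] S\<close>)
          then show ?thesis by (rule WI) (use y(2) k0 a in \<open>simp add: matrix_repD(4)[OF rep]\<close>)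
        qed
      qed
      show "act (d b0) (\<sigma> b0) y w \<in> W" if w: "w \<in> W" for y w
      proof -
        obtain z where z: "z \<in> Ann" "\<forall>i<d b0. w i = \<sigma> b0 z $$ (i, k0)" using WE[OF w] by blast
        have "y * z \<in> Ann" by (rule AnnI) (use AnnD[OF z(1)] in \<open>simp add: rm S\<close>)
        then show ?thesis by (rule WI) (use z(2) k0 in \<open>simp add: rm\<close>)
      qed
    qed
    then obtain y where y: "y \<in> Ann" "\<forall>i<d b0. t b0 k0 i - \<sigma> b0 x $$ (i, k0) = \<sigma> b0 y $$ (i, k0)"
      using WE by force
    have "\<sigma> b (x + y) $$ (i, k) = t b k i" if bk: "(b, k) \<in> insert bk0 S" and i: "i < d b" for b k i
    proof (cases "(b, k) = bk0")
      case True
      then show ?thesis using y(2) k0 bk0 i by (auto simp: matrix_repD(1)[OF rep] algebra_simps)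
    next
      case False
      then have "(b, k) \<in> S" using bk by blast
      then show ?thesis using x AnnD[OF y(1)] S i by (auto simp: matrix_repD(1)[OF rep])
    qed
    then show ?thesis by blast
  next
    case False
    have zero: "\<sigma> b0 x $$ (i, k0) = 0" if "x \<in> Ann" "i < d b0" for x i
    proof -
      have "(\<lambda>i. \<sigma> b0 x $$ (i, k0)) \<in> W" by (rule WI[OF that(1)]) simp
      then show ?thesis using False that(2) by auto
    qed
    define isE where "isE b k j x \<longleftrightarrow> (\<forall>(b', k')\<in>S. \<forall>i<d b'.
        \<sigma> b' x $$ (i, k') = (if b' = b \<and> k' = k \<and> i = j then 1 else 0))" for b k j x
    define E where "E b k j = (SOME x. isE b k j x)" for b k j
    have "\<exists>x. isE b k j x" for b k j unfolding isE_def by (rule IH)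
    then have "isE b k j (E b k j)" for b k j unfolding E_def by (rule someI_ex)
    then have E: "\<sigma> b' (E b k j) $$ (i, k') = (if b' = b \<and> k' = k \<and> i = j then 1 else 0)"
      if "(b', k') \<in> S" "i < d b'" for b k j b' k' i using that unfolding isE_def by blast
    \<comment> \<open>\<open>E b k j\<close> has the \<open>j\<close>-th unit vector in the column \<open>(b, k)\<close> and zero in the other columns of \<open>S\<close>; so \<open>P b k\<close>
        tells how the new column depends on the column \<open>(b, k)\<close>\<close>
    define P where "P b k i j = \<sigma> b0 (E b k j) $$ (i, k0)" for b k i j
    have P: "(\<Sum>l<d b. P b k i l * \<sigma> b x $$ (l, j)) = (\<Sum>m<d b0. \<sigma> b0 x $$ (i, m) * P b k m j)"
      if bk: "(b, k) \<in> S" and i: "i < d b0" and j: "j < d b" for b k x i j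
    proof -
      define a where "a l = inv_into UNIV \<pi> (\<sigma> b x $$ (l, j))" for l
      have a: "\<pi> (a l) = \<sigma> b x $$ (l, j)" for l unfolding a_def by (rule surj_f_inv_f[OF surj])
      let ?y = "x * E b k j - (\<Sum>l<d b. \<eta> (a l) * E b k l)"
      have "?y \<in> Ann"
      proof (rule AnnI)
        fix b' k' i assume bk': "(b', k') \<in> S" and i: "i < d b'"
        note r = matrix_rep_diff[OF rep i S[OF bk']] matrix_rep_sum[OF rep i S[OF bk']]
          matrix_repD(4)[OF rep i S[OF bk']] matrix_repD(2)[OF rep i S[OF bk'], of x]
        have "\<sigma> b' ?y $$ (i, k') = (\<Sum>m<d b'. \<sigma> b' x $$ (i, m) * (if b' = b \<and> k' = k \<and> m = j then 1 else 0))
            - (\<Sum>l<d b. \<sigma> b x $$ (l, j) * (if b' = b \<and> k' = k \<and> i = l then 1 else 0))"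
          unfolding r a using E[OF bk'] i by (intro arg_cong2[of _ _ _ _ "(-)"] sum.cong refl) auto
        also have "\<dots> = 0"
        proof (cases "b' = b \<and> k' = k")
          case True
          have "(\<Sum>m<d b. \<sigma> b x $$ (i, m) * (if m = j then 1 else 0)) = (\<Sum>m<d b. if m = j then \<sigma> b x $$ (i, m) else 0)"
            "(\<Sum>l<d b. \<sigma> b x $$ (l, j) * (if i = l then 1 else 0)) = (\<Sum>l<d b. if i = l then \<sigma> b x $$ (l, j) else 0)"
            by (intro sum.cong refl; simp)+
          then show ?thesis using True i j by simp
        qed auto
        finally show "\<sigma> b' ?y $$ (i, k') = 0" .
      qed
      from zero[OF this i] show ?thesis
        unfolding matrix_rep_diff[OF rep i k0] matrix_rep_sum[OF rep i k0]
          matrix_repD(4)[OF rep i k0] matrix_repD(2)[OF rep i k0, of x] a P_def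
        by (simp add: mult.commute)
    qed
    have P0: "P b k k0 k = 0" if bk: "(b, k) \<in> S" for b k
    proof (cases "b = b0")
      case True
      obtain c where "\<forall>i<d b0. \<forall>j<d b0. P b k i j = (if i = j then c else 0)"
        using schur_scalar[OF irr[of b0], of "P b k"] P[OF bk] True matrix_rep_dim[OF rep] by blast
      moreover have "k \<noteq> k0" using bk insert.hyps True bk0 by auto
      ultimately show ?thesis using k0 S[OF bk] True by auto
    next
      case False
      show ?thesis
      proof (rule ccontr)
        assume "P b k k0 k \<noteq> 0"
        then have "isomorphic_reps (d b) (\<sigma> b) (d b0) (\<sigma> b0)"
          using P[OF bk] k0 S[OF bk]
          by (intro schur_hom[OF irr irr, of b b0 "P b k" k0 k]) (auto simp: matrix_rep_dim[OF rep])
        then show False using niso False by blast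
      qed
    qed
    \<comment> \<open>the columns of \<open>1\<close> in \<open>S\<close> are unit vectors, so this element kills all of them\<close>
    let ?y = "1 - (\<Sum>(b, k)\<in>S. E b k k)"
    have "?y \<in> Ann"
    proof (rule AnnI)
      fix b k i assume bk: "(b, k) \<in> S" and i: "i < d b"
      have "\<sigma> b ?y $$ (i, k) = (if i = k then 1 else 0)
          - (\<Sum>(b', k')\<in>S. if b = b' \<and> k = k' \<and> i = k' then 1 else 0)"
        unfolding matrix_rep_diff[OF rep i S[OF bk]] matrix_rep_sum[OF rep i S[OF bk]]
          matrix_repD(3)[OF rep i S[OF bk]] case_prod_unfold E[OF bk i] ..
      also have "(\<Sum>(b', k')\<in>S. if b = b' \<and> k = k' \<and> i = k' then 1 else (0 :: 'f))
          = (\<Sum>x\<in>S. if x = (b, k) then if i = k then 1 else 0 else 0)"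
        by (intro sum.cong) (auto split: if_splits)
      also have "\<dots> = (if i = k then 1 else 0)" using insert.hyps(1) bk by simp
      finally show "\<sigma> b ?y $$ (i, k) = 0" by simp
    qed
    from zero[OF this k0] have "1 - (\<Sum>(b, k)\<in>S. P b k k0 k) = 0"
      unfolding matrix_rep_diff[OF rep k0 k0] matrix_rep_sum[OF rep k0 k0]
        matrix_repD(3)[OF rep k0 k0] P_def case_prod_unfold by simp
    moreover have "(\<Sum>(b, k)\<in>S. P b k k0 k) = 0" using P0 by (intro sum.neutral) auto
    ultimately show ?thesis by simp
  qed
qed simp

lemma isomorphic_reps_sym:
  assumes "isomorphic_reps d1 \<sigma>1 d2 \<sigma>2"
    and dim: "\<And>x. \<sigma>1 x \<in> carrier_mat d1 d1" "\<And>x. \<sigma>2 x \<in> carrier_mat d2 d2"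
  shows "isomorphic_reps d2 \<sigma>2 d1 \<sigma>1"
proof -
  obtain P where d: "d1 = d2" and P: "P \<in> carrier_mat d1 d1" "invertible_mat P" "\<And>x. P * \<sigma>1 x = \<sigma>2 x * P"
    using assms(1) by (auto simp: isomorphic_reps_def)
  obtain Q where Q: "inverts_mat P Q" "inverts_mat Q P" using P(2) by (auto simp: invertible_mat_def)
  have PQ: "P * Q = 1\<^sub>m d1" using Q(1) P(1) by (simp add: inverts_mat_def)
  have "dim_col (P * Q) = d1" using PQ by simp
  moreover have QP1: "Q * P = 1\<^sub>m (dim_row Q)" using Q(2) by (simp add: inverts_mat_def)
  then have "dim_col (Q * P) = dim_row Q" by simp
  ultimately have Qc: "Q \<in> carrier_mat d1 d1" using P(1) by auto
  have QP: "Q * P = 1\<^sub>m d1" using QP1 Qc by simp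
  have "Q * \<sigma>2 x = \<sigma>1 x * Q" for x
  proof -
    have s: "\<sigma>1 x \<in> carrier_mat d1 d1" "\<sigma>2 x \<in> carrier_mat d1 d1" using dim d by auto
    have "Q * \<sigma>2 x = Q * (\<sigma>2 x * (P * Q))" using PQ s by simp
    also have "\<dots> = Q * (\<sigma>2 x * P * Q)" using s P(1) Qc by (simp add: assoc_mult_mat[of _ d1 d1 _ d1 _ d1])
    also have "\<dots> = Q * (P * \<sigma>1 x * Q)" by (simp add: P(3))
    also have "\<dots> = Q * P * (\<sigma>1 x * Q)" using s P(1) Qc by (simp add: assoc_mult_mat[of _ d1 d1 _ d1 _ d1])
    also have "\<dots> = \<sigma>1 x * Q" using QP s Qc by simp
    finally show ?thesis .
  qed
  moreover have "invertible_mat Q" using PQ QP P(1) Qc unfolding invertible_mat_def inverts_mat_def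
    by (auto intro!: exI[of _ P])
  ultimately show ?thesis unfolding isomorphic_reps_def using d Qc by auto
qed

corollary density_pair:
  fixes \<sigma>1 \<sigma>2 :: "'r::ring_1 \<Rightarrow> 'f::field mat" and \<pi> :: "'a::comm_ring_1 \<Rightarrow> 'f"
  assumes rep: "matrix_rep \<eta> \<pi> d1 \<sigma>1" "matrix_rep \<eta> \<pi> d2 \<sigma>2" and surj: "surj \<pi>"
    and irr: "abs_irreducible_rep d1 \<sigma>1" "abs_irreducible_rep d2 \<sigma>2"
    and niso: "\<not> isomorphic_reps d1 \<sigma>1 d2 \<sigma>2"
    and M: "M1 \<in> carrier_mat d1 d1" "M2 \<in> carrier_mat d2 d2"
  obtains x where "\<sigma>1 x = M1" and "\<sigma>2 x = M2"
proof -
  let ?\<sigma> = "\<lambda>b. if b then \<sigma>1 else \<sigma>2" and ?d = "\<lambda>b. if b then d1 else d2"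
  let ?S = "Sigma (UNIV :: bool set) (\<lambda>b. {..<?d b})"
  note dim = matrix_rep_dim[OF rep(1)] matrix_rep_dim[OF rep(2)]
  have n2: "\<not> isomorphic_reps d2 \<sigma>2 d1 \<sigma>1" using isomorphic_reps_sym[of d2 \<sigma>2 d1 \<sigma>1] niso dim by blast
  have "\<exists>x. \<forall>(b, k)\<in>?S. \<forall>i<?d b. ?\<sigma> b x $$ (i, k) = (if b then M1 else M2) $$ (i, k)"
    by (rule density[of \<eta> \<pi> ?d ?\<sigma>]) (use rep irr niso n2 surj in \<open>auto split: if_splits\<close>)
  then obtain x where x: "\<forall>(b, k)\<in>?S. \<forall>i<?d b. ?\<sigma> b x $$ (i, k) = (if b then M1 else M2) $$ (i, k)" ..
  have "\<sigma>1 x $$ (i, k) = M1 $$ (i, k)" if "i < d1" "k < d1" for i k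
    using bspec[OF x, of "(True, k)"] that by simp
  moreover have "\<sigma>2 x $$ (i, k) = M2 $$ (i, k)" if "i < d2" "k < d2" for i k
    using bspec[OF x, of "(False, k)"] that by simp
  ultimately have "\<sigma>1 x = M1" "\<sigma>2 x = M2" using dim M by (auto intro!: eq_matI)
  then show thesis by (rule that)
qed

section \<open>Semisimple block triangular representations and traces modulo an ideal\<close>

text \<open>The map \<open>u \<mapsto> Xm (emb u)\<close> intertwines \<open>\<tau>\<close> with \<open>\<sigma>\<close> and is onto the image of \<open>Xm\<close>. The vectors that it
  sends into \<open>W\<close> form a subrepresentation of \<open>\<tau>\<close>, hence everything or zero.\<close>

lemma isotypic_part:
  fixes \<tau> \<sigma> :: "'r \<Rightarrow> 'f::field mat"
  assumes irr: "abs_irreducible_rep d \<tau>" and dim: "\<And>x. \<tau> x \<in> carrier_mat d d"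
    and W: "subrep n \<sigma> W" and XW: "\<And>z. z \<in> W \<Longrightarrow> Xm *\<^sub>v z \<in> W" and Xm: "Xm \<in> carrier_mat n n"
    and emb: "\<And>u. emb u \<in> carrier_vec n" "\<And>u v. emb (\<lambda>i. u i + v i) = emb u + emb v"
      "\<And>c u. emb (\<lambda>i. c * u i) = c \<cdot>\<^sub>v emb u" "\<And>u v. (\<And>i. i < d \<Longrightarrow> u i = v i) \<Longrightarrow> emb u = emb v"
    and p: "\<And>z. z \<in> carrier_vec n \<Longrightarrow> Xm *\<^sub>v z = Xm *\<^sub>v emb (p z)"
    and act: "\<And>s u. \<sigma> s *\<^sub>v (Xm *\<^sub>v emb u) = Xm *\<^sub>v emb (act d \<tau> s u)"
  shows "(\<forall>z\<in>carrier_vec n. Xm *\<^sub>v z \<in> W) \<or> (\<forall>z\<in>W. Xm *\<^sub>v z = 0\<^sub>v n)"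
proof -
  note W' = W[unfolded subrep_def]
  have emb0: "emb (\<lambda>_. 0) = 0\<^sub>v n" 
  proof -
    have "emb (\<lambda>_. 0) = 0 \<cdot>\<^sub>v emb (\<lambda>_. 0)" using emb(3)[of 0 "\<lambda>_. 0"] by simp
    also have "\<dots> = 0\<^sub>v n" using emb(1)[of "\<lambda>_. 0"] by (intro eq_vecI) auto
    finally show ?thesis .
  qed
  have X0: "Xm *\<^sub>v 0\<^sub>v n = 0\<^sub>v n" using Xm by (intro eq_vecI) auto
  define U where "U = {u. Xm *\<^sub>v emb u \<in> W}"
  show ?thesis
  proof (cases "\<exists>u\<in>U. \<exists>i<d. u i \<noteq> 0")
    case True
    then obtain u0 i0 where u0: "u0 \<in> U" "i0 < d" "u0 i0 \<noteq> 0" by blast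
    have "Xm *\<^sub>v z \<in> W" if z: "z \<in> carrier_vec n" for z
    proof -
      have "\<exists>w\<in>U. \<forall>i<d. w i = p z i"
      proof (rule abs_irreducible_rep_full[where ?w0.0 = u0 and ?i0.0 = i0, OF irr dim])
        show "fun_subspace U"
          unfolding fun_subspace_def U_def
          using W' emb(1) by (auto simp: emb0 X0 emb(2,3) mult_add_distrib_mat_vec[OF Xm] mult_mat_vec[OF Xm emb(1)])
        show "act d \<tau> x w \<in> U" if "w \<in> U" for x w
          using that W' by (auto simp: U_def simp flip: act)
      qed (use u0 in auto)
      then obtain w where w: "w \<in> U" "\<forall>i<d. w i = p z i" by blast
      have "emb w = emb (p z)" using w(2) by (intro emb(4)) simp
      then show ?thesis using w(1) p[OF z] by (simp add: U_def)
    qed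
    then show ?thesis by blast
  next
    case False
    have "Xm *\<^sub>v z = 0\<^sub>v n" if z: "z \<in> W" for z
    proof -
      have zc: "z \<in> carrier_vec n" using z W' by blast
      then have "p z \<in> U" using XW[OF z] p[OF zc] by (simp add: U_def)
      then have "emb (p z) = emb (\<lambda>_. 0)" using False by (intro emb(4)) auto
      then show ?thesis using p[OF zc] X0 emb0 by simp
    qed
    then show ?thesis by blast
  qed
qed

lemma block_entries:
  assumes "A \<in> carrier_mat n1 n1" "B \<in> carrier_mat n1 n2" "D \<in> carrier_mat n2 n2"
    and "i < n1 + n2" "j < n1 + n2"
  shows "four_block_mat A B (0\<^sub>m n2 n1) D $$ (i, j) =
    (if i < n1 then if j < n1 then A $$ (i, j) else B $$ (i, j - n1)
     else if j < n1 then 0 else D $$ (i - n1, j - n1))"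
  using assms by auto

text \<open>The element \<open>x\<close> acts as a central idempotent of the image of \<open>\<sigma>\<close>, so every subrepresentation is the sum of its
  parts in the images of \<open>\<sigma>(x)\<close> and \<open>\<sigma>(1 - x)\<close>. These are irreducible, isomorphic to \<open>\<tau>1\<close> and \<open>\<tau>2\<close>; a
  complement of \<open>W\<close> is the sum of those of the two images that \<open>W\<close> does not contain.\<close>

lemma split_block_semisimple:
  fixes \<tau>1 \<tau>2 b \<sigma> :: "'r::ring_1 \<Rightarrow> 'f::field mat" and \<pi> :: "'a::comm_ring_1 \<Rightarrow> 'f"
  assumes rep: "matrix_rep \<eta> \<pi> n1 \<tau>1" "matrix_rep \<eta> \<pi> n2 \<tau>2" "matrix_rep \<eta> \<pi> (n1 + n2) \<sigma>"
    and irr: "abs_irreducible_rep n1 \<tau>1" "abs_irreducible_rep n2 \<tau>2"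
    and b: "\<And>x. b x \<in> carrier_mat n1 n2"
    and \<sigma>: "\<And>x. \<sigma> x = four_block_mat (\<tau>1 x) (b x) (0\<^sub>m n2 n1) (\<tau>2 x)"
    and x: "\<tau>1 x = 1\<^sub>m n1" "\<tau>2 x = 0\<^sub>m n2 n2"
    and comm: "\<And>s. \<sigma> x * \<sigma> s = \<sigma> s * \<sigma> x"
  shows "semisimple_rep (n1 + n2) \<sigma>"
  unfolding semisimple_rep_def
proof (intro allI impI)
  fix W assume W: "subrep (n1 + n2) \<sigma> W"
  let ?n = "n1 + n2"
  note W' = W[unfolded subrep_def]
  note dims = matrix_rep_dim[OF rep(1)] matrix_rep_dim[OF rep(2)] matrix_rep_dim[OF rep(3)]
  have dimb: "dim_row (b x) = n1" "dim_col (b x) = n2" for x using b[of x] by auto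
  define Xm where "Xm = \<sigma> x"
  define Y where "Y = \<sigma> (1 - x)"
  have Xm: "Xm \<in> carrier_mat ?n ?n" and Y: "Y \<in> carrier_mat ?n ?n" using dims by (simp_all add: Xm_def Y_def)
  have Xe: "Xm $$ (i, j) = (if i < n1 then if j < n1 then (if i = j then 1 else 0) else b x $$ (i, j - n1) else 0)"
    if "i < ?n" "j < ?n" for i j
    unfolding Xm_def \<sigma>[of x] x using that b[of x] by (subst block_entries) auto
  have Ye: "Y $$ (i, j) = (if i = j then 1 else 0) - Xm $$ (i, j)" if "i < ?n" "j < ?n" for i j
    using that by (simp add: Xm_def Y_def matrix_rep_diff[OF rep(3)] matrix_repD(3)[OF rep(3)])
  have Yv: "Y *\<^sub>v z = z - Xm *\<^sub>v z" if z: "z \<in> carrier_vec ?n" for z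
  proof (rule eq_vecI)
    fix i assume "i < dim_vec (z - Xm *\<^sub>v z)"
    then have i: "i < ?n" using Xm by simp
    have "(Y *\<^sub>v z) $ i = (\<Sum>j<?n. Y $$ (i, j) * z $ j)"
      using i Y z by (simp add: scalar_prod_def atLeast0LessThan)
    also have "\<dots> = (\<Sum>j<?n. (if i = j then z $ j else 0) - Xm $$ (i, j) * z $ j)"
      using i by (intro sum.cong refl) (simp add: Ye left_diff_distrib)
    also have "\<dots> = z $ i - (Xm *\<^sub>v z) $ i"
      using i Xm z by (simp add: sum_subtractf scalar_prod_def atLeast0LessThan)
    finally show "(Y *\<^sub>v z) $ i = (z - Xm *\<^sub>v z) $ i" using i Xm z by simp
  qed (use Xm Y z in simp)
  have Xcomm: "\<sigma> s *\<^sub>v (Xm *\<^sub>v z) = Xm *\<^sub>v (\<sigma> s *\<^sub>v z)" if "z \<in> carrier_vec ?n" for s z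
    using comm[of s] dims that by (simp add: Xm_def flip: assoc_mult_mat_vec[of _ ?n ?n _ ?n])
  have \<sigma>c: "\<sigma> s *\<^sub>v z \<in> carrier_vec ?n" if "z \<in> carrier_vec ?n" for s z
    using dims that by (intro mult_mat_vec_carrier) auto
  have Xc: "Xm *\<^sub>v z \<in> carrier_vec ?n" if "z \<in> carrier_vec ?n" for z
    using \<sigma>c[OF that] by (simp add: Xm_def)
  have Ycomm: "\<sigma> s *\<^sub>v (Y *\<^sub>v z) = Y *\<^sub>v (\<sigma> s *\<^sub>v z)" if "z \<in> carrier_vec ?n" for s z
    using that Xc \<sigma>c Xcomm dims by (simp add: Yv mult_minus_distrib_mat_vec[of _ ?n ?n])
  have XX: "Xm *\<^sub>v (Xm *\<^sub>v z) = Xm *\<^sub>v z" if z: "z \<in> carrier_vec ?n" for z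
  proof -
    have "Xm * Xm = Xm"
    proof (rule eq_matI)
      fix i j assume "i < dim_row Xm" "j < dim_col Xm"
      then have ij: "i < ?n" "j < ?n" using Xm by auto
      have "(Xm * Xm) $$ (i, j) = (\<Sum>k<?n. Xm $$ (i, k) * Xm $$ (k, j))"
        using ij Xm by (simp add: scalar_prod_def atLeast0LessThan)
      also have "\<dots> = (\<Sum>k<?n. if k = i then Xm $$ (i, j) else 0)"
        using ij by (intro sum.cong refl) (auto simp: Xe)
      finally show "(Xm * Xm) $$ (i, j) = Xm $$ (i, j)" using ij by simp
    qed (use Xm in auto)
    then show ?thesis using z Xm by (simp flip: assoc_mult_mat_vec[of _ ?n ?n _ ?n])
  qed
  have XY: "Xm *\<^sub>v (Y *\<^sub>v z) = 0\<^sub>v ?n" "Y *\<^sub>v (Xm *\<^sub>v z) = 0\<^sub>v ?n" if "z \<in> carrier_vec ?n" for z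
    using that Xc XX by (simp_all add: Yv mult_minus_distrib_mat_vec[OF Xm])
  have XW: "Xm *\<^sub>v z \<in> W" "Y *\<^sub>v z \<in> W" if "z \<in> W" for z
    using that W' by (simp_all add: Xm_def Y_def)
  have zc: "z \<in> carrier_vec ?n" if "z \<in> W" for z using that W' by blast
  define emb1 where "emb1 u = vec ?n (\<lambda>i. if i < n1 then u i else (0 :: 'f))" for u
  define emb2 where "emb2 u = vec ?n (\<lambda>i. if i < n1 then 0 else u (i - n1) :: 'f)" for u
  have s_emb1: "\<sigma> s *\<^sub>v emb1 u = emb1 (act n1 \<tau>1 s u)" for s u
  proof (rule eq_vecI)
    fix i assume "i < dim_vec (emb1 (act n1 \<tau>1 s u))"
    then have i: "i < ?n" by (simp add: emb1_def)
    have "(\<sigma> s *\<^sub>v emb1 u) $ i = (\<Sum>j<?n. \<sigma> s $$ (i, j) * (if j < n1 then u j else 0))"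
      using i dims by (simp add: emb1_def scalar_prod_def atLeast0LessThan)
    also have "\<dots> = (\<Sum>j<n1. \<sigma> s $$ (i, j) * u j)" by (intro sum.mono_neutral_cong_right) auto
    also have "\<dots> = (if i < n1 then act n1 \<tau>1 s u i else 0)"
    proof -
      have "\<sigma> s $$ (i, j) = (if i < n1 then \<tau>1 s $$ (i, j) else 0)" if "j < n1" for j
        unfolding \<sigma>[of s] using that i b dims by (subst block_entries) auto
      then show ?thesis by auto
    qed
    finally show "(\<sigma> s *\<^sub>v emb1 u) $ i = emb1 (act n1 \<tau>1 s u) $ i" using i by (simp add: emb1_def)
  qed (use dims in \<open>simp add: emb1_def\<close>)
  have Ydep: "Y *\<^sub>v z = Y *\<^sub>v emb2 (\<lambda>i. z $ (n1 + i))" if z: "z \<in> carrier_vec ?n" for z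
  proof (rule eq_vecI)
    fix i assume "i < dim_vec (Y *\<^sub>v emb2 (\<lambda>i. z $ (n1 + i)))"
    then have i: "i < ?n" using Y by simp
    have "(\<Sum>j<?n. Y $$ (i, j) * z $ j) = (\<Sum>j<?n. Y $$ (i, j) * emb2 (\<lambda>i. z $ (n1 + i)) $ j)"
      using i by (intro sum.cong refl) (auto simp: emb2_def Ye Xe)
    then show "(Y *\<^sub>v z) $ i = (Y *\<^sub>v emb2 (\<lambda>i. z $ (n1 + i))) $ i"
      using i Y z by (simp add: scalar_prod_def atLeast0LessThan emb2_def)
  qed (use Y in simp)
  have s_emb2: "(\<sigma> s *\<^sub>v emb2 u) $ (n1 + i) = act n2 \<tau>2 s u i" if i: "i < n2" for s u i
  proof -
    have "(\<sigma> s *\<^sub>v emb2 u) $ (n1 + i) = (\<Sum>j<?n. \<sigma> s $$ (n1 + i, j) * emb2 u $ j)"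
      using i dims by (simp add: emb2_def scalar_prod_def atLeast0LessThan)
    also have "\<dots> = (\<Sum>j\<in>{n1..<?n}. \<tau>2 s $$ (i, j - n1) * u (j - n1))"
    proof (intro sum.mono_neutral_cong_right ballI)
      fix j assume "j \<in> {n1..<?n}"
      then show "\<sigma> s $$ (n1 + i, j) * emb2 u $ j = \<tau>2 s $$ (i, j - n1) * u (j - n1)"
        unfolding \<sigma>[of s] using i b dims by (subst block_entries) (auto simp: emb2_def)
    qed (auto simp: emb2_def)
    also have "\<dots> = act n2 \<tau>2 s u i"
      by (rule sum.reindex_bij_witness[of _ "\<lambda>j. n1 + j" "\<lambda>j. j - n1"]) auto
    finally show ?thesis .
  qed
  have embc: "emb1 u \<in> carrier_vec ?n" "emb2 u \<in> carrier_vec ?n" for u by (simp_all add: emb1_def emb2_def)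
  have d1: "(\<forall>z\<in>carrier_vec ?n. Xm *\<^sub>v z \<in> W) \<or> (\<forall>z\<in>W. Xm *\<^sub>v z = 0\<^sub>v ?n)"
  proof (rule isotypic_part[where emb = emb1 and p = "\<lambda>z i. vec_index (Xm *\<^sub>v z) i", OF irr(1) dims(1) W XW(1) Xm])
    show "Xm *\<^sub>v z = Xm *\<^sub>v emb1 (\<lambda>i. (Xm *\<^sub>v z) $ i)" if z: "z \<in> carrier_vec ?n" for z
    proof -
      have "emb1 (\<lambda>i. (Xm *\<^sub>v z) $ i) = Xm *\<^sub>v z"
      proof (rule eq_vecI)
        fix i assume "i < dim_vec (Xm *\<^sub>v z)"
        then have i: "i < ?n" using Xm by simp
        have "(Xm *\<^sub>v z) $ i = 0" if "\<not> i < n1"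
          using that i Xm z by (simp add: scalar_prod_def Xe)
        then show "emb1 (\<lambda>i. (Xm *\<^sub>v z) $ i) $ i = (Xm *\<^sub>v z) $ i" using i by (simp add: emb1_def)
      qed (use Xm in \<open>simp add: emb1_def\<close>)
      then show ?thesis using XX[OF z] by simp
    qed
    show "\<sigma> s *\<^sub>v (Xm *\<^sub>v emb1 u) = Xm *\<^sub>v emb1 (act n1 \<tau>1 s u)" for s u
      by (simp add: Xcomm embc s_emb1)
  qed (auto simp: emb1_def)
  have d2: "(\<forall>z\<in>carrier_vec ?n. Y *\<^sub>v z \<in> W) \<or> (\<forall>z\<in>W. Y *\<^sub>v z = 0\<^sub>v ?n)"
  proof (rule isotypic_part[where emb = emb2 and p = "\<lambda>z i. vec_index z (n1 + i)", OF irr(2) dims(4) W XW(2) Y])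
    show "\<sigma> s *\<^sub>v (Y *\<^sub>v emb2 u) = Y *\<^sub>v emb2 (act n2 \<tau>2 s u)" for s u
    proof -
      have "\<sigma> s *\<^sub>v (Y *\<^sub>v emb2 u) = Y *\<^sub>v emb2 (\<lambda>i. (\<sigma> s *\<^sub>v emb2 u) $ (n1 + i))"
        unfolding Ycomm[OF embc(2)] by (rule Ydep[OF \<sigma>c[OF embc(2)]])
      also have "emb2 (\<lambda>i. (\<sigma> s *\<^sub>v emb2 u) $ (n1 + i)) = emb2 (act n2 \<tau>2 s u)"
      proof (rule eq_vecI)
        fix i assume "i < dim_vec (emb2 (act n2 \<tau>2 s u))"
        then have i: "i < ?n" by (simp add: emb2_def)
        have idx: "emb2 v $ i = (if i < n1 then 0 else v (i - n1))" for v using i by (simp add: emb2_def)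
        show "emb2 (\<lambda>i. (\<sigma> s *\<^sub>v emb2 u) $ (n1 + i)) $ i = emb2 (act n2 \<tau>2 s u) $ i"
          unfolding idx using s_emb2[of "i - n1" s u] i by (cases "i < n1") simp_all
      qed (simp add: emb2_def)
      finally show ?thesis .
    qed
    show "Y *\<^sub>v z = Y *\<^sub>v emb2 (\<lambda>i. z $ (n1 + i))" if "z \<in> carrier_vec ?n" for z
      by (rule Ydep[OF that])
  qed (auto simp: emb2_def)
  \<comment> \<open>\<open>?P1\<close> and \<open>?P2\<close> tell which of the two irreducible parts lie in \<open>W\<close>\<close>
  let ?P1 = "\<forall>z\<in>carrier_vec ?n. Xm *\<^sub>v z \<in> W" and ?P2 = "\<forall>z\<in>carrier_vec ?n. Y *\<^sub>v z \<in> W"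
  define W2 where "W2 = {z\<in>carrier_vec ?n. (?P1 \<longrightarrow> Xm *\<^sub>v z = 0\<^sub>v ?n) \<and> (?P2 \<longrightarrow> Y *\<^sub>v z = 0\<^sub>v ?n)}"
  have zXY: "z = Xm *\<^sub>v z + Y *\<^sub>v z" if "z \<in> carrier_vec ?n" for z
    using that Xm Xc[OF that] unfolding Yv[OF that] by (intro eq_vecI) auto
  show "\<exists>W'. subrep ?n \<sigma> W' \<and> W \<inter> W' = {0\<^sub>v ?n} \<and> (\<forall>v\<in>carrier_vec ?n. \<exists>w\<in>W. \<exists>w'\<in>W'. v = w + w')"
  proof (intro exI[of _ W2] conjI ballI)
    have mat0: "M *\<^sub>v 0\<^sub>v ?n = 0\<^sub>v ?n" if "M \<in> carrier_mat ?n ?n" for M :: "'f mat"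
      using that by (intro eq_vecI) auto
    note X0 = mat0[OF Xm] mat0[OF Y]
    have smult0: "c \<cdot>\<^sub>v 0\<^sub>v ?n = 0\<^sub>v ?n" for c :: 'f by (intro eq_vecI) auto
    have s0: "\<sigma> s *\<^sub>v 0\<^sub>v ?n = 0\<^sub>v ?n" for s by (rule mat0[OF dims(7)])
    show "subrep ?n \<sigma> W2"
      unfolding subrep_def
    proof (intro conjI ballI allI)
      show "W2 \<subseteq> carrier_vec ?n" by (auto simp: W2_def)
      show "0\<^sub>v ?n \<in> W2" by (simp add: W2_def X0)
      fix v assume v: "v \<in> W2"
      then have vc: "v \<in> carrier_vec ?n" by (simp add: W2_def)
      show "v + w \<in> W2" if w: "w \<in> W2" for w
      proof -
        have wc: "w \<in> carrier_vec ?n" using w by (simp add: W2_def)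
        then show ?thesis using v w
          by (simp add: W2_def mult_add_distrib_mat_vec[OF Xm vc wc] mult_add_distrib_mat_vec[OF Y vc wc])
      qed
      show "c \<cdot>\<^sub>v v \<in> W2" for c
        using v by (simp add: W2_def smult0 mult_mat_vec[OF Xm vc] mult_mat_vec[OF Y vc])
      show "\<sigma> s *\<^sub>v v \<in> W2" for s
        using v by (simp add: W2_def \<sigma>c[OF vc] Xcomm[OF vc, symmetric] Ycomm[OF vc, symmetric] s0)
    qed
    have "z = 0\<^sub>v ?n" if z: "z \<in> W" "z \<in> W2" for z
    proof -
      have "Xm *\<^sub>v z = 0\<^sub>v ?n" "Y *\<^sub>v z = 0\<^sub>v ?n" using z d1 d2 by (auto simp: W2_def)
      then show ?thesis using zXY[OF zc[OF z(1)]] by simp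
    qed
    then show "W \<inter> W2 = {0\<^sub>v ?n}" using W' by (auto simp: W2_def X0)
    fix v :: "'f vec" assume v: "v \<in> carrier_vec ?n"
    have Yc: "Y *\<^sub>v v \<in> carrier_vec ?n" using Y v by simp
    define w where "w = (if ?P1 then Xm *\<^sub>v v else 0\<^sub>v ?n) + (if ?P2 then Y *\<^sub>v v else 0\<^sub>v ?n)"
    define w' where "w' = (if ?P1 then 0\<^sub>v ?n else Xm *\<^sub>v v) + (if ?P2 then 0\<^sub>v ?n else Y *\<^sub>v v)"
    have "w \<in> W" unfolding w_def using W' v by auto
    moreover have "w' \<in> W2"
      unfolding w'_def W2_def using Xc[OF v] Yc XY[OF v]
      by (auto simp: X0 mult_add_distrib_mat_vec[OF Xm] mult_add_distrib_mat_vec[OF Y])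
    moreover have "v = w + w'"
    proof -
      have "w + w' = Xm *\<^sub>v v + Y *\<^sub>v v"
        unfolding w_def w'_def using Xc[OF v] Yc by (auto simp: comm_add_vec[of _ ?n])
      then show ?thesis using zXY[OF v] by simp
    qed
    ultimately show "\<exists>w\<in>W. \<exists>w'\<in>W2. v = w + w'" by blast
  qed
qed

lemma ideal_cong_prod:
  assumes I: "ring_ideal I" and "\<And>i. i \<in> A \<Longrightarrow> f i - g i \<in> I"
  shows "prod f A - prod g A \<in> I"
  using assms(2)
proof (induction A rule: infinite_finite_induct)
  case (insert a A)
  have "f a * prod f A - g a * prod g A = (f a - g a) * prod f A + g a * (prod f A - prod g A)"
    by (simp add: algebra_simps)
  then show ?case
    using insert by (simp add: ideal_add[OF I] ideal_multl[OF I] ideal_multr[OF I])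
qed (simp_all add: ideal_zero[OF I])

text \<open>Modulo \<open>I\<close> the entries of \<open>m\<close> on a product are the entries of the product of matrices, so the Frobenius sum of the
  trace is congruent to one that vanishes identically. Multiplicativity only modulo \<open>I\<close> is what the diagonal
  blocks of a representation satisfy when its lower left block has entries in \<open>I\<close>.\<close>

theorem trace_pseudocharacter_mod:
  fixes m :: "'r::ring_1 \<Rightarrow> nat \<Rightarrow> nat \<Rightarrow> 'a::comm_ring_1"
  assumes I: "ring_ideal I"
    and add: "\<And>x y i j. i < d \<Longrightarrow> j < d \<Longrightarrow> m (x + y) i j = m x i j + m y i j"
    and scale: "\<And>a x i j. i < d \<Longrightarrow> j < d \<Longrightarrow> m (\<eta> a * x) i j = a * m x i j"
    and one: "\<And>i j. i < d \<Longrightarrow> j < d \<Longrightarrow> m 1 i j = (if i = j then 1 else 0)"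
    and mult: "\<And>x y i j. i < d \<Longrightarrow> j < d \<Longrightarrow> m (x * y) i j - (\<Sum>k<d. m x i k * m y k j) \<in> I"
  shows "pseudocharacter_mod \<eta> I d (\<lambda>x. \<Sum>i<d. m x i i)"
  unfolding pseudocharacter_mod_def
proof (intro conjI allI)
  let ?T = "\<lambda>x. \<Sum>i<d. m x i i"
  show "?T (x + y) - (?T x + ?T y) \<in> I" for x y
    using ideal_zero[OF I] by (simp add: add sum.distrib)
  show "?T (\<eta> a * x) - a * ?T x \<in> I" for a x
    using ideal_zero[OF I] by (simp add: scale sum_distrib_left)
  show "?T 1 - of_nat d \<in> I" using ideal_zero[OF I] by (simp add: one)
  show "?T (x * y) - ?T (y * x) \<in> I" for x y
  proof -
    have "(\<Sum>i<d. m (x * y) i i - (\<Sum>k<d. m x i k * m y k i)) - (\<Sum>i<d. m (y * x) i i - (\<Sum>k<d. m y i k * m x k i)) \<in> I"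
      by (intro ideal_diff[OF I] ideal_sum[OF I] mult) auto
    moreover have "(\<Sum>i<d. \<Sum>k<d. m x i k * m y k i) = (\<Sum>i<d. \<Sum>k<d. m y i k * m x k i)"
      by (subst sum.swap) (simp add: mult.commute)
    ultimately show ?thesis by (simp add: sum_subtractf)
  qed
  fix x :: "nat \<Rightarrow> 'r"
  have path: "m (prod_list (map x js)) i j - path_prod d (map (\<lambda>k. m (x k)) js) i j \<in> I"
    if "i < d" "j < d" for js i j
    using that
  proof (induction js arbitrary: i)
    case Nil
    then show ?case using one ideal_zero[OF I] by simp
  next
    case (Cons k js)
    have "(m (x k * prod_list (map x js)) i j - (\<Sum>l<d. m (x k) i l * m (prod_list (map x js)) l j))
      + (\<Sum>l<d. m (x k) i l * (m (prod_list (map x js)) l j - path_prod d (map (\<lambda>k. m (x k)) js) l j)) \<in> I"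
      using Cons by (intro ideal_add[OF I] ideal_sum[OF I] ideal_multl[OF I] mult) auto
    then show ?case by (simp add: right_diff_distrib sum_subtractf)
  qed
  let ?S = "\<lambda>\<sigma>. \<Prod>C\<in>orbit \<sigma> ` {..d}. \<Sum>a<d. path_prod d (map (\<lambda>k. m (x k)) (Cycles.support \<sigma> (Min C))) a a"
  have "(\<Sum>\<sigma> | \<sigma> permutes {..d}. of_int (sign \<sigma>) * (cycle_product ?T d x \<sigma> - ?S \<sigma>)) \<in> I"
    unfolding cycle_product_def
  proof (intro ideal_sum[OF I] ideal_multl[OF I] ideal_cong_prod[OF I])
    fix \<sigma> C
    show "?T (prod_list (map x (Cycles.support \<sigma> (Min C))))
       - (\<Sum>a<d. path_prod d (map (\<lambda>k. m (x k)) (Cycles.support \<sigma> (Min C))) a a) \<in> I"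
      unfolding sum_subtractf[symmetric] by (intro ideal_sum[OF I] path) auto
  qed
  moreover have "(\<Sum>\<sigma> | \<sigma> permutes {..d}. of_int (sign \<sigma>) * ?S \<sigma>) = 0"
    by (rule frobenius_identity) simp
  ultimately show "frobenius_sum ?T d x \<in> I"
    by (simp only: frobenius_sum_def right_diff_distrib sum_subtractf diff_zero)
qed

section \<open>Rank one idempotents for the residual extension\<close>

definition bil :: "nat \<Rightarrow> ('r \<Rightarrow> 'a::comm_ring_1 mat) \<Rightarrow> (nat \<Rightarrow> 'a) \<Rightarrow> 'r \<Rightarrow> (nat \<Rightarrow> 'a) \<Rightarrow> 'a" where
  "bil n \<rho> w x v = (\<Sum>i<n. \<Sum>j<n. w i * \<rho> x $$ (i, j) * v j)"

text \<open>The matrix of \<open>e\<close> is \<open>v w\<^sup>T\<close>; the normalisation \<open>w\<^sup>T v = 1\<close> makes it an idempotent.\<close>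

definition rank_one :: "nat \<Rightarrow> ('r \<Rightarrow> 'a::comm_ring_1 mat) \<Rightarrow> 'r \<Rightarrow> (nat \<Rightarrow> 'a) \<Rightarrow> (nat \<Rightarrow> 'a) \<Rightarrow> bool" where
  "rank_one n \<rho> e v w \<longleftrightarrow>
     (\<forall>i<n. \<forall>j<n. \<rho> e $$ (i, j) = v i * w j) \<and> (\<Sum>i<n. w i * v i) = 1"

locale residual_extension =
  fixes \<mm> :: "'a::comm_ring_1 set" and \<pi> :: "'a \<Rightarrow> 'f::field" and \<eta> :: "'a \<Rightarrow> 'r::ring_1"
    and n n1 n2 :: nat and \<rho> :: "'r \<Rightarrow> 'a mat" and \<tau>1 \<tau>2 b :: "'r \<Rightarrow> 'f mat"
  assumes noeth: "noetherian TYPE('a)" and loc: "local_ring \<mm>" and res: "residue_map \<mm> \<pi>"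
    and hens: "henselian \<pi>" and alg: "algebra_map \<eta>"
    and rho: "matrix_rep \<eta> (\<lambda>a. a) n \<rho>"
    and fact_unit: "(of_nat (fact n) :: 'a) dvd 1" and n_def: "n1 + n2 = n"
    and rep1: "matrix_rep \<eta> \<pi> n1 \<tau>1" and rep2: "matrix_rep \<eta> \<pi> n2 \<tau>2"
    and irr1: "abs_irreducible_rep n1 \<tau>1" and irr2: "abs_irreducible_rep n2 \<tau>2"
    and niso: "\<not> isomorphic_reps n1 \<tau>1 n2 \<tau>2"
    and b_dim: "\<And>x. b x \<in> carrier_mat n1 n2"
    and block: "\<And>x. map_mat \<pi> (\<rho> x) = four_block_mat (\<tau>1 x) (b x) (0\<^sub>m n2 n1) (\<tau>2 x)"
    and nonss: "\<not> semisimple_rep n (\<lambda>x. map_mat \<pi> (\<rho> x))"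
begin

definition T :: "'r \<Rightarrow> 'a" where "T x = mat_trace (\<rho> x)"

abbreviation form :: "(nat \<Rightarrow> 'a) \<Rightarrow> 'r \<Rightarrow> (nat \<Rightarrow> 'a) \<Rightarrow> 'a" where "form \<equiv> bil n \<rho>"

lemmas pi = residue_mapD(1-8)[OF res] and pi_zero = residue_mapD(9)[OF res]
lemmas mm = local_ringD(1)[OF loc]

lemma n_pos: "n1 > 0" "n2 > 0"
  using irr1 irr2 by (simp_all add: abs_irreducible_rep_def irreducible_rep_def)

lemma pi_unit: "\<pi> a \<noteq> 0 \<Longrightarrow> a dvd 1"
  using local_ring_unit[OF loc] pi_zero by blast

lemma fact_units: "(of_nat (fact n1) :: 'a) dvd 1" "(of_nat (fact n2) :: 'a) dvd 1"
proof -
  have "(of_nat (fact k) :: 'a) dvd of_nat (fact n)" if "k \<le> n" for k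
  proof -
    have "fact k dvd (fact n :: nat)" using that by (rule fact_dvd)
    then obtain c where "fact n = (fact k * c :: nat)" by (rule dvdE)
    then show ?thesis by (metis dvd_triv_left of_nat_mult)
  qed
  then show "(of_nat (fact n1) :: 'a) dvd 1" "(of_nat (fact n2) :: 'a) dvd 1"
    using fact_unit n_def by (meson dvd_trans le_add1 le_add2)+
qed

lemma rho_entries:
  assumes "i < n" "j < n"
  shows "\<pi> (\<rho> x $$ (i, j)) = (if i < n1 then if j < n1 then \<tau>1 x $$ (i, j) else b x $$ (i, j - n1)
     else if j < n1 then 0 else \<tau>2 x $$ (i - n1, j - n1))"
proof -
  have "\<pi> (\<rho> x $$ (i, j)) = map_mat \<pi> (\<rho> x) $$ (i, j)" using assms matrix_rep_dim[OF rho, of x] by simp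
  then show ?thesis
    unfolding block using block_entries[OF matrix_rep_dim(1)[OF rep1] b_dim matrix_rep_dim(1)[OF rep2]] assms n_def
    by simp
qed

lemma T_sum: "T x = (\<Sum>i<n. \<rho> x $$ (i, i))"
  using matrix_rep_dim[OF rho, of x] by (simp add: T_def mat_trace_def)

lemma T_comm: "T (x * y) = T (y * x)"
proof -
  have "T (x * y) = (\<Sum>i<n. \<Sum>k<n. \<rho> x $$ (i, k) * \<rho> y $$ (k, i))"
    unfolding T_sum by (intro sum.cong refl) (simp add: matrix_repD(2)[OF rho])
  also have "\<dots> = (\<Sum>k<n. \<Sum>i<n. \<rho> y $$ (k, i) * \<rho> x $$ (i, k))"
    by (subst sum.swap) (simp add: mult.commute)
  also have "\<dots> = T (y * x)"
    unfolding T_sum by (intro sum.cong refl) (simp add: matrix_repD(2)[OF rho])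
  finally show ?thesis .
qed

lemma trace_residue:
  "mat_trace (\<tau>1 x) = (\<Sum>i<n1. \<tau>1 x $$ (i, i))" "mat_trace (\<tau>2 x) = (\<Sum>i<n2. \<tau>2 x $$ (i, i))"
  using matrix_rep_dim[OF rep1, of x] matrix_rep_dim[OF rep2, of x] by (simp_all add: mat_trace_def)

lemma sum_split: "(\<Sum>i<n. f i) = (\<Sum>i<n1. f i) + (\<Sum>i<n2. f (n1 + i))"
  for f :: "nat \<Rightarrow> 'c::comm_monoid_add"
proof -
  have "(\<Sum>i<n. f i) = (\<Sum>i<n1. f i) + (\<Sum>i\<in>{n1..<n}. f i)"
    using sum.atLeastLessThan_concat[of 0 n1 n f] n_def by (simp add: atLeast0LessThan)
  also have "(\<Sum>i\<in>{n1..<n}. f i) = (\<Sum>i<n2. f (n1 + i))"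
    using n_def by (intro sum.reindex_bij_witness[of _ "\<lambda>i. n1 + i" "\<lambda>i. i - n1"]) auto
  finally show ?thesis .
qed

lemma T_residue: "\<pi> (T x) = mat_trace (\<tau>1 x) + mat_trace (\<tau>2 x)"
  unfolding T_sum trace_residue sum_split pi
  using n_def by (intro arg_cong2[of _ _ _ _ "(+)"] sum.cong refl) (simp_all add: rho_entries)

lemma exists_residual:
  obtains x where "\<And>i j. i < n1 \<Longrightarrow> j < n1 \<Longrightarrow> \<tau>1 x $$ (i, j) = f i j"
    and "\<And>i j. i < n2 \<Longrightarrow> j < n2 \<Longrightarrow> \<tau>2 x $$ (i, j) = g i j"
proof -
  obtain x where x: "\<tau>1 x = mat n1 n1 (\<lambda>(i, j). f i j)" "\<tau>2 x = mat n2 n2 (\<lambda>(i, j). g i j)"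
    using density_pair[OF rep1 rep2 residue_mapD(10)[OF res] irr1 irr2 niso,
        of "mat n1 n1 (\<lambda>(i, j). f i j)" "mat n2 n2 (\<lambda>(i, j). g i j)"] by auto
  show thesis by (rule that[of x]) (simp_all add: x)
qed

lemma power_idempotent_rep:
  assumes "matrix_rep \<eta> \<pi> d \<sigma>" and "\<sigma> x * \<sigma> x = \<sigma> x" and "k > 0"
  shows "\<sigma> (x ^ k) = \<sigma> x"
  using \<open>k > 0\<close>
proof (induction k rule: nat_induct_non_zero)
  case (Suc k)
  then show ?case using assms(1,2) by (simp add: matrix_rep_def)
qed simp

text \<open>Density provides \<open>x\<close> that is residually the elementary idempotent at \<open>p\<close>, the first position of one of the two
  blocks. Its image modulo \<open>\<mm>\<close> is upper triangular, with a single \<open>1\<close> on the diagonal, as needed for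
  lifting.\<close>

lemma exists_rank_one:
  assumes "p = 0 \<or> p = n1"
  obtains e v w where "rank_one n \<rho> e v w"
    and "\<And>i j. i < n1 \<Longrightarrow> j < n1 \<Longrightarrow> \<tau>1 e $$ (i, j) = (if i = p \<and> j = p then 1 else 0)"
    and "\<And>i j. i < n2 \<Longrightarrow> j < n2 \<Longrightarrow> \<tau>2 e $$ (i, j) = (if n1 + i = p \<and> n1 + j = p then 1 else 0)"
    and "\<And>i. \<pi> (v i) = \<pi> (\<rho> e $$ (i, p))" and "\<And>j. \<pi> (w j) = \<pi> (\<rho> e $$ (p, j))"
proof -
  have p: "p < n" using assms n_pos n_def by auto
  obtain x where x: "\<And>i j. i < n1 \<Longrightarrow> j < n1 \<Longrightarrow> \<tau>1 x $$ (i, j) = (if i = p \<and> j = p then 1 else 0)"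
    "\<And>i j. i < n2 \<Longrightarrow> j < n2 \<Longrightarrow> \<tau>2 x $$ (i, j) = (if n1 + i = p \<and> n1 + j = p then 1 else 0)"
    by (rule exists_residual[of "\<lambda>i j. if i = p \<and> j = p then 1 else 0"
          "\<lambda>i j. if n1 + i = p \<and> n1 + j = p then 1 else 0"]) blast
  have low: "\<pi> (\<rho> y $$ (i, j)) = 0" if "\<tau>1 y = \<tau>1 x" "\<tau>2 y = \<tau>2 x" "j < i" "i < n" for y i j
  proof -
    have "\<not> (n1 + (i - n1) = p \<and> n1 + (j - n1) = p) \<or> i < n1 \<or> j < n1" using that by auto
    then show ?thesis using that n_def by (auto simp: rho_entries x)
  qed
  have dg: "\<pi> (\<rho> y $$ (i, i)) = (if i = p then 1 else 0)" if "\<tau>1 y = \<tau>1 x" "\<tau>2 y = \<tau>2 x" "i < n" for y i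
    using that n_def by (auto simp: rho_entries x)
  have ut: "upper_triangular (map_mat \<pi> (\<rho> x))"
    using low[of x] matrix_rep_dim[OF rho, of x] by (intro upper_triangularI) auto
  obtain e where e: "\<rho> (e * e) = \<rho> e"
    "\<And>d (\<sigma> :: 'r \<Rightarrow> 'f mat). matrix_rep \<eta> \<pi> d \<sigma> \<Longrightarrow> \<sigma> e = \<sigma> (x ^ (n - 1))"
    by (rule lift_idempotent[OF loc res hens alg rho p ut dg[OF refl refl]]) (assumption, blast)
  have idem: "(\<Sum>k<d. (if i = q \<and> k = q then 1 else 0) * (if k = q \<and> j = q then 1 else 0))
     = (if i = q \<and> j = q then 1 else (0 :: 'f))" if "i < d" for i j q d :: nat
  proof -
    have eq: "(\<Sum>k<d. (if i = q \<and> k = q then 1 else 0) * (if k = q \<and> j = q then 1 else (0::'f)))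
      = (\<Sum>k<d. if k = i then (if i = q \<and> j = q then 1 else 0) else 0)"
      by (intro sum.cong) auto
    show ?thesis unfolding eq using that by (cases "i = q \<and> j = q") auto
  qed
  have "\<tau>1 x * \<tau>1 x = \<tau>1 x"
  proof (rule eq_matI)
    fix i j assume "i < dim_row (\<tau>1 x)" "j < dim_col (\<tau>1 x)"
    then have ij: "i < n1" "j < n1" using matrix_rep_dim[OF rep1, of x] by simp_all
    have "(\<tau>1 x * \<tau>1 x) $$ (i, j) = (\<Sum>k<n1. \<tau>1 x $$ (i, k) * \<tau>1 x $$ (k, j))"
      using ij matrix_rep_dim[OF rep1, of x] by (simp add: scalar_prod_def atLeast0LessThan)
    also have "\<dots> = \<tau>1 x $$ (i, j)" using ij idem[of i n1 p j] by (simp add: x)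
    finally show "(\<tau>1 x * \<tau>1 x) $$ (i, j) = \<tau>1 x $$ (i, j)" .
  qed (use matrix_rep_dim[OF rep1, of x] in auto)
  moreover have "\<tau>2 x * \<tau>2 x = \<tau>2 x"
  proof (rule eq_matI)
    fix i j assume "i < dim_row (\<tau>2 x)" "j < dim_col (\<tau>2 x)"
    then have ij: "i < n2" "j < n2" using matrix_rep_dim[OF rep2, of x] by simp_all
    have "(\<tau>2 x * \<tau>2 x) $$ (i, j) = (\<Sum>k<n2. \<tau>2 x $$ (i, k) * \<tau>2 x $$ (k, j))"
      using ij matrix_rep_dim[OF rep2, of x] by (simp add: scalar_prod_def atLeast0LessThan)
    also have "\<dots> = (\<Sum>k<n2. (if p \<ge> n1 \<and> i = p - n1 \<and> k = p - n1 then 1 else 0) *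
        (if p \<ge> n1 \<and> k = p - n1 \<and> j = p - n1 then 1 else 0))"
      using ij by (intro sum.cong refl) (auto simp: x)
    also have "\<dots> = \<tau>2 x $$ (i, j)"
      using ij idem[of i n2 "p - n1" j] by (cases "p \<ge> n1") (auto simp: x)
    finally show "(\<tau>2 x * \<tau>2 x) $$ (i, j) = \<tau>2 x $$ (i, j)" .
  qed (use matrix_rep_dim[OF rep2, of x] in auto)
  moreover have "n - 1 > 0" using n_pos n_def by simp
  ultimately have te: "\<tau>1 e = \<tau>1 x" "\<tau>2 e = \<tau>2 x"
    using e(2)[OF rep1] e(2)[OF rep2] power_idempotent_rep[OF rep1] power_idempotent_rep[OF rep2] by simp_all
  have "\<rho> e * \<rho> e = \<rho> e" using e(1) rho by (simp add: matrix_rep_def)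
  from idempotent_rank_one[OF loc res matrix_rep_dim(1)[OF rho] this p low[OF te] dg[OF te]]
  obtain v w where vw: "\<And>i j. i < n \<Longrightarrow> j < n \<Longrightarrow> \<rho> e $$ (i, j) = v i * w j"
    "(\<Sum>i<n. w i * v i) = 1" "\<And>i. \<pi> (v i) = \<pi> (\<rho> e $$ (i, p))" "\<And>j. \<pi> (w j) = \<pi> (\<rho> e $$ (p, j))"
    by blast
  show thesis
  proof (rule that[of e v w])
    show "rank_one n \<rho> e v w" using vw by (simp add: rank_one_def)
  qed (use vw te x in auto)
qed

lemma form_add: "form w (x + y) v = form w x v + form w y v"
proof -
  have "form w (x + y) v = (\<Sum>i<n. \<Sum>j<n. w i * \<rho> x $$ (i, j) * v j + w i * \<rho> y $$ (i, j) * v j)"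
    unfolding bil_def by (intro sum.cong refl) (simp add: matrix_repD(1)[OF rho] algebra_simps)
  then show ?thesis by (simp add: bil_def sum.distrib)
qed

lemma form_scale: "form w (\<eta> a * x) v = a * form w x v"
  unfolding bil_def sum_distrib_left
  by (intro sum.cong refl) (simp add: matrix_repD(4)[OF rho] algebra_simps)

lemma form_residue: "\<pi> (form w x v) = (\<Sum>i<n. \<Sum>j<n. \<pi> (w i) * \<pi> (\<rho> x $$ (i, j)) * \<pi> (v j))"
  by (simp add: bil_def pi)

lemma form_mult: "form w (x * y) v = (\<Sum>k<n. (\<Sum>i<n. w i * \<rho> x $$ (i, k)) * (\<Sum>j<n. \<rho> y $$ (k, j) * v j))"
proof -
  have "form w (x * y) v = (\<Sum>i<n. \<Sum>j<n. \<Sum>k<n. w i * \<rho> x $$ (i, k) * (\<rho> y $$ (k, j) * v j))"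
    unfolding bil_def
    by (intro sum.cong refl) (simp add: matrix_repD(2)[OF rho] sum_distrib_left sum_distrib_right mult.assoc)
  also have "\<dots> = (\<Sum>i<n. \<Sum>k<n. \<Sum>j<n. w i * \<rho> x $$ (i, k) * (\<rho> y $$ (k, j) * v j))"
    by (intro sum.cong refl sum.swap)
  also have "\<dots> = (\<Sum>k<n. \<Sum>i<n. \<Sum>j<n. w i * \<rho> x $$ (i, k) * (\<rho> y $$ (k, j) * v j))"
    by (rule sum.swap)
  finally show ?thesis by (simp add: sum_product)
qed

lemma T_rank_one:
  assumes "rank_one n \<rho> e v w"
  shows "T (e * z) = form w z v"
proof -
  have "T (e * z) = (\<Sum>i<n. \<Sum>k<n. v i * w k * \<rho> z $$ (k, i))"
    unfolding T_sum using assms by (intro sum.cong refl) (simp add: matrix_repD(2)[OF rho] rank_one_def)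
  also have "\<dots> = (\<Sum>k<n. \<Sum>i<n. v i * w k * \<rho> z $$ (k, i))" by (rule sum.swap)
  finally show ?thesis by (simp add: bil_def algebra_simps)
qed

text \<open>A rank one idempotent in the middle factors a matrix coefficient. So the off-diagonal values \<open>w\<^sup>T \<rho>(x) v'\<close> behave
  like the structure constants of a generalised matrix algebra.\<close>

lemma form_sandwich:
  assumes "rank_one n \<rho> e v w"
  shows "form w' (x * e * y) v' = form w' x v * form w y v'"
proof -
  have row: "(\<Sum>i<n. w' i * \<rho> (x * e) $$ (i, k)) = form w' x v * w k" if k: "k < n" for k
  proof -
    have "(\<Sum>i<n. w' i * \<rho> (x * e) $$ (i, k)) = (\<Sum>i<n. \<Sum>j<n. w' i * \<rho> x $$ (i, j) * v j * w k)"
      using assms k by (intro sum.cong refl)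
        (simp add: matrix_repD(2)[OF rho] rank_one_def sum_distrib_left mult.assoc)
    then show ?thesis by (simp add: bil_def sum_distrib_right)
  qed
  have "form w' (x * e * y) v' = (\<Sum>k<n. form w' x v * (w k * (\<Sum>j<n. \<rho> y $$ (k, j) * v' j)))"
    unfolding form_mult[of w' "x * e"] using row by (intro sum.cong refl) (simp add: mult.assoc)
  also have "\<dots> = form w' x v * form w y v'"
    by (simp add: bil_def sum_distrib_left mult.assoc)
  finally show ?thesis .
qed

lemma T_sandwich:
  assumes "rank_one n \<rho> e v w" "rank_one n \<rho> e' v' w'"
  shows "T (e * x * e' * y) = form w x v' * form w' y v"
proof -
  have "T (e * x * e' * y) = T (e * (x * e' * y))" by (simp add: mult.assoc)
  also have "\<dots> = form w (x * e' * y) v" by (rule T_rank_one[OF assms(1)])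
  finally show ?thesis by (simp add: form_sandwich[OF assms(2)])
qed

text \<open>Suppose that \<open>w\<^sub>1\<^sup>T \<rho>(x) v\<^sub>2\<close> were always in \<open>\<mm>\<close>. Multiplying by residual matrix units on both sides, which moves
  any entry to the place read off by \<open>w\<^sub>1\<close> and \<open>v\<^sub>2\<close>, shows that the upper right block vanishes on the common kernel of
  \<open>\<tau>1\<close> and \<open>\<tau>2\<close>. Then an element lying over \<open>(1, 0)\<close> commutes residually with all of \<open>R\<close>, and the residual
  representation splits, which was excluded.\<close>

lemma exists_linking_element:
  assumes w1: "\<And>k. k < n1 \<Longrightarrow> \<pi> (w1 k) = (if k = 0 then 1 else 0)"
    and v2: "\<And>k. k < n2 \<Longrightarrow> \<pi> (v2 (n1 + k)) = (if k = 0 then 1 else 0)"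
  obtains x where "form w1 x v2 = 1"
proof -
  have "\<exists>x. \<pi> (form w1 x v2) \<noteq> 0"
  proof (rule ccontr)
    assume "\<not> ?thesis"
    then have orth: "\<pi> (form w1 x v2) = 0" for x by blast
    obtain e where e: "\<And>i j. i < n1 \<Longrightarrow> j < n1 \<Longrightarrow> \<tau>1 e $$ (i, j) = (if i = j then 1 else 0)"
      "\<And>i j. i < n2 \<Longrightarrow> j < n2 \<Longrightarrow> \<tau>2 e $$ (i, j) = 0"
      by (rule exists_residual[of "\<lambda>i j. if i = j then 1 else 0" "\<lambda>i j. 0"]) blast
    let ?s = "\<lambda>x. map_mat \<pi> (\<rho> x)"
    note rs = matrix_rep_residue[OF rho res]
    have ent: "?s x $$ (i, j) = \<pi> (\<rho> x $$ (i, j))" if "i < n" "j < n" for x i j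
      using that matrix_rep_dim[OF rho, of x] by simp
    have e': "\<tau>1 (1 - e) $$ (i, j) = 0" if "i < n1" "j < n1" for i j
      using that by (simp add: matrix_rep_diff[OF rep1] matrix_repD(3)[OF rep1] e)
    have prod: "\<pi> (\<rho> (x * y) $$ (i, j)) = (\<Sum>k<n. \<pi> (\<rho> x $$ (i, k)) * \<pi> (\<rho> y $$ (k, j)))"
      if "i < n" "j < n" for x y i j using that by (simp add: matrix_repD(2)[OF rho] pi)
    \<comment> \<open>\<open>g\<close> and \<open>h\<close> carry the entry \<open>(i, j)\<close> of the upper right block to the entry seen by \<open>w1\<close> and \<open>v2\<close>\<close>
    have corner: "b y $$ (i, j) = 0"
      if y1: "\<And>i j. i < n1 \<Longrightarrow> j < n1 \<Longrightarrow> \<tau>1 y $$ (i, j) = 0"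
        and y2: "\<And>i j. i < n2 \<Longrightarrow> j < n2 \<Longrightarrow> \<tau>2 y $$ (i, j) = 0" and ij: "i < n1" "j < n2" for y i j
    proof -
      obtain g where g: "\<And>k l. k < n1 \<Longrightarrow> l < n1 \<Longrightarrow> \<tau>1 g $$ (k, l) = (if k = 0 \<and> l = i then 1 else 0)"
        "\<And>k l. k < n2 \<Longrightarrow> l < n2 \<Longrightarrow> \<tau>2 g $$ (k, l) = 0"
        by (rule exists_residual[of "\<lambda>k l. if k = 0 \<and> l = i then 1 else 0" "\<lambda>k l. 0"]) blast
      obtain h where h: "\<And>k l. k < n1 \<Longrightarrow> l < n1 \<Longrightarrow> \<tau>1 h $$ (k, l) = 0"
        "\<And>k l. k < n2 \<Longrightarrow> l < n2 \<Longrightarrow> \<tau>2 h $$ (k, l) = (if k = j \<and> l = 0 then 1 else 0)"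
        by (rule exists_residual[of "\<lambda>k l. 0" "\<lambda>k l. if k = j \<and> l = 0 then 1 else 0"]) blast
      have yent: "\<pi> (\<rho> y $$ (k, l)) = (if k < n1 \<and> n1 \<le> l then b y $$ (k, l - n1) else 0)"
        if "k < n" "l < n" for k l using that n_def by (auto simp: rho_entries y1 y2)
      have row: "(\<Sum>k<n. \<pi> (w1 k) * \<pi> (\<rho> g $$ (k, l))) = (if l = i then 1 else 0)" if l: "l < n1" for l
      proof -
        have "(\<Sum>k<n. \<pi> (w1 k) * \<pi> (\<rho> g $$ (k, l))) = (\<Sum>k<n. if k = 0 then if l = i then 1 else 0 else 0)"
          using l n_def n_pos by (intro sum.cong refl) (auto simp: rho_entries w1 g)
        then show ?thesis using n_pos n_def by simp
      qed
      have col: "(\<Sum>l<n. \<pi> (\<rho> h $$ (n1 + k, l)) * \<pi> (v2 l)) = (if k = j then 1 else 0)" if k: "k < n2" for k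
      proof -
        have "(\<Sum>l<n. \<pi> (\<rho> h $$ (n1 + k, l)) * \<pi> (v2 l)) = (\<Sum>l<n2. if l = 0 then if k = j then 1 else 0 else 0)"
        proof -
          have "\<pi> (\<rho> h $$ (n1 + k, l)) * \<pi> (v2 l) = 0" if "l < n1" for l
            using that k n_def by (simp add: rho_entries)
          moreover have "\<pi> (\<rho> h $$ (n1 + k, n1 + l)) * \<pi> (v2 (n1 + l))
              = (if l = 0 then if k = j then 1 else 0 else 0)" if "l < n2" for l
            using that k n_def by (simp add: rho_entries v2 h)
          ultimately show ?thesis unfolding sum_split by (simp del: mult_eq_0_iff)
        qed
        then show ?thesis using n_pos by simp
      qed
      have "0 = \<pi> (form w1 (g * (y * h)) v2)" by (simp add: orth)
      also have "\<dots> = (\<Sum>k<n. (\<Sum>i<n. \<pi> (w1 i) * \<pi> (\<rho> g $$ (i, k))) * (\<Sum>j<n. \<pi> (\<rho> (y * h) $$ (k, j)) * \<pi> (v2 j)))"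
        by (simp add: form_mult pi)
      also have "\<dots> = (\<Sum>k<n. if k = i then \<Sum>j<n. \<pi> (\<rho> (y * h) $$ (k, j)) * \<pi> (v2 j) else 0)"
      proof (intro sum.cong refl)
        fix k assume "k \<in> {..<n}"
        then have k: "k < n" by simp
        show "(\<Sum>i<n. \<pi> (w1 i) * \<pi> (\<rho> g $$ (i, k))) * (\<Sum>j<n. \<pi> (\<rho> (y * h) $$ (k, j)) * \<pi> (v2 j))
          = (if k = i then \<Sum>j<n. \<pi> (\<rho> (y * h) $$ (k, j)) * \<pi> (v2 j) else 0)"
        proof (cases "k < n1")
          case True
          then show ?thesis using row[OF True] by simp
        next
          case False
          have "\<pi> (\<rho> (y * h) $$ (k, l)) = 0" if "l < n" for l
            using False k that by (simp add: prod yent)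
          then show ?thesis using False ij by simp
        qed
      qed
      also have "\<dots> = (\<Sum>l<n. \<pi> (\<rho> (y * h) $$ (i, l)) * \<pi> (v2 l))" using ij n_def by simp
      also have "\<dots> = (\<Sum>l<n. \<Sum>k<n. \<pi> (\<rho> y $$ (i, k)) * (\<pi> (\<rho> h $$ (k, l)) * \<pi> (v2 l)))"
        using ij n_def by (intro sum.cong refl) (simp add: prod sum_distrib_right mult.assoc)
      also have "\<dots> = (\<Sum>k<n. \<pi> (\<rho> y $$ (i, k)) * (\<Sum>l<n. \<pi> (\<rho> h $$ (k, l)) * \<pi> (v2 l)))"
        by (subst sum.swap) (simp add: sum_distrib_left)
      also have "\<dots> = (\<Sum>k<n2. b y $$ (i, k) * (if k = j then 1 else 0))"
        unfolding sum_split[of "\<lambda>k. \<pi> (\<rho> y $$ (i, k)) * _ k"] using ij n_def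
        by (simp add: yent col)
      also have "\<dots> = (\<Sum>k<n2. if k = j then b y $$ (i, k) else 0)" by (intro sum.cong) auto
      also have "\<dots> = b y $$ (i, j)" using ij by simp
      finally show ?thesis by simp
    qed
    have zero1: "\<pi> (\<rho> (e * s * (1 - e)) $$ (i, j)) = 0" if ij: "i < n" "j < n" for s i j
    proof -
      have "\<tau>1 (e * s * (1 - e)) $$ (i, j) = 0" if "i < n1" "j < n1" for i j
        using that by (simp add: matrix_repD(2)[OF rep1, of _ _ "e * s"] e')
      moreover have "\<tau>2 (e * (s * (1 - e))) $$ (i, j) = 0" if "i < n2" "j < n2" for i j
        using that by (simp add: matrix_repD(2)[OF rep2, of _ _ e] e)
      ultimately show ?thesis using ij n_def corner[of "e * s * (1 - e)" i "j - n1"]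
        by (auto simp: rho_entries mult.assoc)
    qed
    have zero2: "\<pi> (\<rho> ((1 - e) * s * e) $$ (i, j)) = 0" if ij: "i < n" "j < n" for s i j
    proof -
      have "\<tau>1 ((1 - e) * s) $$ (i, k) = 0" if "i < n1" "k < n1" for i k
        using that by (simp add: matrix_repD(2)[OF rep1, of _ _ "1 - e"] e')
      then have "\<pi> (\<rho> ((1 - e) * s) $$ (i, k)) * \<pi> (\<rho> e $$ (k, j)) = 0" if "k < n" for k
        using ij that n_def by (cases "k < n1") (auto simp: rho_entries e)
      then show ?thesis using ij by (simp add: prod[of i j "(1 - e) * s"] del: mult_eq_0_iff)
    qed
    have "?s e * ?s s = ?s s * ?s e" for s
    proof -
      have "?s (e * s) = ?s (s * e)"
      proof (rule eq_matI)
        fix i j assume "i < dim_row (?s (s * e))" "j < dim_col (?s (s * e))"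
        then have ij: "i < n" "j < n" using matrix_rep_dim[OF rho] by simp_all
        have "e * s = s * e + e * s * (1 - e) - (1 - e) * s * e" by (simp add: algebra_simps)
        then have "\<pi> (\<rho> (e * s) $$ (i, j)) = \<pi> (\<rho> (s * e + e * s * (1 - e) - (1 - e) * s * e) $$ (i, j))"
          by (simp only:)
        also have "\<dots> = \<pi> (\<rho> (s * e) $$ (i, j))"
          using zero1[OF ij] zero2[OF ij]
          by (simp only: matrix_rep_diff[OF rho ij] matrix_repD(1)[OF rho ij] pi) simp
        finally show "?s (e * s) $$ (i, j) = ?s (s * e) $$ (i, j)" using ij by (simp add: ent)
      qed (use matrix_rep_dim[OF rho] in simp_all)
      then show ?thesis using rs unfolding matrix_rep_def by metis
    qed
    moreover have "\<tau>1 e = 1\<^sub>m n1" "\<tau>2 e = 0\<^sub>m n2 n2"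
      using e matrix_rep_dim[OF rep1] matrix_rep_dim[OF rep2] by (auto intro!: eq_matI)
    ultimately have "semisimple_rep (n1 + n2) ?s"
      using rs n_def b_dim block
      by (intro split_block_semisimple[OF rep1 rep2 _ irr1 irr2, of ?s b e]) simp_all
    then show False using nonss n_def by simp
  qed
  then obtain x where "form w1 x v2 dvd 1" using pi_unit by blast
  then obtain u where "form w1 x v2 * u = 1" by (metis dvdE)
  then have "form w1 (\<eta> u * x) v2 = 1" by (simp add: form_scale mult.commute)
  then show thesis by (rule that)
qed

end

section \<open>The ideal of reducibility\<close>

lemma conjugate_rep:
  assumes \<rho>: "matrix_rep \<eta> c d \<rho>" and Q: "Q \<in> carrier_mat d d" "Q' \<in> carrier_mat d d" "Q * Q' = 1\<^sub>m d" "Q' * Q = 1\<^sub>m d"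
  shows "matrix_rep \<eta> c d (\<lambda>x. Q * \<rho> x * Q')"
proof -
  note dim = matrix_rep_dim[OF \<rho>]
  have add: "Q * \<rho> (x + y) * Q' = Q * \<rho> x * Q' + Q * \<rho> y * Q'" for x y
  proof -
    have "\<rho> (x + y) = \<rho> x + \<rho> y" using \<rho> unfolding matrix_rep_def by blast
    then have "Q * \<rho> (x + y) = Q * \<rho> x + Q * \<rho> y"
      using mult_add_distrib_mat[OF Q(1) dim(1) dim(1)] by simp
    then show ?thesis using add_mult_distrib_mat[of "Q * \<rho> x" d d "Q * \<rho> y" Q' d] Q dim by simp
  qed
  have mult: "Q * \<rho> (x * y) * Q' = (Q * \<rho> x * Q') * (Q * \<rho> y * Q')" for x y
  proof -
    have "(Q * \<rho> x * Q') * (Q * \<rho> y * Q') = Q * \<rho> x * (Q' * Q) * \<rho> y * Q'"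
      using Q(1,2) dim(1)[of x] dim(1)[of y] by (simp add: assoc_mult_mat[of _ d d _ d _ d])
    also have "\<dots> = Q * (\<rho> x * \<rho> y) * Q'"
      using Q dim(1)[of x] dim(1)[of y] by (simp add: assoc_mult_mat[of _ d d _ d _ d])
    finally show ?thesis using \<rho> by (simp add: matrix_rep_def)
  qed
  have one: "Q * \<rho> 1 * Q' = 1\<^sub>m d" using \<rho> Q by (simp add: matrix_rep_def)
  have scale: "Q * \<rho> (\<eta> a * x) * Q' = c a \<cdot>\<^sub>m (Q * \<rho> x * Q')" for a x
  proof -
    have "\<rho> (\<eta> a * x) = c a \<cdot>\<^sub>m \<rho> x" using \<rho> unfolding matrix_rep_def by blast
    then show ?thesis using Q dim(1)[of x]
      by (simp add: mult_smult_distrib[of _ d d _ d] mult_smult_assoc_mat[of _ d d _ d])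
  qed
  have "Q * \<rho> x * Q' \<in> carrier_mat d d" for x using Q dim(1)[of x] by simp
  then show ?thesis using add mult one scale unfolding matrix_rep_def by blast
qed

text \<open>The element \<open>x1\<close> lies residually over the first diagonal position of \<open>\<tau>1\<close>, \<open>x2\<close> over that of \<open>\<tau>2\<close>, and \<open>link\<close> connects
  them in the direction which the residual extension leaves open. For \<open>w1\<close> only the first \<open>n1\<close> residual entries are
  known: the rest of that row is part of the non-split extension.\<close>

locale residual_frame = residual_extension \<mm> \<pi> \<eta> n n1 n2 \<rho> \<tau>1 \<tau>2 b
  for \<mm> :: "'a::comm_ring_1 set" and \<pi> :: "'a \<Rightarrow> 'f::field" and \<eta> :: "'a \<Rightarrow> 'r::ring_1"
    and n n1 n2 :: nat and \<rho> :: "'r \<Rightarrow> 'a mat" and \<tau>1 \<tau>2 b :: "'r \<Rightarrow> 'f mat" +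
  fixes x1 x2 link :: 'r and v1 w1 v2 w2 :: "nat \<Rightarrow> 'a"
  assumes r1: "rank_one n \<rho> x1 v1 w1" and r2: "rank_one n \<rho> x2 v2 w2"
    and t1x1: "\<And>i j. i < n1 \<Longrightarrow> j < n1 \<Longrightarrow> \<tau>1 x1 $$ (i, j) = (if i = 0 \<and> j = 0 then 1 else 0)"
    and t2x1: "\<And>i j. i < n2 \<Longrightarrow> j < n2 \<Longrightarrow> \<tau>2 x1 $$ (i, j) = 0"
    and t1x2: "\<And>i j. i < n1 \<Longrightarrow> j < n1 \<Longrightarrow> \<tau>1 x2 $$ (i, j) = 0"
    and t2x2: "\<And>i j. i < n2 \<Longrightarrow> j < n2 \<Longrightarrow> \<tau>2 x2 $$ (i, j) = (if i = 0 \<and> j = 0 then 1 else 0)"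
    and v1: "\<And>i. i < n \<Longrightarrow> \<pi> (v1 i) = (if i = 0 then 1 else 0)"
    and w1: "\<And>j. j < n1 \<Longrightarrow> \<pi> (w1 j) = (if j = 0 then 1 else 0)"
    and w2: "\<And>j. j < n \<Longrightarrow> \<pi> (w2 j) = (if j = n1 then 1 else 0)"
    and link: "form w1 link v2 = 1"
begin

definition red_ideal :: "'a set" where "red_ideal = range (\<lambda>s. form w2 s v1)"

lemma ring_ideal_red: "ring_ideal red_ideal"
  unfolding ring_ideal_iff
proof (intro conjI ballI allI)
  have "form w2 0 v1 = 0" using form_add[of w2 0 0 v1] by simp
  then show "0 \<in> red_ideal" unfolding red_ideal_def by (metis rangeI)
  show "x + y \<in> red_ideal" if "x \<in> red_ideal" "y \<in> red_ideal" for x y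
    using that unfolding red_ideal_def by (auto simp flip: form_add)
  show "a * x \<in> red_ideal" if "x \<in> red_ideal" for a x
    using that unfolding red_ideal_def by (auto simp flip: form_scale)
qed

text \<open>Residually \<open>w\<^sub>2\<close> and \<open>v\<^sub>1\<close> are unit vectors that read off an entry of the lower left block.\<close>

lemma red_ideal_subset: "red_ideal \<subseteq> \<mm>"
proof -
  have "\<pi> (form w2 s v1) = 0" for s
  proof -
    have "\<pi> (form w2 s v1) = (\<Sum>i<n. \<Sum>j<n. if i = n1 \<and> j = 0 then \<pi> (\<rho> s $$ (n1, 0)) else 0)"
      unfolding form_residue by (intro sum.cong refl) (auto simp: w2 v1)
    also have "\<dots> = 0" using n_pos n_def by (intro sum.neutral ballI) (auto simp: rho_entries)
    finally show ?thesis .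
  qed
  then show ?thesis using pi_zero by (auto simp: red_ideal_def)
qed

lemma form_as_trace: "form w2 s v1 = T (x1 * link * x2 * s)"
  by (simp add: T_sandwich[OF r1 r2] link)

text \<open>The rows \<open>w\<^sub>i\<^sup>T \<rho>(r i)\<close>, with \<open>r i\<close> residually a matrix unit, form an invertible matrix \<open>Q\<close>, residually
  upper unitriangular; the columns \<open>\<rho>(c k) v\<^sub>1\<close> form \<open>P\<close>. In \<open>S = Q \<rho> Q\<^sup>-\<^sup>1\<close> the lower left block has entries in the
  ideal: the lower rows of \<open>S Q P = Q \<rho> P\<close> and of \<open>Q P\<close> consist of values \<open>w\<^sub>2\<^sup>T \<rho>(s) v\<^sub>1\<close>, and the upper
  block \<open>\<alpha>\<close> of \<open>Q P\<close> is invertible, so the block of \<open>S\<close> can be solved for. The traces of the diagonal blocks of \<open>S\<close>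
  are the required pseudocharacters.\<close>

lemma red_ideal_splits: "splits_mod \<eta> \<mm> \<pi> T n1 \<tau>1 n2 \<tau>2 red_ideal"
proof -
  have "\<exists>r. (\<forall>k<n1. \<forall>l<n1. \<tau>1 r $$ (k, l) = (if k = 0 \<and> l = i then 1 else 0)) \<and>
      (\<forall>k<n2. \<forall>l<n2. \<tau>2 r $$ (k, l) = (if k = 0 \<and> n1 + l = i then 1 else 0))" for i
    by (rule exists_residual[of "\<lambda>k l. if k = 0 \<and> l = i then 1 else 0"
          "\<lambda>k l. if k = 0 \<and> n1 + l = i then 1 else 0"]) blast
  then have "\<exists>r. \<forall>i. (\<forall>k<n1. \<forall>l<n1. \<tau>1 (r i) $$ (k, l) = (if k = 0 \<and> l = i then 1 else 0)) \<and>
      (\<forall>k<n2. \<forall>l<n2. \<tau>2 (r i) $$ (k, l) = (if k = 0 \<and> n1 + l = i then 1 else 0))"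
    by (rule choice[OF allI])
  then obtain r where
    r: "\<And>i k l. k < n1 \<Longrightarrow> l < n1 \<Longrightarrow> \<tau>1 (r i) $$ (k, l) = (if k = 0 \<and> l = i then 1 else 0)"
      "\<And>i k l. k < n2 \<Longrightarrow> l < n2 \<Longrightarrow> \<tau>2 (r i) $$ (k, l) = (if k = 0 \<and> n1 + l = i then 1 else 0)"
    by blast
  have "\<exists>c. \<forall>i<n1. \<forall>l<n1. \<tau>1 c $$ (i, l) = (if i = k \<and> l = 0 then 1 else 0)" for k
    by (rule exists_residual[of "\<lambda>i l. if i = k \<and> l = 0 then 1 else 0" "\<lambda>_ _. 0"]) blast
  then have "\<exists>c. \<forall>k. \<forall>i<n1. \<forall>l<n1. \<tau>1 (c k) $$ (i, l) = (if i = k \<and> l = 0 then 1 else 0)"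
    by (rule choice[OF allI])
  then obtain c where c: "\<And>k i l. i < n1 \<Longrightarrow> l < n1 \<Longrightarrow> \<tau>1 (c k) $$ (i, l) = (if i = k \<and> l = 0 then 1 else 0)"
    by blast
  define w where "w i = (if i < n1 then w1 else w2)" for i
  define Q where "Q i j = (\<Sum>k<n. w i k * \<rho> (r i) $$ (k, j))" for i j
  define P where "P j k = (\<Sum>l<n. \<rho> (c k) $$ (j, l) * v1 l)" for j k
  \<comment> \<open>the entries of \<open>Q\<close> in the upper right block are not controlled: they involve the extension class\<close>
  have Q_left: "\<pi> (Q i j) = (if i = j then 1 else 0)" if "i < n" "j < n" "n1 \<le> i \<or> j < n1" for i j
  proof (cases "i < n1")
    case True
    then have j: "j < n1" using that by auto
    have "\<pi> (Q i j) = (\<Sum>k<n. if k = 0 then if i = j then 1 else 0 else 0)"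
      unfolding Q_def pi using True j n_def
      by (intro sum.cong refl) (auto simp: w_def rho_entries w1 r)
    then show ?thesis using n_pos n_def by simp
  next
    case False
    have "\<pi> (Q i j) = (\<Sum>k<n. if k = n1 then \<pi> (\<rho> (r i) $$ (n1, j)) else 0)"
      unfolding Q_def pi using False by (intro sum.cong refl) (auto simp: w_def w2)
    also have "\<dots> = \<pi> (\<rho> (r i) $$ (n1, j))" using n_pos n_def by simp
    also have "\<dots> = (if i = j then 1 else 0)"
      using False that n_pos n_def by (auto simp: rho_entries r)
    finally show ?thesis .
  qed
  have P_res: "\<pi> (P j k) = (if j = k then 1 else 0)" if "j < n" "k < n1" for j k
  proof -
    have "\<pi> (P j k) = (\<Sum>l<n. if l = 0 then \<pi> (\<rho> (c k) $$ (j, 0)) else 0)"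
      unfolding P_def pi by (intro sum.cong refl) (auto simp: v1)
    also have "\<dots> = \<pi> (\<rho> (c k) $$ (j, 0))" using n_pos n_def by simp
    also have "\<dots> = (if j = k then 1 else 0)"
      using that n_pos n_def by (auto simp: rho_entries c)
    finally show ?thesis .
  qed
  have QrP: "(\<Sum>m<n. (\<Sum>j<n. Q i j * \<rho> x $$ (j, m)) * P m k) = form (w i) (r i * x * c k) v1" for i x k
  proof -
    have "(\<Sum>j<n. Q i j * \<rho> x $$ (j, m)) = (\<Sum>l<n. w i l * \<rho> (r i * x) $$ (l, m))" if m: "m < n" for m
    proof -
      have "(\<Sum>j<n. Q i j * \<rho> x $$ (j, m)) = (\<Sum>j<n. \<Sum>l<n. w i l * (\<rho> (r i) $$ (l, j) * \<rho> x $$ (j, m)))"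
        by (simp add: Q_def sum_distrib_right mult.assoc)
      also have "\<dots> = (\<Sum>l<n. \<Sum>j<n. w i l * (\<rho> (r i) $$ (l, j) * \<rho> x $$ (j, m)))" by (rule sum.swap)
      finally show ?thesis using m by (simp add: matrix_repD(2)[OF rho] sum_distrib_left)
    qed
    then show ?thesis by (simp add: form_mult[of "w i" "r i * x"] P_def)
  qed
  have QP: "(\<Sum>j<n. Q i j * P j k) = form (w i) (r i * c k) v1" for i k
    by (simp add: form_mult Q_def P_def)
  define Qm where "Qm = mat n n (\<lambda>(i, j). Q i j)"
  have Qm: "Qm \<in> carrier_mat n n" by (simp add: Qm_def)
  have unit_det: "det M dvd 1"
    if M: "M \<in> carrier_mat k k" "\<And>i j. j \<le> i \<Longrightarrow> i < k \<Longrightarrow> \<pi> (M $$ (i, j)) = (if i = j then 1 else 0)" for M k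
  proof -
    interpret comm_ring_hom \<pi> by (rule residue_mapD[OF res])
    have "\<pi> (det M) = det (map_mat \<pi> M)" by simp
    also have "\<dots> = prod_list (diag_mat (map_mat \<pi> M))"
      by (rule det_upper_triangular[of _ k]) (use M in \<open>auto intro!: upper_triangularI\<close>)
    also have "diag_mat (map_mat \<pi> M) = map (\<lambda>i. 1) [0..<k]"
      unfolding diag_mat_def using M by (intro map_cong) auto
    also have "prod_list \<dots> = (1 :: 'f)" by (induction k) simp_all
    finally show ?thesis by (intro pi_unit) simp
  qed
  have "det Qm dvd 1"
  proof (rule unit_det[OF Qm])
    fix i j assume ij: "j \<le> i" "i < n"
    then have "n1 \<le> i \<or> j < n1" by linarith
    then show "\<pi> (Qm $$ (i, j)) = (if i = j then 1 else 0)" using ij Q_left[of i j] by (simp add: Qm_def)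
  qed
  then obtain u where u: "det Qm * u = 1" by (metis dvdE)
  define Q' where "Q' = u \<cdot>\<^sub>m adj_mat Qm"
  have Q': "Q' \<in> carrier_mat n n" using adj_mat(1)[OF Qm] by (simp add: Q'_def)
  have unit: "u \<cdot>\<^sub>m (det Qm \<cdot>\<^sub>m 1\<^sub>m n) = 1\<^sub>m n"
    using u by (intro eq_matI) (auto simp: mult.commute)
  have inv1: "Qm * Q' = 1\<^sub>m n"
    using mult_smult_distrib[OF Qm adj_mat(1)[OF Qm], of u] unit adj_mat(2)[OF Qm] by (simp add: Q'_def)
  have inv2: "Q' * Qm = 1\<^sub>m n"
    using mult_smult_assoc_mat[OF adj_mat(1)[OF Qm] Qm, of u] unit adj_mat(3)[OF Qm] by (simp add: Q'_def)
  define S where "S x = Qm * \<rho> x * Q'" for x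
  have S: "matrix_rep \<eta> (\<lambda>a. a) n S"
    unfolding S_def by (rule conjugate_rep[OF rho Qm Q' inv1 inv2])
  have SQ: "(\<Sum>k<n. S x $$ (i, k) * Q k j) = (\<Sum>k<n. Q i k * \<rho> x $$ (k, j))" if "i < n" "j < n" for x i j
  proof -
    have "S x * Qm = Qm * \<rho> x * (Q' * Qm)"
      unfolding S_def using Qm Q' matrix_rep_dim(1)[OF rho, of x] by (simp add: assoc_mult_mat[of _ n n _ n _ n])
    also have "\<dots> = Qm * \<rho> x" using inv2 Qm matrix_rep_dim(1)[OF rho, of x] by simp
    finally have "(S x * Qm) $$ (i, j) = (Qm * \<rho> x) $$ (i, j)" by simp
    then show ?thesis
      using that matrix_rep_dim[OF S, of x] matrix_rep_dim[OF rho, of x]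
      by (simp add: Qm_def scalar_prod_def atLeast0LessThan)
  qed
  have trace: "(\<Sum>i<n. S x $$ (i, i)) = T x" for x
  proof -
    have dx: "\<rho> x \<in> carrier_mat n n" by (rule matrix_rep_dim(1)[OF rho])
    have ent: "(A * B) $$ (i, i) = (\<Sum>k<n. A $$ (i, k) * B $$ (k, i))"
      if "A \<in> carrier_mat n n" "B \<in> carrier_mat n n" "i < n" for A B :: "'a mat" and i
      using that by (simp add: scalar_prod_def atLeast0LessThan)
    have "(\<Sum>i<n. S x $$ (i, i)) = (\<Sum>i<n. \<Sum>k<n. (Qm * \<rho> x) $$ (i, k) * Q' $$ (k, i))"
      unfolding S_def using Qm Q' dx by (intro sum.cong refl ent) auto
    also have "\<dots> = (\<Sum>k<n. \<Sum>i<n. Q' $$ (k, i) * (Qm * \<rho> x) $$ (i, k))"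
      by (subst sum.swap) (simp add: mult.commute)
    also have "\<dots> = (\<Sum>k<n. (Q' * (Qm * \<rho> x)) $$ (k, k))"
      using Qm Q' dx by (intro sum.cong refl ent[symmetric]) auto
    also have "Q' * (Qm * \<rho> x) = \<rho> x"
      using inv2 Qm Q' dx by (simp flip: assoc_mult_mat[of _ n n _ n _ n])
    finally show ?thesis by (simp add: T_sum)
  qed
  \<comment> \<open>solving \<open>S Q P = Q \<rho> P\<close> for the lower left block of \<open>S\<close>, modulo the ideal\<close>
  have low: "S x $$ (i, l) \<in> red_ideal" if i: "n1 \<le> i" "i < n" and l: "l < n1" for x i l
  proof -
    define \<alpha> where "\<alpha> = mat n1 n1 (\<lambda>(j, k). \<Sum>m<n. Q j m * P m k)"
    have \<alpha>: "\<alpha> \<in> carrier_mat n1 n1" by (simp add: \<alpha>_def)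
    have "det \<alpha> dvd 1"
    proof (rule unit_det[OF \<alpha>])
      fix i j assume ij: "j \<le> i" "i < n1"
      have "\<pi> (\<alpha> $$ (i, j)) = (\<Sum>m<n. \<pi> (Q i m) * \<pi> (P m j))"
        using ij by (simp add: \<alpha>_def pi)
      also have "\<dots> = (\<Sum>m<n. if m = i then if i = j then 1 else 0 else 0)"
        using ij n_def by (intro sum.cong refl) (auto simp: P_res Q_left)
      finally show "\<pi> (\<alpha> $$ (i, j)) = (if i = j then 1 else 0)" using ij n_def by simp
    qed
    then obtain t where t: "det \<alpha> * t = 1" by (metis dvdE)
    let ?s = "\<lambda>j. S x $$ (i, j)"
    have part: "(\<Sum>j<n1. ?s j * \<alpha> $$ (j, k)) \<in> red_ideal" if k: "k < n1" for k
    proof -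
      have "(\<Sum>j<n. ?s j * (\<Sum>m<n. Q j m * P m k)) = (\<Sum>m<n. (\<Sum>j<n. ?s j * Q j m) * P m k)"
        by (simp add: sum_distrib_left sum_distrib_right mult.assoc) (rule sum.swap)
      also have "\<dots> = form w2 (r i * x * c k) v1"
        using i by (simp add: SQ QrP w_def)
      finally have "(\<Sum>j<n1. ?s j * (\<Sum>m<n. Q j m * P m k))
          + (\<Sum>j<n2. ?s (n1 + j) * (\<Sum>m<n. Q (n1 + j) m * P m k)) \<in> red_ideal"
        unfolding sum_split[of "\<lambda>j. ?s j * _ j"] by (simp add: red_ideal_def)
      moreover have "(\<Sum>j<n2. ?s (n1 + j) * (\<Sum>m<n. Q (n1 + j) m * P m k)) \<in> red_ideal"
      proof (rule ideal_sum[OF ring_ideal_red], rule ideal_multl[OF ring_ideal_red])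
        show "(\<Sum>m<n. Q (n1 + j) m * P m k) \<in> red_ideal" for j by (simp add: QP w_def red_ideal_def)
      qed
      ultimately have "(\<Sum>j<n1. ?s j * (\<Sum>m<n. Q j m * P m k)) \<in> red_ideal"
        using ideal_diff[OF ring_ideal_red] by fastforce
      then show ?thesis using k by (simp add: \<alpha>_def)
    qed
    have adj: "(\<Sum>k<n1. \<alpha> $$ (j, k) * adj_mat \<alpha> $$ (k, l)) = (if j = l then det \<alpha> else 0)" if "j < n1" for j
    proof -
      have "(\<Sum>k<n1. \<alpha> $$ (j, k) * adj_mat \<alpha> $$ (k, l)) = (\<alpha> * adj_mat \<alpha>) $$ (j, l)"
        using that l \<alpha> adj_mat(1)[OF \<alpha>] by (simp add: scalar_prod_def atLeast0LessThan)
      also have "\<dots> = (if j = l then det \<alpha> else 0)" using that l by (simp add: adj_mat(2)[OF \<alpha>])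
      finally show ?thesis .
    qed
    have "(\<Sum>k<n1. (\<Sum>j<n1. ?s j * \<alpha> $$ (j, k)) * adj_mat \<alpha> $$ (k, l)) \<in> red_ideal"
      by (intro ideal_sum[OF ring_ideal_red] ideal_multr[OF ring_ideal_red] part) simp
    also have "(\<Sum>k<n1. (\<Sum>j<n1. ?s j * \<alpha> $$ (j, k)) * adj_mat \<alpha> $$ (k, l))
        = (\<Sum>j<n1. ?s j * (\<Sum>k<n1. \<alpha> $$ (j, k) * adj_mat \<alpha> $$ (k, l)))"
      by (simp add: sum_distrib_left sum_distrib_right mult.assoc) (rule sum.swap)
    also have "\<dots> = (\<Sum>j<n1. if j = l then ?s l * det \<alpha> else 0)" by (intro sum.cong refl) (simp add: adj)
    also have "\<dots> = ?s l * det \<alpha>" using l by simp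
    finally have "?s l * det \<alpha> * t \<in> red_ideal" by (rule ideal_multr[OF ring_ideal_red])
    then show ?thesis by (simp add: mult.assoc t)
  qed
  have SQres: "(\<Sum>k<n. \<pi> (S x $$ (i, k)) * \<pi> (Q k j)) = (\<Sum>k<n. \<pi> (Q i k) * \<pi> (\<rho> x $$ (k, j)))"
    if "i < n" "j < n" for x i j
    using arg_cong[OF SQ[OF that, of x], of \<pi>] by (simp add: pi)
  have res1: "\<pi> (S x $$ (i, j)) = \<tau>1 x $$ (i, j)" if "i < n1" "j < n1" for x i j
  proof -
    have ij: "i < n" "j < n" using that n_def by auto
    have "(\<Sum>k<n. \<pi> (S x $$ (i, k)) * \<pi> (Q k j)) = (\<Sum>k<n. if k = j then \<pi> (S x $$ (i, j)) else 0)"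
      using that ij by (intro sum.cong refl) (auto simp: Q_left)
    moreover have "(\<Sum>k<n. \<pi> (Q i k) * \<pi> (\<rho> x $$ (k, j))) = (\<Sum>k<n. if k = i then \<tau>1 x $$ (i, j) else 0)"
    proof (intro sum.cong refl)
      fix k assume "k \<in> {..<n}"
      then show "\<pi> (Q i k) * \<pi> (\<rho> x $$ (k, j)) = (if k = i then \<tau>1 x $$ (i, j) else 0)"
        using that ij by (cases "k < n1") (auto simp: rho_entries Q_left)
    qed
    ultimately show ?thesis using SQres[OF ij, of x] ij by simp
  qed
  have res2: "\<pi> (S x $$ (n1 + i, n1 + j)) = \<tau>2 x $$ (i, j)" if "i < n2" "j < n2" for x i j
  proof -
    have ij: "n1 + i < n" "n1 + j < n" using that n_def by auto
    have "(\<Sum>k<n. \<pi> (S x $$ (n1 + i, k)) * \<pi> (Q k (n1 + j)))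
        = (\<Sum>k<n. if k = n1 + j then \<pi> (S x $$ (n1 + i, n1 + j)) else 0)"
    proof (intro sum.cong refl)
      fix k assume "k \<in> {..<n}"
      then have k: "k < n" by simp
      show "\<pi> (S x $$ (n1 + i, k)) * \<pi> (Q k (n1 + j)) = (if k = n1 + j then \<pi> (S x $$ (n1 + i, n1 + j)) else 0)"
      proof (cases "k < n1")
        case True
        then have "\<pi> (S x $$ (n1 + i, k)) = 0" using low[of "n1 + i" k x] ij red_ideal_subset pi_zero by auto
        then show ?thesis using True by simp
      next
        case False
        then show ?thesis using k ij by (simp add: Q_left)
      qed
    qed
    moreover have "(\<Sum>k<n. \<pi> (Q (n1 + i) k) * \<pi> (\<rho> x $$ (k, n1 + j)))
        = (\<Sum>k<n. if k = n1 + i then \<tau>2 x $$ (i, j) else 0)"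
      using that ij by (intro sum.cong refl) (auto simp: rho_entries Q_left)
    ultimately show ?thesis using SQres[OF ij, of x] ij by simp
  qed
  let ?T1 = "\<lambda>x. \<Sum>i<n1. S x $$ (i, i)" and ?T2 = "\<lambda>x. \<Sum>i<n2. S x $$ (n1 + i, n1 + i)"
  have "pseudocharacter_mod \<eta> red_ideal n1 ?T1"
  proof (rule trace_pseudocharacter_mod[OF ring_ideal_red, where m = "\<lambda>x i j. S x $$ (i, j)"])
    fix x y i j assume ij: "i < n1" "j < n1"
    then have ij': "i < n" "j < n" using n_def by auto
    have "S (x * y) $$ (i, j) - (\<Sum>k<n1. S x $$ (i, k) * S y $$ (k, j))
        = (\<Sum>k<n2. S x $$ (i, n1 + k) * S y $$ (n1 + k, j))"
      unfolding matrix_repD(2)[OF S ij'] sum_split by simp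
    also have "\<dots> \<in> red_ideal"
      using ij n_def by (intro ideal_sum[OF ring_ideal_red] ideal_multl[OF ring_ideal_red] low) auto
    finally show "S (x * y) $$ (i, j) - (\<Sum>k<n1. S x $$ (i, k) * S y $$ (k, j)) \<in> red_ideal" .
  qed (use n_def in \<open>simp_all add: matrix_repD(1,3,4)[OF S]\<close>)
  moreover have "pseudocharacter_mod \<eta> red_ideal n2 ?T2"
  proof (rule trace_pseudocharacter_mod[OF ring_ideal_red, where m = "\<lambda>x i j. S x $$ (n1 + i, n1 + j)"])
    fix x y i j assume ij: "i < n2" "j < n2"
    then have ij': "n1 + i < n" "n1 + j < n" using n_def by auto
    have "S (x * y) $$ (n1 + i, n1 + j) - (\<Sum>k<n2. S x $$ (n1 + i, n1 + k) * S y $$ (n1 + k, n1 + j))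
        = (\<Sum>k<n1. S x $$ (n1 + i, k) * S y $$ (k, n1 + j))"
      unfolding matrix_repD(2)[OF S ij'] sum_split by simp
    also have "\<dots> \<in> red_ideal"
      using ij n_def by (intro ideal_sum[OF ring_ideal_red] ideal_multr[OF ring_ideal_red] low) auto
    finally show "S (x * y) $$ (n1 + i, n1 + j) - (\<Sum>k<n2. S x $$ (n1 + i, n1 + k) * S y $$ (n1 + k, n1 + j)) \<in> red_ideal" .
  qed (use n_def in \<open>simp_all add: matrix_repD(1,3,4)[OF S]\<close>)
  moreover have "T x - (?T1 x + ?T2 x) \<in> red_ideal" for x
    using trace[of x] ideal_zero[OF ring_ideal_red] by (simp add: sum_split)
  moreover have "\<pi> (?T1 x) = mat_trace (\<tau>1 x)" for x by (simp add: pi res1 trace_residue)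
  moreover have "\<pi> (?T2 x) = mat_trace (\<tau>2 x)" for x by (simp add: pi res2 trace_residue)
  ultimately show ?thesis
    unfolding splits_mod_def using ring_ideal_red red_ideal_subset by (intro conjI exI allI)
qed

lemma power_zero_rep:
  assumes "matrix_rep \<eta> \<pi> d \<sigma>" and "\<And>i j. i < d \<Longrightarrow> j < d \<Longrightarrow> \<sigma> y $$ (i, j) = 0" and "k > 0" and "i < d"
  shows "\<sigma> (y ^ k) $$ (i, i) = 0"
proof -
  obtain l where "k = Suc l" using \<open>k > 0\<close> by (metis gr0_implies_Suc)
  then show ?thesis using assms by (simp add: matrix_repD(2)[OF assms(1), of _ _ y])
qed

text \<open>Residually \<open>x1\<close> is zero for \<open>\<tau>2\<close> and \<open>x2\<close> for \<open>\<tau>1\<close>, so \<open>T\<^sub>2\<close> vanishes on the left ideal of \<open>x1\<close> and \<open>T\<^sub>1\<close> on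
  that of \<open>x2\<close>. Up to cyclic permutation, \<open>x1 * link * x2 * s\<close> lies in both. The elements \<open>x1\<close> and \<open>x2\<close>
  are idempotent only up to the kernel \<open>K\<close> of \<open>\<rho>\<close>, which is why the vanishing on \<open>K\<close> comes first.\<close>

lemma red_ideal_minimal:
  assumes "splits_mod \<eta> \<mm> \<pi> T n1 \<tau>1 n2 \<tau>2 J"
  shows "red_ideal \<subseteq> J"
proof -
  obtain T1 T2 where J: "ring_ideal J" "J \<subseteq> \<mm>" and T1: "pseudocharacter_mod \<eta> J n1 T1"
    and T2: "pseudocharacter_mod \<eta> J n2 T2" and sum: "\<And>x. T x - (T1 x + T2 x) \<in> J"
    and res1: "\<And>x. \<pi> (T1 x) = mat_trace (\<tau>1 x)" and res2: "\<And>x. \<pi> (T2 x) = mat_trace (\<tau>2 x)"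
    using assms unfolding splits_mod_def by blast
  define K where "K = {z. \<forall>i<n. \<forall>j<n. \<rho> z $$ (i, j) = 0}"
  have K: "0 \<in> K" "\<And>z z'. z \<in> K \<Longrightarrow> z' \<in> K \<Longrightarrow> z + z' \<in> K" "\<And>a z. z \<in> K \<Longrightarrow> \<eta> a * z \<in> K"
    "\<And>z x. z \<in> K \<Longrightarrow> z * x \<in> K" "\<And>z x. z \<in> K \<Longrightarrow> x * z \<in> K"
    by (auto simp: K_def matrix_rep_0[OF rho] matrix_repD(1,4)[OF rho]) (simp_all add: matrix_repD(2)[OF rho])
  have sumK: "T1 z + T2 z \<in> J" if "z \<in> K" for z
  proof -
    have "T z = 0" using that by (simp add: T_sum K_def)
    then show ?thesis using ideal_uminus[OF J(1) sum[of z]] by (simp add: add.commute)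
  qed
  have in_m1: "T1 (y ^ k) \<in> \<mm>" if "\<And>i j. i < n1 \<Longrightarrow> j < n1 \<Longrightarrow> \<tau>1 y $$ (i, j) = 0" "k > 0" for y k
  proof -
    have "\<pi> (T1 (y ^ k)) = 0" using power_zero_rep[OF rep1 that] by (simp add: res1 trace_residue)
    then show ?thesis by (simp add: pi_zero)
  qed
  have in_m2: "T2 (y ^ k) \<in> \<mm>" if "\<And>i j. i < n2 \<Longrightarrow> j < n2 \<Longrightarrow> \<tau>2 y $$ (i, j) = 0" "k > 0" for y k
  proof -
    have "\<pi> (T2 (y ^ k)) = 0" using power_zero_rep[OF rep2 that] by (simp add: res2 trace_residue)
    then show ?thesis by (simp add: pi_zero)
  qed
  obtain y where y: "\<And>i j. i < n1 \<Longrightarrow> j < n1 \<Longrightarrow> \<tau>1 y $$ (i, j) = (if i = j then 1 else 0)"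
    "\<And>i j. i < n2 \<Longrightarrow> j < n2 \<Longrightarrow> \<tau>2 y $$ (i, j) = 0"
    by (rule exists_residual[of "\<lambda>i j. if i = j then 1 else 0" "\<lambda>i j. 0"]) blast
  have y': "\<tau>1 (1 - y) $$ (i, j) = 0" if "i < n1" "j < n1" for i j
    using that by (simp add: matrix_rep_diff[OF rep1] matrix_repD(3)[OF rep1] y)
  have T2K: "T2 z \<in> J" if "z \<in> K" for z
    by (rule pseudocharacter_vanishes_on_kernel[OF noeth loc J(1) T1 T2 fact_units K(1-4) sumK
          in_m2[OF y(2)] in_m1[OF y'] that])
  have T1K: "T1 z \<in> J" if "z \<in> K" for z
    using ideal_diff[OF J(1) sumK[OF that] T2K[OF that]] by simp
  have rank_power: "z * e ^ Suc k - z * e \<in> K" if e: "rank_one n \<rho> e v w" for z e v w k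
  proof -
    have "\<rho> (e * e) $$ (i, j) = \<rho> e $$ (i, j)" if ij: "i < n" "j < n" for i j
    proof -
      have "\<rho> (e * e) $$ (i, j) = (\<Sum>k<n. (v i * w k) * (v k * w j))"
        using e ij by (simp add: matrix_repD(2)[OF rho] rank_one_def)
      also have "\<dots> = v i * (\<Sum>k<n. w k * v k) * w j"
        by (simp add: sum_distrib_left sum_distrib_right mult.assoc)
      finally have "\<rho> (e * e) $$ (i, j) = v i * (\<Sum>k<n. w k * v k) * w j" .
      then show ?thesis using e ij by (simp add: rank_one_def)
    qed
    then have ee: "e * e - e \<in> K" by (simp add: K_def matrix_rep_diff[OF rho])
    have "e ^ Suc k - e \<in> K"
    proof (induction k)
      case (Suc k)
      have "e ^ Suc (Suc k) - e = e * (e ^ Suc k - e) + (e * e - e)" by (simp add: algebra_simps)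
      then show ?case using K(2)[OF K(5)[OF Suc, of e] ee] by (simp only:)
    qed (use K(1) in simp)
    from K(5)[OF this, of z] show ?thesis by (simp add: right_diff_distrib)
  qed
  have cong: "t a - t c \<in> J" if t: "pseudocharacter_mod \<eta> J d t" "\<And>z. z \<in> K \<Longrightarrow> t z \<in> J" and "a - c \<in> K"
    for t d a c
    using ideal_add[OF J(1) pseudocharacter_modD(1)[OF t(1), of "a - c" c] t(2)[OF \<open>a - c \<in> K\<close>]] by simp
  have T2x1: "T2 (z * x1) \<in> J" for z
    by (rule pseudocharacter_vanishes_on_left_ideal[OF noeth loc J(1) T2 fact_units(2) in_m2[OF t2x1]])
      (assumption, assumption, assumption, rule cong[OF T2 T2K rank_power[OF r1]])
  have T1x2: "T1 (z * x2) \<in> J" for z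
    by (rule pseudocharacter_vanishes_on_left_ideal[OF noeth loc J(1) T1 fact_units(1) in_m1[OF t1x2]])
      (assumption, assumption, assumption, rule cong[OF T1 T1K rank_power[OF r2]])
  have "form w2 s v1 \<in> J" for s
  proof -
    let ?z = "x1 * link * x2 * s"
    have "T2 (x1 * (link * x2 * s)) - T2 ((link * x2 * s) * x1) \<in> J" by (rule pseudocharacter_modD(3)[OF T2])
    then have "T2 (x1 * (link * x2 * s)) \<in> J" using ideal_congI[OF J(1)] T2x1 by blast
    then have a: "T2 ?z \<in> J" by (simp add: mult.assoc)
    have "T1 ((x1 * link * x2) * s) - T1 (s * (x1 * link * x2)) \<in> J" by (rule pseudocharacter_modD(3)[OF T1])
    moreover have "T1 (s * (x1 * link * x2)) \<in> J" using T1x2[of "s * (x1 * link)"] by (simp add: mult.assoc)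
    ultimately have c: "T1 ?z \<in> J" using ideal_congI[OF J(1)] by blast
    have "T ?z \<in> J" using ideal_congI[OF J(1) sum[of ?z]] ideal_add[OF J(1) c a] by (rule iffD2)
    then show ?thesis by (simp add: form_as_trace)
  qed
  then show ?thesis by (auto simp: red_ideal_def)
qed

text \<open>Write \<open>y\<^sub>i = \<tau> x\<^sub>i\<close>. Invariance of \<open>T\<close> turns \<open>T (x1 * link * x2 * s)\<close> into
  \<open>T (y\<^sub>1 * \<tau> s * y\<^sub>2 * \<tau> link)\<close> up to cyclic order. The rule \<open>T (y p y z) = T (y p) T (y z)\<close> is the shadow under
  \<open>\<tau>\<close> of \<open>x\<^sub>i\<close> having rank one, and some \<open>T (y\<^sub>i a' x\<^sub>i a)\<close> is a unit because \<open>\<tau>\<close> preserves the trace of \<open>\<tau>\<^sub>i\<close>.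
  Inserting these factors places \<open>x1\<close> next to \<open>y\<^sub>1\<close> and \<open>x2\<close> next to \<open>y\<^sub>2\<close>, and cutting at \<open>x1\<close> and \<open>x2\<close> separates a factor
  \<open>c\<close> independent of \<open>s\<close>, which itself is a value \<open>w\<^sub>2\<^sup>T \<rho>(\<cdot>) v\<^sub>1\<close>.\<close>

lemma red_ideal_principal:
  assumes \<tau>: "anti_involution \<eta> \<tau>" and T\<tau>: "\<And>x. T (\<tau> x) = T x"
    and \<tau>1: "\<And>x. mat_trace (\<tau>1 (\<tau> x)) = mat_trace (\<tau>1 x)"
    and \<tau>2: "\<And>x. mat_trace (\<tau>2 (\<tau> x)) = mat_trace (\<tau>2 x)"
  shows "principal_ideal red_ideal"
proof -
  have mult: "\<tau> (x * y) = \<tau> y * \<tau> x" for x y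
    using \<tau> by (simp add: anti_involution_def)
  have "\<tau> \<circ> \<tau> = id" using \<tau> by (simp add: anti_involution_def)
  then have inv: "\<tau> (\<tau> x) = x" for x by (simp add: fun_eq_iff)
  \<comment> \<open>for \<open>T\<close>, the image \<open>\<tau> e\<close> of a rank one idempotent behaves like a rank one idempotent\<close>
  have flip: "T (\<tau> e * p * \<tau> e * z) = T (\<tau> e * p) * T (\<tau> e * z)" if e: "rank_one n \<rho> e v w" for e v w p z
  proof -
    have lin: "T (\<tau> e * q) = form w (\<tau> q) v" for q
    proof -
      have "T (\<tau> e * q) = T (\<tau> (\<tau> q * e))" by (simp add: mult inv)
      also have "\<dots> = T (e * \<tau> q)" by (simp only: T\<tau> T_comm[of "\<tau> q"])
      finally show ?thesis by (simp add: T_rank_one[OF e])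
    qed
    have "T (\<tau> e * (p * \<tau> e * z)) = form w (\<tau> (p * \<tau> e * z)) v" by (rule lin)
    also have "\<tau> (p * \<tau> e * z) = \<tau> z * e * \<tau> p" by (simp add: mult inv mult.assoc)
    also have "form w (\<tau> z * e * \<tau> p) v = form w (\<tau> z) v * form w (\<tau> p) v" by (rule form_sandwich[OF e])
    also have "\<dots> = T (\<tau> e * p) * T (\<tau> e * z)" by (simp add: lin mult.commute)
    finally show ?thesis by (simp only: mult.assoc)
  qed
  have tr: "mat_trace (\<sigma> (y * (a' * x * a))) = \<sigma> y $$ (i, i)"
    if \<sigma>: "matrix_rep \<eta> \<pi> d \<sigma>" and "i < d"
      and x: "\<And>k l. k < d \<Longrightarrow> l < d \<Longrightarrow> \<sigma> x $$ (k, l) = (if k = 0 \<and> l = 0 then 1 else 0)"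
      and a': "\<And>k l. k < d \<Longrightarrow> l < d \<Longrightarrow> \<sigma> a' $$ (k, l) = (if k = i \<and> l = 0 then 1 else 0)"
      and a: "\<And>k l. k < d \<Longrightarrow> l < d \<Longrightarrow> \<sigma> a $$ (k, l) = (if k = 0 \<and> l = i then 1 else 0)"
    for d \<sigma> x y a' a i
  proof -
    have ax: "\<sigma> (a' * x) $$ (k, l) = (if k = i \<and> l = 0 then 1 else 0)" if "k < d" "l < d" for k l
    proof -
      have "\<sigma> (a' * x) $$ (k, l) = (\<Sum>m<d. if m = 0 then if k = i \<and> l = 0 then 1 else 0 else 0)"
        unfolding matrix_repD(2)[OF \<sigma> that, of a']
        using that by (intro sum.cong refl) (auto simp: x a')
      then show ?thesis using that by simp
    qed
    have axa: "\<sigma> (a' * x * a) $$ (k, l) = (if k = i \<and> l = i then 1 else 0)" if "k < d" "l < d" for k l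
    proof -
      have "\<sigma> (a' * x * a) $$ (k, l) = (\<Sum>m<d. if m = 0 then if k = i \<and> l = i then 1 else 0 else 0)"
        unfolding matrix_repD(2)[OF \<sigma> that, of "a' * x"]
        using that by (intro sum.cong refl) (auto simp: ax a)
      then show ?thesis using that by simp
    qed
    have "mat_trace (\<sigma> (y * (a' * x * a))) = (\<Sum>k<d. \<Sum>l<d. \<sigma> y $$ (k, l) * \<sigma> (a' * x * a) $$ (l, k))"
      using matrix_rep_dim[OF \<sigma>] by (simp add: mat_trace_def matrix_repD(2)[OF \<sigma>, of _ _ y])
    also have "\<dots> = (\<Sum>k<d. \<Sum>l<d. if k = i then if l = i then \<sigma> y $$ (i, i) else 0 else 0)"
      by (intro sum.cong refl) (auto simp: axa)
    also have "\<dots> = (\<Sum>k<d. if k = i then \<sigma> y $$ (i, i) else 0)"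
      using \<open>i < d\<close> by (intro sum.cong refl) auto
    also have "\<dots> = \<sigma> y $$ (i, i)" using \<open>i < d\<close> by simp
    finally show ?thesis .
  qed
  \<comment> \<open>\<open>\<tau>1 (\<tau> x1)\<close> has trace \<open>1\<close>, so some diagonal entry of it is non-zero; \<open>a\<close> and \<open>a'\<close> move the idempotent \<open>x1\<close>
      to that place\<close>
  have "\<exists>a a'. T (\<tau> x1 * (a' * x1 * a)) dvd 1"
  proof -
    have "mat_trace (\<tau>1 x1) = (\<Sum>i<n1. if i = 0 then 1 else 0)"
      unfolding trace_residue by (intro sum.cong refl) (simp add: t1x1)
    then have "(\<Sum>i<n1. \<tau>1 (\<tau> x1) $$ (i, i)) \<noteq> 0" using \<tau>1[of x1] n_pos by (simp add: trace_residue)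
    then obtain i where i: "i < n1" "\<tau>1 (\<tau> x1) $$ (i, i) \<noteq> 0" by (meson lessThan_iff sum.neutral)
    obtain a' where a': "\<And>k l. k < n1 \<Longrightarrow> l < n1 \<Longrightarrow> \<tau>1 a' $$ (k, l) = (if k = i \<and> l = 0 then 1 else 0)"
      by (rule exists_residual[of "\<lambda>k l. if k = i \<and> l = 0 then 1 else 0" "\<lambda>_ _. 0"]) blast
    obtain a where a: "\<And>k l. k < n1 \<Longrightarrow> l < n1 \<Longrightarrow> \<tau>1 a $$ (k, l) = (if k = 0 \<and> l = i then 1 else 0)"
      by (rule exists_residual[of "\<lambda>k l. if k = 0 \<and> l = i then 1 else 0" "\<lambda>_ _. 0"]) blast
    have z: "\<tau>2 (\<tau> x1 * (a' * x1 * a)) $$ (k, l) = 0" if "k < n2" "l < n2" for k l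
    proof -
      have "\<tau>2 (x1 * a) $$ (k, l) = 0" if "k < n2" "l < n2" for k l
        using that by (simp add: matrix_repD(2)[OF rep2] t2x1)
      then have "\<tau>2 ((\<tau> x1 * a') * (x1 * a)) $$ (k, l) = 0"
        using that by (simp add: matrix_repD(2)[OF rep2, of _ _ "\<tau> x1 * a'"])
      then show ?thesis by (simp add: mult.assoc)
    qed
    have "\<pi> (T (\<tau> x1 * (a' * x1 * a))) = \<tau>1 (\<tau> x1) $$ (i, i)"
      using z by (simp add: T_residue tr[OF rep1 i(1) t1x1 a' a] trace_residue(2))
    then show ?thesis using i(2) pi_unit by metis
  qed
  then obtain a a' l where l: "T (\<tau> x1 * (a' * x1 * a)) * l = 1" by (metis dvdE)
  have "\<exists>g g'. T (\<tau> x2 * (g * x2 * g')) dvd 1"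
  proof -
    have "mat_trace (\<tau>2 x2) = (\<Sum>i<n2. if i = 0 then 1 else 0)"
      unfolding trace_residue by (intro sum.cong refl) (simp add: t2x2)
    then have "(\<Sum>i<n2. \<tau>2 (\<tau> x2) $$ (i, i)) \<noteq> 0" using \<tau>2[of x2] n_pos by (simp add: trace_residue)
    then obtain i where i: "i < n2" "\<tau>2 (\<tau> x2) $$ (i, i) \<noteq> 0" by (meson lessThan_iff sum.neutral)
    obtain g where g: "\<And>k l. k < n2 \<Longrightarrow> l < n2 \<Longrightarrow> \<tau>2 g $$ (k, l) = (if k = i \<and> l = 0 then 1 else 0)"
      by (rule exists_residual[of "\<lambda>_ _. 0" "\<lambda>k l. if k = i \<and> l = 0 then 1 else 0"]) blast
    obtain g' where g': "\<And>k l. k < n2 \<Longrightarrow> l < n2 \<Longrightarrow> \<tau>2 g' $$ (k, l) = (if k = 0 \<and> l = i then 1 else 0)"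
      by (rule exists_residual[of "\<lambda>_ _. 0" "\<lambda>k l. if k = 0 \<and> l = i then 1 else 0"]) blast
    have z: "\<tau>1 (\<tau> x2 * (g * x2 * g')) $$ (k, l) = 0" if "k < n1" "l < n1" for k l
    proof -
      have "\<tau>1 (x2 * g') $$ (k, l) = 0" if "k < n1" "l < n1" for k l
        using that by (simp add: matrix_repD(2)[OF rep1] t1x2)
      then have "\<tau>1 ((\<tau> x2 * g) * (x2 * g')) $$ (k, l) = 0"
        using that by (simp add: matrix_repD(2)[OF rep1, of _ _ "\<tau> x2 * g"])
      then show ?thesis by (simp add: mult.assoc)
    qed
    have "\<pi> (T (\<tau> x2 * (g * x2 * g'))) = \<tau>2 (\<tau> x2) $$ (i, i)"
      using z by (simp add: T_residue tr[OF rep2 i(1) t2x2 g g'] trace_residue(1))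
    then show ?thesis using i(2) pi_unit by metis
  qed
  then obtain g g' k where k: "T (\<tau> x2 * (g * x2 * g')) * k = 1" by (metis dvdE)
  let ?y1 = "\<tau> x1" and ?y2 = "\<tau> x2"
  \<comment> \<open>the factor left between the two cuts at \<open>x2\<close> and at \<open>x1\<close>\<close>
  define c where "c = form w2 (g' * ?y2 * \<tau> link * ?y1 * a') v1"
  have mem: "form w2 s v1 = (k * l * form w1 (a * ?y1 * \<tau> s * ?y2 * g) v2) * c" for s
  proof -
    let ?s = "\<tau> s * ?y2 * \<tau> link"
    let ?t = "\<tau> link * ?y1 * a' * x1 * a * ?y1 * \<tau> s"
    have "form w2 s v1 = T (\<tau> (x1 * link * x2 * s))" by (simp only: form_as_trace T\<tau>)
    also have "\<tau> (x1 * link * x2 * s) = ?s * ?y1" by (simp add: mult mult.assoc)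
    also have "T (?s * ?y1) = T (?y1 * ?s)" by (rule T_comm)
    also have "\<dots> = l * (T (?y1 * (a' * x1 * a)) * T (?y1 * ?s))" using l by (metis mult.assoc mult.commute mult_1)
    also have "T (?y1 * (a' * x1 * a)) * T (?y1 * ?s) = T (?y1 * (a' * x1 * a) * ?y1 * ?s)"
      by (rule flip[OF r1, symmetric])
    also have "?y1 * (a' * x1 * a) * ?y1 * ?s = (?y1 * a' * x1 * a * ?y1 * \<tau> s) * (?y2 * \<tau> link)"
      by (simp add: mult.assoc)
    also have "T \<dots> = T ((?y2 * \<tau> link) * (?y1 * a' * x1 * a * ?y1 * \<tau> s))" by (rule T_comm)
    also have "(?y2 * \<tau> link) * (?y1 * a' * x1 * a * ?y1 * \<tau> s) = ?y2 * ?t" by (simp add: mult.assoc)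
    also have "T (?y2 * ?t) = k * (T (?y2 * (g * x2 * g')) * T (?y2 * ?t))" using k by (metis mult.assoc mult.commute mult_1)
    also have "T (?y2 * (g * x2 * g')) * T (?y2 * ?t) = T (?y2 * (g * x2 * g') * ?y2 * ?t)"
      by (rule flip[OF r2, symmetric])
    also have "?y2 * (g * x2 * g') * ?y2 * ?t
        = (?y2 * g) * (x2 * (g' * ?y2 * \<tau> link * ?y1 * a') * x1 * (a * ?y1 * \<tau> s))" by (simp add: mult.assoc)
    also have "T \<dots> = T ((x2 * (g' * ?y2 * \<tau> link * ?y1 * a') * x1 * (a * ?y1 * \<tau> s)) * (?y2 * g))" by (rule T_comm)
    also have "(x2 * (g' * ?y2 * \<tau> link * ?y1 * a') * x1 * (a * ?y1 * \<tau> s)) * (?y2 * g)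
        = x2 * (g' * ?y2 * \<tau> link * ?y1 * a') * x1 * (a * ?y1 * \<tau> s * ?y2 * g)" by (simp add: mult.assoc)
    also have "T \<dots> = c * form w1 (a * ?y1 * \<tau> s * ?y2 * g) v2" unfolding c_def by (rule T_sandwich[OF r2 r1])
    finally show ?thesis by (simp add: algebra_simps)
  qed
  have "red_ideal = ideal_span {c}"
  proof
    show "red_ideal \<subseteq> ideal_span {c}"
      unfolding red_ideal_def module.span_singleton[OF module_times] using mem by auto
    have "c \<in> red_ideal" unfolding c_def red_ideal_def by blast
    then show "ideal_span {c} \<subseteq> red_ideal" using ring_ideal_red by (intro module.span_minimal[OF module_times]) auto
  qed
  then show ?thesis unfolding principal_ideal_def by blast
qed

end

section \<open>Idempotents of trace one and the involution on the quotient\<close>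

lemma corner_iff: "z \<in> corner e \<longleftrightarrow> e * z * e = z" if "e * e = e" for e :: "'q::ring_1"
proof
  assume "z \<in> corner e"
  then obtain x where "z = e * x * e" by (auto simp: corner_def)
  then have "e * z * e = (e * e) * x * (e * e)" by (simp add: mult.assoc)
  then show "e * z * e = z" using that \<open>z = e * x * e\<close> by simp
next
  assume "e * z * e = z"
  then show "z \<in> corner e" unfolding corner_def by (metis (mono_tags, lifting) mem_Collect_eq)
qed

lemma corner_closed:
  fixes e :: "'q::ring_1"
  assumes e: "e * e = e" and "z \<in> corner e"
  shows "z' \<in> corner e \<Longrightarrow> z * z' \<in> corner e" and "(\<And>x. c * x = x * c) \<Longrightarrow> c * z \<in> corner e"
    and "e * z = z" "z * e = z"
proof -
  have z: "e * z * e = z" using corner_iff[OF e] assms(2) by blast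
  show ez: "e * z = z" using z e by (metis mult.assoc)
  show ze: "z * e = z" using z e by (metis mult.assoc)
  show "z' \<in> corner e \<Longrightarrow> z * z' \<in> corner e"
    using ez corner_iff[OF e] e by (metis mult.assoc)
  show "c * z \<in> corner e" if "\<And>x. c * x = x * c"
    using ez ze that corner_iff[OF e] by (metis mult.assoc)
qed

definition matrix_unit :: "nat \<Rightarrow> nat \<Rightarrow> nat \<Rightarrow> 'a::comm_ring_1 mat" where
  "matrix_unit d k l = mat d d (\<lambda>(i, j). if i = k \<and> j = l then 1 else 0)"

lemma matrix_unit_entry [simp]:
  "i < d \<Longrightarrow> j < d \<Longrightarrow> matrix_unit d k l $$ (i, j) = (if i = k \<and> j = l then 1 else 0)"
  "matrix_unit d k l \<in> carrier_mat d d" "dim_row (matrix_unit d k l) = d" "dim_col (matrix_unit d k l) = d"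
  by (simp_all add: matrix_unit_def)

lemma matrix_unit_mult:
  assumes "M \<in> carrier_mat d d" and "k < d" "l < d" "k' < d" "l' < d"
  shows "matrix_unit d k l * M * matrix_unit d k' l' = M $$ (l, k') \<cdot>\<^sub>m matrix_unit d k l'"
proof (rule eq_matI)
  fix i j assume "i < dim_row (M $$ (l, k') \<cdot>\<^sub>m matrix_unit d k l')" "j < dim_col (M $$ (l, k') \<cdot>\<^sub>m matrix_unit d k l')"
  then have ij: "i < d" "j < d" by simp_all
  have row: "(matrix_unit d k l * M) $$ (i, m) = (if i = k then M $$ (l, m) else 0)" if "m < d" for m
  proof -
    have "(matrix_unit d k l * M) $$ (i, m) = (\<Sum>p<d. matrix_unit d k l $$ (i, p) * M $$ (p, m))"
      using assms ij that by (simp add: scalar_prod_def atLeast0LessThan)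
    also have "\<dots> = (\<Sum>p<d. if p = l then if i = k then M $$ (l, m) else 0 else 0)"
      using ij by (intro sum.cong refl) auto
    finally show ?thesis using assms by simp
  qed
  have "(matrix_unit d k l * M * matrix_unit d k' l') $$ (i, j)
      = (\<Sum>m<d. (matrix_unit d k l * M) $$ (i, m) * matrix_unit d k' l' $$ (m, j))"
    using assms ij by (simp add: scalar_prod_def atLeast0LessThan)
  also have "\<dots> = (\<Sum>m<d. if m = k' then if i = k \<and> j = l' then M $$ (l, k') else 0 else 0)"
    using ij by (intro sum.cong refl) (auto simp: row)
  finally show "(matrix_unit d k l * M * matrix_unit d k' l') $$ (i, j) = (M $$ (l, k') \<cdot>\<^sub>m matrix_unit d k l') $$ (i, j)"
    using assms ij by simp
qed (use assms in simp_all)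

text \<open>In the matrix algebra \<open>e Q e\<close> the idempotent \<open>s E\<close> has trace one, so one of its diagonal entries, say the \<open>i\<close>-th, is a
  unit: this uses that the base ring is local. The matrix units \<open>U 0 i\<close> and \<open>U i 0\<close>, cut off by \<open>s E\<close>, then give
  maps in both directions between the images of \<open>E\<close> and of \<open>s E\<close>, inverse to each other up to this unit.\<close>

lemma corner_unit_conjugate:
  fixes e :: "'q::ring_1" and \<psi> :: "'q \<Rightarrow> 'a::comm_ring_1 mat" and t :: "'q \<Rightarrow> 'a" and \<mm> :: "'a set"
  assumes m: "local_ring \<mm>" and e: "e * e = e" and iso: "corner_iso h e d \<psi>" and d: "d > 0"
    and h: "\<And>a x. h a * x = x * h a" "h 1 = 1" "\<And>a c. h (a * c) = h a * h c"
    and s: "\<And>x y. s (x * y) = s y * s x" "\<And>x. s (s x) = x" "\<And>a x. s (h a * x) = h a * s x" "s e = e"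
    and t: "\<And>z. z \<in> corner e \<Longrightarrow> t z = mat_trace (\<psi> z)" "\<And>z. t (s z) = t z"
  defines "E \<equiv> corner_unit d e \<psi>"
  obtains u v where "u * v = E" and "v * u = s E" and "E * E = E" and "E * u = u" and "v * E = v"
    and "u * s E = u" and "s E * v = v"
proof -
  note cc = corner_closed[OF e]
  have bij: "bij_betw \<psi> (corner e) (carrier_mat d d)" and mult: "\<And>x y. x \<in> corner e \<Longrightarrow> y \<in> corner e \<Longrightarrow> \<psi> (x * y) = \<psi> x * \<psi> y"
    and scale: "\<And>a x. x \<in> corner e \<Longrightarrow> \<psi> (h a * x) = a \<cdot>\<^sub>m \<psi> x"
    using iso unfolding corner_iso_def by blast+
  have inj: "x = y" if "\<psi> x = \<psi> y" "x \<in> corner e" "y \<in> corner e" for x y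
    using bij that by (meson bij_betw_imp_inj_on inj_onD)
  have car: "\<psi> x \<in> carrier_mat d d" if "x \<in> corner e" for x using bij that by (rule bij_betwE[rule_format])
  define U where "U k l = inv_into (corner e) \<psi> (matrix_unit d k l)" for k l
  have mu: "(matrix_unit d k l :: 'a mat) \<in> carrier_mat d d" for k l by (simp add: matrix_unit_def)
  have U: "U k l \<in> corner e" "\<psi> (U k l) = matrix_unit d k l" for k l
    unfolding U_def using bij mu[of k l] by (auto simp: bij_betw_def inv_into_into f_inv_into_f)
  have E: "E = U 0 0"
    unfolding E_def corner_unit_def
  proof (rule the_equality)
    show "U 0 0 \<in> corner e \<and> \<psi> (U 0 0) = mat d d (\<lambda>(i, j). if i = 0 \<and> j = 0 then 1 else 0)"
      using U[of 0 0] by (simp add: matrix_unit_def)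
    show "z = U 0 0" if "z \<in> corner e \<and> \<psi> z = mat d d (\<lambda>(i, j). if i = 0 \<and> j = 0 then 1 else 0)" for z
      using that U[of 0 0] by (intro inj) (simp_all add: matrix_unit_def)
  qed
  have UU: "U k l * U l r = U k r" if "k < d" "l < d" "r < d" for k l r
  proof (rule inj)
    have "matrix_unit d k l * (matrix_unit d l r :: 'a mat)
        = matrix_unit d k l * 1\<^sub>m d * matrix_unit d l r" using mu[of k l] by simp
    also have "\<dots> = 1\<^sub>m d $$ (l, l) \<cdot>\<^sub>m matrix_unit d k r" using that by (intro matrix_unit_mult) auto
    also have "\<dots> = matrix_unit d k r" using that by (intro eq_matI) (auto simp: matrix_unit_def)
    finally show "\<psi> (U k l * U l r) = \<psi> (U k r)" by (simp add: mult U)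
  qed (use U cc(1) in blast)+
  have EE: "E * E = E" using UU[of 0 0 0] d by (simp add: E)
  have Ec: "E \<in> corner e" using U E by simp
  have sc: "s z \<in> corner e" if "z \<in> corner e" for z
    using that corner_iff[OF e] s(1,4) by (metis mult.assoc)
  have sE: "s E * s E = s E" using EE s(1) by metis
  define P where "P = \<psi> (s E)"
  have P: "P \<in> carrier_mat d d" unfolding P_def by (rule car[OF sc[OF Ec]])
  have "(\<Sum>i<d. P $$ (i, i)) = t (s E)" using t(1)[OF sc[OF Ec]] P by (simp add: mat_trace_def P_def)
  also have "\<dots> = mat_trace (matrix_unit d 0 0)" using t Ec U[of 0 0] by (simp add: E)
  also have "\<dots> = (\<Sum>i<d. if i = 0 then 1 else 0)"
    unfolding mat_trace_def by (intro sum.cong) (auto simp: matrix_unit_def)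
  also have "\<dots> = 1" using d by simp
  finally have trP: "(\<Sum>i<d. P $$ (i, i)) = 1" .
  have "\<exists>i<d. P $$ (i, i) \<notin> \<mm>"
  proof (rule ccontr)
    assume "\<not> ?thesis"
    then have "(\<Sum>i<d. P $$ (i, i)) \<in> \<mm>" by (intro ideal_sum[OF local_ringD(1)[OF m]]) auto
    then show False using trP local_ringD(2)[OF m] by simp
  qed
  then obtain i where i: "i < d" "P $$ (i, i) dvd 1" using local_ring_unit[OF m] by blast
  then obtain c where c: "P $$ (i, i) * c = 1" by (metis dvdE)
  \<comment> \<open>\<open>E w E\<close> is a scalar multiple of \<open>E\<close> for every \<open>w\<close> in the corner, and the involution carries this over to \<open>s E\<close>\<close>
  have sandwich: "\<exists>a. s E * w * s E = h a * s E" if w: "w \<in> corner e" for w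
  proof -
    have "E * s w * E = h (\<psi> (s w) $$ (0, 0)) * E"
    proof (rule inj)
      show "\<psi> (E * s w * E) = \<psi> (h (\<psi> (s w) $$ (0, 0)) * E)"
        using matrix_unit_mult[OF car[OF sc[OF w]] d d d d] sc[OF w] Ec U[of 0 0]
        by (simp add: E mult scale cc(1))
      show "E * s w * E \<in> corner e" by (intro cc(1) sc Ec w)
      show "h (\<psi> (s w) $$ (0, 0)) * E \<in> corner e" by (rule cc(2)[OF Ec h(1)])
    qed
    then have "s (E * s w * E) = h (\<psi> (s w) $$ (0, 0)) * s E" by (simp add: s(3))
    then show ?thesis by (auto simp: s(1,2) mult.assoc)
  qed
  have key: "s E * U i i * s E = h (P $$ (i, i)) * s E"
  proof -
    obtain a where a: "s E * U i i * s E = h a * s E" using sandwich[OF U(1)] by blast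
    have "\<psi> (s E * U i i * s E) = P * matrix_unit d i i * P"
      using U[of i i] sc[OF Ec] by (simp add: mult cc(1) P_def)
    then have PUP: "P * matrix_unit d i i * P = a \<cdot>\<^sub>m P" using a scale[OF sc[OF Ec]] by (simp add: P_def)
    have "(P * matrix_unit d i i * P) $$ (i, i) = P $$ (i, i) * P $$ (i, i)"
    proof -
      have "(P * matrix_unit d i i) $$ (i, k) = (if k = i then P $$ (i, i) else 0)" if k: "k < d" for k
      proof -
        have "(P * matrix_unit d i i) $$ (i, k) = (\<Sum>p<d. P $$ (i, p) * matrix_unit d i i $$ (p, k))"
          using P i k by (simp add: matrix_unit_def scalar_prod_def atLeast0LessThan)
        also have "\<dots> = (\<Sum>p<d. if p = i then if k = i then P $$ (i, i) else 0 else 0)"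
          using k by (intro sum.cong refl) (auto simp: matrix_unit_def)
        finally show ?thesis using i by simp
      qed
      note row = this
      have "(P * matrix_unit d i i * P) $$ (i, i) = (\<Sum>k<d. (P * matrix_unit d i i) $$ (i, k) * P $$ (k, i))"
        using P i by (simp add: matrix_unit_def scalar_prod_def atLeast0LessThan)
      also have "\<dots> = (\<Sum>k<d. if k = i then P $$ (i, i) * P $$ (i, i) else 0)"
        by (intro sum.cong refl) (auto simp: row)
      finally show ?thesis using i by simp
    qed
    then have "P $$ (i, i) * P $$ (i, i) = a * P $$ (i, i)" using PUP P i by simp
    then have "P $$ (i, i) * (P $$ (i, i) * c) = a * (P $$ (i, i) * c)" by (simp add: mult.assoc[symmetric])
    then have "a = P $$ (i, i)" by (simp add: c)
    then show ?thesis using a by simp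
  qed
  \<comment> \<open>\<open>c\<close> is the inverse of the \<open>i\<close>-th diagonal entry of \<open>\<psi> (s E)\<close>\<close>
  define u where "u = U 0 i * s E"
  define v where "v = h c * (s E * U i 0)"
  show thesis
  proof (rule that[of u v])
    have "U 0 i * s E * U i 0 = h (P $$ (i, i)) * E"
    proof (rule inj)
      show "\<psi> (U 0 i * s E * U i 0) = \<psi> (h (P $$ (i, i)) * E)"
        using matrix_unit_mult[OF P d i(1) i(1) d] sc[OF Ec] U Ec
        by (simp add: mult scale cc(1) P_def E)
      show "U 0 i * s E * U i 0 \<in> corner e" by (intro cc(1) sc Ec U)
      show "h (P $$ (i, i)) * E \<in> corner e" by (rule cc(2)[OF Ec h(1)])
    qed
    then have "h c * (U 0 i * s E * U i 0) = (h c * h (P $$ (i, i))) * E" by (simp add: mult.assoc)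
    also have "h c * h (P $$ (i, i)) = 1" using c h(2,3) by (metis mult.commute)
    finally have "h c * (U 0 i * s E * U i 0) = E" by simp
    moreover have "u * v = h c * (U 0 i * (s E * s E) * U i 0)"
      unfolding u_def v_def by (metis h(1) mult.assoc)
    ultimately show "u * v = E" by (simp add: sE)
    have "v * u = h c * (s E * (U i 0 * U 0 i) * s E)" unfolding u_def v_def by (simp add: mult.assoc)
    also have "\<dots> = h c * (h (P $$ (i, i)) * s E)" using UU[of i 0 i] i d key by simp
    also have "\<dots> = (h c * h (P $$ (i, i))) * s E" by (simp add: mult.assoc)
    also have "h c * h (P $$ (i, i)) = 1" using c h(2,3) by (metis mult.commute)
    finally show "v * u = s E" by simp
    show "E * E = E" by (fact EE)
    show "E * u = u" unfolding u_def using UU[of 0 0 i] i d by (simp add: E mult.assoc[symmetric])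
    show "v * E = v" unfolding v_def using UU[of i 0 0] i d by (simp add: E mult.assoc)
    show "u * s E = u" unfolding u_def by (simp add: mult.assoc sE)
    show "s E * v = v" unfolding v_def by (metis h(1) mult.assoc sE)
  qed
qed

text \<open>The involution sends \<open>E1 Q E2\<close> to \<open>s E2 Q s E1\<close>, and multiplication by \<open>u2\<close> and \<open>v1\<close> carries this on to
  \<open>E2 Q E1\<close>; multiplication by \<open>v2\<close> and \<open>u1\<close> goes back.\<close>

lemma off_diagonal_isomorphic:
  fixes E1 E2 :: "'q::ring_1"
  assumes h: "\<And>a x. h a * x = x * h a"
    and s: "\<And>x y. s (x + y) = s x + s y" "\<And>x y. s (x * y) = s y * s x" "\<And>x. s (s x) = x" "\<And>a x. s (h a * x) = h a * s x"
    and u1: "u1 * v1 = E1" "v1 * u1 = s E1" "E1 * E1 = E1" "v1 * E1 = v1" "u1 * s E1 = u1"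
    and u2: "u2 * v2 = E2" "v2 * u2 = s E2" "E2 * E2 = E2" "E2 * u2 = u2" "s E2 * v2 = v2"
  shows "isomorphic_submodules h {E1 * x * E2 | x. True} {E2 * x * E1 | x. True}"
proof -
  let ?M = "{E1 * x * E2 | x. True}" and ?N = "{E2 * x * E1 | x. True}"
  let ?f = "\<lambda>z. u2 * s z * v1"
  have sM: "s E2 * s z * s E1 = s z" if z: "z \<in> ?M" for z
  proof -
    obtain x where x: "z = E1 * x * E2" using z by blast
    have "E1 * z * E2 = z" unfolding x using u1(3) u2(3) by (metis mult.assoc)
    then show ?thesis using s(2) by (metis mult.assoc)
  qed
  have recover: "v2 * ?f z * u1 = s z" if "z \<in> ?M" for z
  proof -
    have "v2 * ?f z * u1 = (v2 * u2) * s z * (v1 * u1)" by (simp only: mult.assoc)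
    then show ?thesis using sM[OF that] u1(2) u2(2) by simp
  qed
  have "bij_betw ?f ?M ?N"
  proof (rule bij_betw_imageI)
    show "inj_on ?f ?M"
    proof (rule inj_onI)
      fix z z' assume "z \<in> ?M" "z' \<in> ?M" "?f z = ?f z'"
      then have "s z = s z'" using recover by metis
      then show "z = z'" using s(3) by metis
    qed
    show "?f ` ?M = ?N"
    proof (intro subset_antisym subsetI)
      fix y assume "y \<in> ?f ` ?M"
      then obtain z where "y = ?f z" by blast
      then have "y = E2 * y * E1" using u2(4) u1(4) by (metis mult.assoc)
      then show "y \<in> ?N" by blast
    next
      fix y assume "y \<in> ?N"
      then obtain x where x: "y = E2 * x * E1" by blast
      let ?z = "s (v2 * y * u1)"
      have "v2 * y * u1 = s E2 * (v2 * y * u1) * s E1" using u2(5) u1(5) by (metis mult.assoc)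
      then have "?z = E1 * ?z * E2" using s(2,3) by (metis mult.assoc)
      then have zM: "?z \<in> ?M" by blast
      have "?f ?z = (u2 * v2) * y * (u1 * v1)" by (simp add: s(3) mult.assoc)
      also have "\<dots> = y" unfolding x u1(1) u2(1) using u1(3) u2(3) by (metis mult.assoc)
      finally show "y \<in> ?f ` ?M" using zM by (intro image_eqI[of _ _ ?z]) simp_all
    qed
  qed
  moreover have "?f (x + y) = ?f x + ?f y" for x y by (simp add: s(1) distrib_left distrib_right)
  moreover have "?f (h a * x) = h a * ?f x" for a x unfolding s(4) by (metis h mult.assoc)
  ultimately show ?thesis unfolding isomorphic_submodules_def by (intro exI[of _ ?f] conjI ballI allI)
qed

text \<open>The kernel of \<open>T\<close> is stable under \<open>\<tau>\<close> because \<open>T\<close> is central and invariant, so both maps descend.\<close>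

lemma quotient_involution:
  fixes T :: "'r::ring_1 \<Rightarrow> 'a::comm_ring_1" and q :: "'r \<Rightarrow> 'q::ring_1"
  assumes q: "quotient_map T q" and \<tau>: "anti_involution \<eta> \<tau>" and T\<tau>: "\<And>x. T (\<tau> x) = T x"
    and add: "\<And>x y. T (x + y) = T x + T y" and comm: "\<And>x y. T (x * y) = T (y * x)"
  shows "induced q T (q x) = T x" and "induced q (q \<circ> \<tau>) (q x) = q (\<tau> x)"
proof -
  interpret Ring_Hom.ring_hom q using q by (simp add: quotient_map_def)
  define y where "y = inv_into UNIV q (q x)"
  have "q y = q x" unfolding y_def by (rule f_inv_into_f) simp
  then have "q (y - x) = 0" by (simp add: hom_distribs)
  then have ker: "T ((y - x) * z) = 0" for z using q by (simp add: quotient_map_def pseudo_kernel_def)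
  have "T (y - x + x) = T (y - x) + T x" by (rule add)
  then have "T y = T x" using ker[of 1] by simp
  then show "induced q T (q x) = T x" by (simp add: induced_def y_def)
  have mult: "\<tau> (x * y) = \<tau> y * \<tau> x" and ad: "\<tau> (x + y) = \<tau> x + \<tau> y" for x y
    using \<tau> by (simp_all add: anti_involution_def)
  have "\<tau> \<circ> \<tau> = id" using \<tau> by (simp add: anti_involution_def)
  then have inv: "\<tau> (\<tau> x) = x" for x by (simp add: fun_eq_iff)
  have "T (\<tau> (y - x) * z) = 0" for z
  proof -
    have "T (\<tau> (y - x) * z) = T (\<tau> (\<tau> z * (y - x)))" by (simp add: mult inv)
    also have "\<dots> = T ((y - x) * \<tau> z)" by (simp only: T\<tau> comm[of "\<tau> z"])
    finally show ?thesis by (simp add: ker)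
  qed
  then have "q (\<tau> (y - x)) = 0" using q by (simp add: quotient_map_def pseudo_kernel_def)
  moreover have "\<tau> y = \<tau> (y - x) + \<tau> x" using ad[of "y - x" x] by simp
  ultimately have "q (\<tau> y) = q (\<tau> x)" by (simp add: hom_distribs)
  then show "induced q (q \<circ> \<tau>) (q x) = q (\<tau> x)" by (simp add: induced_def y_def)
qed

section \<open>Principal reducibility ideal and isomorphic off-diagonal modules\<close>

theorem theorem2p11:
  fixes \<mm> :: "'a::comm_ring_1 set"
    and \<pi> :: "'a \<Rightarrow> 'f::field"
    and \<eta> :: "'a \<Rightarrow> 'r::ring_1"
    and n n1 n2 :: nat
    and \<rho> :: "'r \<Rightarrow> 'a mat"
    and T :: "'r \<Rightarrow> 'a"
    and \<tau>1 \<tau>2 b :: "'r \<Rightarrow> 'f mat"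
    and \<tau> :: "'r \<Rightarrow> 'r"
    and q :: "'r \<Rightarrow> 'q::ring_1"
  assumes "noetherian TYPE('a)" and "local_ring \<mm>" and "residue_map \<mm> \<pi>" and "henselian \<pi>"
    and "algebra_map \<eta>"
    and "matrix_rep \<eta> (\<lambda>a. a) n \<rho>"
    and "T = (\<lambda>x. mat_trace (\<rho> x))"
    and "(of_nat (fact n) :: 'a) dvd 1"
    and "n1 + n2 = n"
    and "matrix_rep \<eta> \<pi> n1 \<tau>1" and "matrix_rep \<eta> \<pi> n2 \<tau>2"
    and "abs_irreducible_rep n1 \<tau>1" and "abs_irreducible_rep n2 \<tau>2"
    and "\<not> isomorphic_reps n1 \<tau>1 n2 \<tau>2"
    and "\<And>x. b x \<in> carrier_mat n1 n2"
    and "\<And>x. map_mat \<pi> (\<rho> x) = four_block_mat (\<tau>1 x) (b x) (0\<^sub>m n2 n1) (\<tau>2 x)"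
    and "\<not> semisimple_rep n (\<lambda>x. map_mat \<pi> (\<rho> x))"
    and "anti_involution \<eta> \<tau>"
    and "T \<circ> \<tau> = T"
    and "mat_trace \<circ> \<tau>1 \<circ> \<tau> = mat_trace \<circ> \<tau>1"
    and "mat_trace \<circ> \<tau>2 \<circ> \<tau> = mat_trace \<circ> \<tau>2"
    and "quotient_map T q"
  shows "(\<forall>e1 \<psi>1 e2 \<psi>2. adapted_data \<eta> \<mm> \<pi> T q \<tau> n1 \<tau>1 n2 \<tau>2 e1 \<psi>1 e2 \<psi>2 \<longrightarrow>
            isomorphic_submodules (q \<circ> \<eta>)
              (off_diagonal n1 e1 \<psi>1 n2 e2 \<psi>2) (off_diagonal n2 e2 \<psi>2 n1 e1 \<psi>1))
       \<and> (\<exists>I. is_reducibility_ideal \<eta> \<mm> \<pi> T n1 \<tau>1 n2 \<tau>2 I \<and> principal_ideal I)"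
proof -
  interpret residual_extension \<mm> \<pi> \<eta> n n1 n2 \<rho> \<tau>1 \<tau>2 b
    using assms by unfold_locales
  have T_eq: "T = residual_extension.T \<rho>" using assms(7) by (simp add: fun_eq_iff T_def)
  have T\<tau>: "T (\<tau> x) = T x" for x using assms(19) by (metis comp_apply)
  have T_add: "T (x + y) = T x + T y" for x y
    unfolding T_eq T_sum sum.distrib[symmetric] by (intro sum.cong refl) (simp add: matrix_repD(1)[OF rho])
  have T_comm': "T (x * y) = T (y * x)" for x y unfolding T_eq by (rule T_comm)
  show ?thesis
  proof (intro conjI allI impI)
    fix e1 \<psi>1 e2 \<psi>2
    assume data: "adapted_data \<eta> \<mm> \<pi> T q \<tau> n1 \<tau>1 n2 \<tau>2 e1 \<psi>1 e2 \<psi>2"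
    let ?s = "induced q (q \<circ> \<tau>)" and ?t = "induced q T" and ?h = "q \<circ> \<eta>"
    interpret q: Ring_Hom.ring_hom q using assms(22) by (simp add: quotient_map_def)
    note ind = quotient_involution[OF assms(22,18) T\<tau> T_add T_comm']
    have surj: "\<exists>x. z = q x" for z using assms(22) by (metis quotient_map_def surjD)
    have \<tau>: "\<tau> (x + y) = \<tau> x + \<tau> y" "\<tau> (x * y) = \<tau> y * \<tau> x" "\<tau> (\<eta> a * x) = \<eta> a * \<tau> x" for x y a
      using assms(18) unfolding anti_involution_def by blast+
    have "\<tau> \<circ> \<tau> = id" using assms(18) by (simp add: anti_involution_def)
    then have \<tau>\<tau>: "\<tau> (\<tau> x) = x" for x by (simp add: fun_eq_iff)
    have s_add: "?s (x + y) = ?s x + ?s y" for x y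
    proof -
      obtain x' y' where "x = q x'" "y = q y'" using surj by metis
      then show ?thesis using ind(2)[of "x' + y'"] by (simp add: ind(2) \<tau> q.hom_add)
    qed
    have s_mult: "?s (x * y) = ?s y * ?s x" for x y
    proof -
      obtain x' y' where "x = q x'" "y = q y'" using surj by metis
      then show ?thesis using ind(2)[of "x' * y'"] by (simp add: ind(2) \<tau> q.hom_mult)
    qed
    have s_inv: "?s (?s x) = x" for x
    proof -
      obtain x' where "x = q x'" using surj by metis
      then show ?thesis by (simp add: ind(2) \<tau>\<tau>)
    qed
    have s_scale: "?s (?h a * x) = ?h a * ?s x" for a x
    proof -
      obtain x' where "x = q x'" using surj by metis
      then have "?s (?h a * x) = q (\<tau> (\<eta> a * x'))" using ind(2)[of "\<eta> a * x'"] by (simp add: q.hom_mult)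
      also have "\<dots> = ?h a * ?s x" unfolding \<tau>(3) using \<open>x = q x'\<close> by (simp add: ind(2) q.hom_mult)
      finally show ?thesis .
    qed
    have t_s: "?t (?s z) = ?t z" for z
    proof -
      obtain x' where "z = q x'" using surj by metis
      then show ?thesis by (simp add: ind T\<tau>)
    qed
    have h_comm: "?h a * x = x * ?h a" for a x
    proof -
      obtain x' where "x = q x'" using surj by metis
      then show ?thesis using algebra_mapD(6)[OF alg, of a x'] by (simp flip: q.hom_mult)
    qed
    have h1: "?h 1 = 1" and hmult: "?h (a * c) = ?h a * ?h c" for a c
      using algebra_mapD(2,4)[OF alg] by (simp_all add: q.hom_mult)
    have d1: "e1 * e1 = e1" "corner_iso ?h e1 n1 \<psi>1" "\<And>z. z \<in> corner e1 \<Longrightarrow> ?t z = mat_trace (\<psi>1 z)" "?s e1 = e1"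
      and d2: "e2 * e2 = e2" "corner_iso ?h e2 n2 \<psi>2" "\<And>z. z \<in> corner e2 \<Longrightarrow> ?t z = mat_trace (\<psi>2 z)" "?s e2 = e2"
      using data unfolding adapted_data_def adapted_corner_def by blast+
    obtain u1 v1 where u1: "u1 * v1 = corner_unit n1 e1 \<psi>1" "v1 * u1 = ?s (corner_unit n1 e1 \<psi>1)"
      "corner_unit n1 e1 \<psi>1 * corner_unit n1 e1 \<psi>1 = corner_unit n1 e1 \<psi>1"
      "v1 * corner_unit n1 e1 \<psi>1 = v1" "u1 * ?s (corner_unit n1 e1 \<psi>1) = u1"
      by (rule corner_unit_conjugate[where h = ?h and s = ?s and t = ?t, OF loc d1(1,2) n_pos(1) h_comm h1 hmult s_mult s_inv s_scale d1(4) d1(3) t_s]) blast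
    obtain u2 v2 where u2: "u2 * v2 = corner_unit n2 e2 \<psi>2" "v2 * u2 = ?s (corner_unit n2 e2 \<psi>2)"
      "corner_unit n2 e2 \<psi>2 * corner_unit n2 e2 \<psi>2 = corner_unit n2 e2 \<psi>2"
      "corner_unit n2 e2 \<psi>2 * u2 = u2" "?s (corner_unit n2 e2 \<psi>2) * v2 = v2"
      by (rule corner_unit_conjugate[where h = ?h and s = ?s and t = ?t, OF loc d2(1,2) n_pos(2) h_comm h1 hmult s_mult s_inv s_scale d2(4) d2(3) t_s]) blast
    show "isomorphic_submodules ?h (off_diagonal n1 e1 \<psi>1 n2 e2 \<psi>2) (off_diagonal n2 e2 \<psi>2 n1 e1 \<psi>1)"
      unfolding off_diagonal_def
      by (rule off_diagonal_isomorphic[where h = ?h and s = ?s, OF h_comm s_add s_mult s_inv s_scale u1 u2])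
  next
    obtain x1 v1 w1 where x1: "rank_one n \<rho> x1 v1 w1"
      "\<And>i j. i < n1 \<Longrightarrow> j < n1 \<Longrightarrow> \<tau>1 x1 $$ (i, j) = (if i = 0 \<and> j = 0 then 1 else 0)"
      "\<And>i j. i < n2 \<Longrightarrow> j < n2 \<Longrightarrow> \<tau>2 x1 $$ (i, j) = (if n1 + i = 0 \<and> n1 + j = 0 then 1 else 0)"
      "\<And>i. \<pi> (v1 i) = \<pi> (\<rho> x1 $$ (i, 0))" "\<And>j. \<pi> (w1 j) = \<pi> (\<rho> x1 $$ (0, j))"
      by (rule exists_rank_one[of 0]) (simp, blast)
    obtain x2 v2 w2 where x2: "rank_one n \<rho> x2 v2 w2"
      "\<And>i j. i < n1 \<Longrightarrow> j < n1 \<Longrightarrow> \<tau>1 x2 $$ (i, j) = (if i = n1 \<and> j = n1 then 1 else 0)"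
      "\<And>i j. i < n2 \<Longrightarrow> j < n2 \<Longrightarrow> \<tau>2 x2 $$ (i, j) = (if n1 + i = n1 \<and> n1 + j = n1 then 1 else 0)"
      "\<And>i. \<pi> (v2 i) = \<pi> (\<rho> x2 $$ (i, n1))" "\<And>j. \<pi> (w2 j) = \<pi> (\<rho> x2 $$ (n1, j))"
      by (rule exists_rank_one[of n1]) (simp, blast)
    have w1: "\<pi> (w1 j) = (if j = 0 then 1 else 0)" if "j < n1" for j
      using that n_pos n_def by (simp add: x1 rho_entries)
    have v1: "\<pi> (v1 i) = (if i = 0 then 1 else 0)" if "i < n" for i
      using that n_pos n_def by (simp add: x1 rho_entries)
    have w2: "\<pi> (w2 j) = (if j = n1 then 1 else 0)" if "j < n" for j
      using that n_pos n_def by (auto simp: x2 rho_entries)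
    have v2: "\<pi> (v2 (n1 + i)) = (if i = 0 then 1 else 0)" if "i < n2" for i
      using that n_pos n_def by (simp add: x2 rho_entries)
    obtain link where "bil n \<rho> w1 link v2 = 1" using exists_linking_element[OF w1 v2] by blast
    then interpret residual_frame \<mm> \<pi> \<eta> n n1 n2 \<rho> \<tau>1 \<tau>2 b x1 x2 link v1 w1 v2 w2
      using x1(1-3) x2(1-3) w1 v1 w2 n_pos by unfold_locales simp_all
    have "is_reducibility_ideal \<eta> \<mm> \<pi> T n1 \<tau>1 n2 \<tau>2 red_ideal"
      unfolding is_reducibility_ideal_def T_eq using red_ideal_splits red_ideal_minimal by blast
    moreover have "principal_ideal red_ideal"
    proof (rule red_ideal_principal[OF assms(18)])
      show "residual_extension.T \<rho> (\<tau> x) = residual_extension.T \<rho> x" for x using T\<tau>[of x] by (simp add: T_eq)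
      show "mat_trace (\<tau>1 (\<tau> x)) = mat_trace (\<tau>1 x)" for x using fun_cong[OF assms(20), of x] by simp
      show "mat_trace (\<tau>2 (\<tau> x)) = mat_trace (\<tau>2 x)" for x using fun_cong[OF assms(21), of x] by simp
    qed
    ultimately show "\<exists>I. is_reducibility_ideal \<eta> \<mm> \<pi> T n1 \<tau>1 n2 \<tau>2 I \<and> principal_ideal I" by blast
  qed
qed

end
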